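(* Assume (HV) and (HP), as defined in the context. For $n\ge1$ let $u^f_n(t,x)=\mathbb E_{\delta_x}(\langle Z_t,f\rangle^n)$, $u_n(t,x)=\mathbb E_{\delta_x}(\langle Z_t,1\rangle^n)$, and let $u_0(t,x)=\mathbb P_{\delta_x}(N_t>0)$. (i) For $f\in C_b(\mathbb R)$ and all $T<\infty$, the function $$(t,x,w)\in[0,T]\times\mathbb R\times\big\{w\in\mathbb C:|w|<(\|f\|_\infty e^{b^*T})^{-1}\big\}\longmapsto H_f(t,x,w)=\mathbb E_{\delta_x}\big(1-e^{w\langle Z_t,f\rangle}\big)\in\mathbb C$$ is well defined. For each $(t,x)\in[0,T]\times\mathbb R$ the function $H_f(t,x,\cdot)$ is analytic in $\{w\in\mathbb C:|w|<(\|f\|_\infty e^{b^*T})^{-1}\}$ and satisfies $$H_f(t,x,w)=P_t\big(1-e^{wf}\big)(x)-\int_0^tP_s\big(b(\cdot)\,H_f^2(t-s,\cdot,w)\big)(x)\,ds.$$ (ii) For all $t\ge0$, $x\in\mathbb R$ and $f\in C_b(\mathbb R)$, $$u_0(t,x)=u_1(t,x)-\int_0^tP_s\big(b(\cdot)\,u_0^2(t-s,\cdot)\big)(x)\,ds,$$ $$u^f_1(t,x)=\mathbb E_{\delta_x}(\langle Z_t,f\rangle)=P_tf(x),$$ and for $n\ge2$ $$u^f_n(t,x)=u^{f^n}_1(t,x)+\int_0^tP_s\Big(b(\cdot)\sum_{k=1}^{n-1}\binom nk\,u^f_{n-k}(t-s,\cdot)\,u^f_k(t-s,\cdot)\Bi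g)(x)\,ds.$$
   Context: Setting and notation. $(X_t)_{t\ge 0}$ is a Markov process on $\mathbb R$ and $\mathbb E_x$ denotes expectation when $X_0=x$. Let $b,d:\mathbb R\to[0,\infty)$ be birth and death rates and $V=b-d$. Consider the branching Markov process started from one individual with trait $x$ (law $\mathbb P_{\delta_x}$, expectation $\mathbb E_{\delta_x}$): individuals behave independently, the trait of each individual moves as $X$, an individual with trait $y$ gives birth to one new individual with the same trait at rate $b(y)$ and dies at rate $d(y)$. If $\mathcal V_t$ is the set of individuals alive at time $t$ and $X^i_t$ is the trait of $i$, put $Z_t=\sum_{i\in\mathcal V_t}\delta_{X^i_t}$, $\langle Z_t,f\rangle=\sum_{i\in\mathcal V_t}f(X^i_t)$, $N_t=\langle Z_t,1\rangle$. The Feynman--Kac semigroup is $P_tf(x)=\mathbb E_{\delta_x}(\langle Z_t,f\rangle)=\mathbb E_x\big(e^{\int_0^tV(X_s)ds}f(X_t)\big)$ (extended linearly to complex-valued functions). $C_b(\mathbb R)$ (bounded continuous), $C_0(\mathbb R)$ (continuous, tending to $0$ at infinity) and $\mathscr B$ (bounded measurable functions) carry the sup norm $\|\cdot\|_\infty$. (HV): HV1) $b,d$ are nonnegative, nonzero and continuous. HV2) $b$ is bounded above by a finite number $b^*>0$. (HP): HP1) There exist a positive function $\Theta_0\in C_0(\mathbb R)$ and a real $\lambda_0$ with $P_t\Theta_0=e^{-\lambda_0t}\Theta_0$ for all $t\ge0$. HP2) There exist a positive finite measure $\mu_0$ charging every nonempty open set, and numbers $\lambda_1>\lambda_0$,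 $H>0$, such that $\int\Theta_0\,d\mu_0=1$ and, with $\Pi(g)=\Theta_0\int g\,d\mu_0$, $\|e^{\lambda_0t}P_t(g)-\Pi(g)\|_\infty\le H\|g\|_\infty e^{-(\lambda_1-\lambda_0)t}$ for all $g\in C_b(\mathbb R)$, $t\ge0$. HP3) $(P_t)$ is strongly continuous and irreducible in $C_0(\mathbb R)$ (irreducible: for every nonzero $f\ge0$ in $C_0(\mathbb R)$ and every nonzero positive finite measure $m$ there is $t\ge 0$ with $\int P_tf\,dm>0$), and $x\mapsto\int_0^tP_sf(x)\,ds$ belongs to $C_b(\mathbb R)$ for every $f\in\mathscr B$ and every $t$. HP4) For any $t>0$, $P_t$ maps $C_b(\mathbb R)$ to $C_0(\mathbb R)$. HP5) With $T_m=\inf\{s\ge0:\langle Z_s,\mathbf 1_{[-m,m]^c}\rangle>0\}$, for every $x\in\mathbb R$, $T_m\to+\infty$ $\mathbb P_{\delta_x}$-a.s. as $m\to\infty$. *)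

theory Defs
  imports "HOL-Probability.Probability"
begin

section \<open>Function spaces on the real line\<close>

text \<open>The space of bounded continuous functions is the library's set \<^const>\<open>bcontfun\<close>.\<close>

definition sup_norm :: "(real \<Rightarrow> 'c::real_normed_vector) \<Rightarrow> real" where
  "sup_norm f = (SUP x. norm (f x))"

definition C0 :: "(real \<Rightarrow> real) set" where
  "C0 = {f. continuous_on UNIV f \<and> (f \<longlongrightarrow> 0) at_infinity}"

definition bounded_measurable :: "(real \<Rightarrow> real) set" where
  "bounded_measurable = {f \<in> borel_measurable borel. bounded (range f)}"


section \<open>The motion and the branching mechanism\<close>

text \<open>
  The motion is a family of laws \<open>motion S x\<close> on a measurable space \<open>paths S\<close> together with the
  coordinate process \<open>pos S t\<close>; \<open>motion S x\<close> is the law started from \<open>x\<close>.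

  The branching process started from one individual with trait \<open>x\<close> is realised on the space of
  families of marks indexed by the nodes of the full binary tree, under the law \<open>tree_law S x\<close>.
  A node is the life of an individual between two successive birth events: when an individual
  represented by node \<open>u\<close> gives birth, it is represented from then on by \<open>u @ [False]\<close>, and the
  newborn by \<open>u @ [True]\<close>.  The mark of a node consists of the trajectory of its trait (with time
  measured from the beginning of the node) and of two exponential clocks, for birth and for death.
\<close>

type_synonym 'a mark = "'a \<times> real \<times> real"
type_synonym 'a tree = "bool list \<Rightarrow> 'a mark"

record 'a branching_model =
  paths :: "'a measure"
  motion :: "real \<Rightarrow> 'a measure"
  pos :: "real \<Rightarrow> 'a \<Rightarrow> real"
  birth :: "real \<Rightarrow> real"
  death :: "real \<Rightarrow> real"
  tree_law :: "real \<Rightarrow> 'a tree measure"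

definition past :: "('a, 'z) branching_model_scheme \<Rightarrow> real \<Rightarrow> 'a set set" where
  "past S s = sigma_sets (space (paths S))
     {pos S r -` B \<inter> space (paths S) | r B. 0 \<le> r \<and> r \<le> s \<and> B \<in> sets borel}"

text \<open>
  Joint measurability in time and randomness is the only regularity required of the trajectories;
  it is what gives a meaning to time integrals along them, and every cadlag process has it.
\<close>

definition markov_process :: "('a, 'z) branching_model_scheme \<Rightarrow> bool" where
  "markov_process S \<longleftrightarrow>
     motion S \<in> borel \<rightarrow>\<^sub>M prob_algebra (paths S) \<and>
     (\<lambda>(t, \<omega>). pos S t \<omega>) \<in> borel_measurable (restrict_space borel {0..} \<Otimes>\<^sub>M paths S) \<and>
     (\<forall>x. AE \<omega> in motion S x. pos S 0 \<omega> = x) \<and>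
     (\<forall>x s t. 0 \<le> s \<longrightarrow> 0 \<le> t \<longrightarrow> (\<forall>A\<in>past S s. \<forall>B\<in>sets borel.
        emeasure (motion S x) {\<omega>\<in>A. pos S (s + t) \<omega> \<in> B} =
        (\<integral>\<^sup>+\<omega>\<in>A. emeasure (motion S (pos S s \<omega>)) {\<omega>'\<in>space (paths S). pos S t \<omega>' \<in> B}
           \<partial>motion S x)))"


subsection \<open>Life of a node\<close>

text \<open>The integral of the rate \<open>r\<close> along the trajectory up to age \<open>a\<close>; it may be infinite.\<close>

definition cum_rate ::
    "('a, 'z) branching_model_scheme \<Rightarrow> (real \<Rightarrow> real) \<Rightarrow> 'a \<Rightarrow> real \<Rightarrow> ennreal" where
  "cum_rate S r \<omega> a = (\<integral>\<^sup>+s\<in>{0..a}. ennreal (r (pos S s \<omega>)) \<partial>lborel)"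

text \<open>
  An event of rate \<open>r\<close> along the trajectory happens when the cumulated rate reaches a standard
  exponential clock that is independent of the trajectory.
\<close>

fun birth_rings :: "('a, 'z) branching_model_scheme \<Rightarrow> 'a mark \<Rightarrow> bool" where
  "birth_rings S (\<omega>, e, e') \<longleftrightarrow> (\<exists>a\<ge>0. ennreal e \<le> cum_rate S (birth S) \<omega> a)"

fun birth_age :: "('a, 'z) branching_model_scheme \<Rightarrow> 'a mark \<Rightarrow> real" where
  "birth_age S (\<omega>, e, e') =
     (if birth_rings S (\<omega>, e, e') then Inf {a. 0 \<le> a \<and> ennreal e \<le> cum_rate S (birth S) \<omega> a}
      else 0)"

fun gives_birth :: "('a, 'z) branching_model_scheme \<Rightarrow> 'a mark \<Rightarrow> bool" where
  "gives_birth S (\<omega>, e, e') \<longleftrightarrow>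
     birth_rings S (\<omega>, e, e') \<and>
     cum_rate S (death S) \<omega> (birth_age S (\<omega>, e, e')) < ennreal e'"

fun active_at_age :: "('a, 'z) branching_model_scheme \<Rightarrow> real \<Rightarrow> 'a mark \<Rightarrow> bool" where
  "active_at_age S a (\<omega>, e, e') \<longleftrightarrow>
     0 \<le> a \<and> cum_rate S (birth S) \<omega> a < ennreal e \<and> cum_rate S (death S) \<omega> a < ennreal e'"

definition birth_trait :: "('a, 'z) branching_model_scheme \<Rightarrow> 'a mark \<Rightarrow> real" where
  "birth_trait S m = pos S (birth_age S m) (fst m)"


subsection \<open>The law of the branching process\<close>

definition mark_space :: "('a, 'z) branching_model_scheme \<Rightarrow> 'a mark measure" where
  "mark_space S = paths S \<Otimes>\<^sub>M borel \<Otimes>\<^sub>M borel"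

definition tree_space :: "('a, 'z) branching_model_scheme \<Rightarrow> 'a tree measure" where
  "tree_space S = PiM UNIV (\<lambda>_. mark_space S)"

definition exp1 :: "real measure" where
  "exp1 = density lborel (\<lambda>x. ennreal (exponential_density 1 x))"

definition mark_law :: "('a, 'z) branching_model_scheme \<Rightarrow> real \<Rightarrow> 'a mark measure" where
  "mark_law S x = motion S x \<Otimes>\<^sub>M exp1 \<Otimes>\<^sub>M exp1"

definition graft :: "'a mark \<Rightarrow> 'a tree \<Rightarrow> 'a tree \<Rightarrow> 'a tree" where
  "graft m \<tau>0 \<tau>1 = (\<lambda>u. case u of [] \<Rightarrow> m | i # v \<Rightarrow> (if i then \<tau>1 v else \<tau>0 v))"

text \<open>
  From a birth event on, the mother and the newborn behave independently of each other and of the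
  past, each as a branching process started from the trait at that event.  By induction on the
  depth this determines \<open>tree_law S\<close>.  The marks below a node that does not give birth are
  irrelevant: such nodes never enter the population.
\<close>

definition branching_process :: "('a, 'z) branching_model_scheme \<Rightarrow> bool" where
  "branching_process S \<longleftrightarrow>
     tree_law S \<in> borel \<rightarrow>\<^sub>M prob_algebra (tree_space S) \<and>
     (\<forall>x. tree_law S x = do {
        m \<leftarrow> mark_law S x;
        \<tau>0 \<leftarrow> tree_law S (birth_trait S m);
        \<tau>1 \<leftarrow> tree_law S (birth_trait S m);
        return (tree_space S) (graft m \<tau>0 \<tau>1)})"


subsection \<open>The population\<close>

fun alive :: "('a, 'z) branching_model_scheme \<Rightarrow> real \<Rightarrow> bool list \<Rightarrow> 'a tree \<Rightarrow> bool" where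
  "alive S t [] \<tau> \<longleftrightarrow> active_at_age S t (\<tau> [])"
| "alive S t (i # u) \<tau> \<longleftrightarrow>
     gives_birth S (\<tau> []) \<and> alive S (t - birth_age S (\<tau> [])) u (\<lambda>v. \<tau> (i # v))"

fun trait :: "('a, 'z) branching_model_scheme \<Rightarrow> real \<Rightarrow> bool list \<Rightarrow> 'a tree \<Rightarrow> real" where
  "trait S t [] \<tau> = pos S t (fst (\<tau> []))"
| "trait S t (i # u) \<tau> = trait S (t - birth_age S (\<tau> [])) u (\<lambda>v. \<tau> (i # v))"

definition population :: "('a, 'z) branching_model_scheme \<Rightarrow> real \<Rightarrow> 'a tree \<Rightarrow> bool list set" where
  "population S t \<tau> = {u. alive S t u \<tau>}"

text \<open>The integral of \<open>f\<close> against the sum \<open>Z t\<close> of the Dirac masses at the traits.\<close>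

definition Z_int ::
    "('a, 'z) branching_model_scheme \<Rightarrow> real \<Rightarrow> (real \<Rightarrow> real) \<Rightarrow> 'a tree \<Rightarrow> real" where
  "Z_int S t f \<tau> = (\<Sum>u\<in>population S t \<tau>. f (trait S t u \<tau>))"

definition N :: "('a, 'z) branching_model_scheme \<Rightarrow> real \<Rightarrow> 'a tree \<Rightarrow> real" where
  "N S t = Z_int S t (\<lambda>_. 1)"


section \<open>The Feynman--Kac semigroup\<close>

definition V :: "('a, 'z) branching_model_scheme \<Rightarrow> real \<Rightarrow> real" where
  "V S y = birth S y - death S y"

text \<open>
  When the birth rate is bounded, the integral of \<open>V\<close> along a trajectory can only fail to exist by
  being minus infinity, in which case its exponential is 0.
\<close>

definition FK_weight :: "('a, 'z) branching_model_scheme \<Rightarrow> real \<Rightarrow> 'a \<Rightarrow> real" where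
  "FK_weight S t \<omega> =
     (if set_integrable lborel {0..t} (\<lambda>s. V S (pos S s \<omega>))
      then exp (LBINT s:{0..t}. V S (pos S s \<omega>)) else 0)"

text \<open>The value type covers real functions and the linear extension to complex ones.\<close>

definition FK ::
    "('a, 'z) branching_model_scheme \<Rightarrow> real \<Rightarrow>
     (real \<Rightarrow> 'c::{banach, second_countable_topology}) \<Rightarrow> real \<Rightarrow> 'c" where
  "FK S t f x = (\<integral>\<omega>. FK_weight S t \<omega> *\<^sub>R f (pos S t \<omega>) \<partial>motion S x)"

definition FK_defined ::
    "('a, 'z) branching_model_scheme \<Rightarrow> real \<Rightarrow>
     (real \<Rightarrow> 'c::{banach, second_countable_topology}) \<Rightarrow> real \<Rightarrow> bool" where
  "FK_defined S t f x \<longleftrightarrow>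
     integrable (motion S x) (\<lambda>\<omega>. FK_weight S t \<omega> *\<^sub>R f (pos S t \<omega>))"

text \<open>
  The integral of \<open>FK S s (g s) x\<close> over \<open>s\<close> in \<open>{0..t}\<close> is a genuine one, not a default value.
\<close>

definition FK_source_defined ::
    "('a, 'z) branching_model_scheme \<Rightarrow> real \<Rightarrow>
     (real \<Rightarrow> real \<Rightarrow> 'c::{banach, second_countable_topology}) \<Rightarrow> real \<Rightarrow> bool" where
  "FK_source_defined S t g x \<longleftrightarrow>
     (\<forall>s\<in>{0..t}. FK_defined S s (g s) x) \<and>
     set_integrable lborel {0..t} (\<lambda>s. FK S s (g s) x)"


section \<open>Standing assumptions\<close>

definition HV :: "('a, 'z) branching_model_scheme \<Rightarrow> real \<Rightarrow> bool" where
  "HV S bstar \<longleftrightarrow>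
     (\<forall>x. 0 \<le> birth S x) \<and> birth S \<noteq> (\<lambda>_. 0) \<and> continuous_on UNIV (birth S) \<and>
     (\<forall>x. 0 \<le> death S x) \<and> death S \<noteq> (\<lambda>_. 0) \<and> continuous_on UNIV (death S) \<and>
     0 < bstar \<and> (\<forall>x. birth S x \<le> bstar)"

definition HP12 :: "('a, 'z) branching_model_scheme \<Rightarrow> bool" where
  "HP12 S \<longleftrightarrow> (\<exists>\<Theta>0 l0 \<mu>0 l1 H.
     \<Theta>0 \<in> C0 \<and> (\<forall>x. 0 < \<Theta>0 x) \<and>
     (\<forall>t\<ge>0. FK S t \<Theta>0 = (\<lambda>x. exp (- l0 * t) * \<Theta>0 x)) \<and>
     finite_measure \<mu>0 \<and> sets \<mu>0 = sets borel \<and>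
     (\<forall>U. open U \<longrightarrow> U \<noteq> {} \<longrightarrow> 0 < emeasure \<mu>0 U) \<and>
     l0 < l1 \<and> 0 < H \<and> (\<integral>y. \<Theta>0 y \<partial>\<mu>0) = 1 \<and>
     (\<forall>g\<in>bcontfun. \<forall>t\<ge>0.
        sup_norm (\<lambda>x. exp (l0 * t) * FK S t g x - \<Theta>0 x * (\<integral>y. g y \<partial>\<mu>0))
          \<le> H * sup_norm g * exp (- (l1 - l0) * t)))"

definition HP3 :: "('a, 'z) branching_model_scheme \<Rightarrow> bool" where
  "HP3 S \<longleftrightarrow>
     (\<forall>f\<in>C0. (\<forall>t\<ge>0. FK S t f \<in> C0) \<and>
        ((\<lambda>t. sup_norm (\<lambda>x. FK S t f x - f x)) \<longlongrightarrow> 0) (at_right 0)) \<and>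
     (\<forall>f\<in>C0. \<forall>m. (\<forall>x. 0 \<le> f x) \<longrightarrow> f \<noteq> (\<lambda>_. 0) \<longrightarrow>
        finite_measure m \<longrightarrow> sets m = sets borel \<longrightarrow> emeasure m UNIV \<noteq> 0 \<longrightarrow>
        (\<exists>t\<ge>0. 0 < (\<integral>x. FK S t f x \<partial>m))) \<and>
     (\<forall>f\<in>bounded_measurable. \<forall>t\<ge>0. (\<lambda>x. LBINT s:{0..t}. FK S s f x) \<in> bcontfun)"

definition HP4 :: "('a, 'z) branching_model_scheme \<Rightarrow> bool" where
  "HP4 S \<longleftrightarrow> (\<forall>t>0. \<forall>f\<in>bcontfun. FK S t f \<in> C0)"

definition exit_time :: "('a, 'z) branching_model_scheme \<Rightarrow> real \<Rightarrow> 'a tree \<Rightarrow> ereal" where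
  "exit_time S m \<tau> = Inf (ereal ` {s. 0 \<le> s \<and> 0 < Z_int S s (indicator (- {-m..m})) \<tau>})"

definition HP5 :: "('a, 'z) branching_model_scheme \<Rightarrow> bool" where
  "HP5 S \<longleftrightarrow> (\<forall>x. AE \<tau> in tree_law S x. ((\<lambda>m. exit_time S m \<tau>) \<longlongrightarrow> \<infinity>) at_top)"

definition HP :: "('a, 'z) branching_model_scheme \<Rightarrow> bool" where
  "HP S \<longleftrightarrow> HP12 S \<and> HP3 S \<and> HP4 S \<and> HP5 S"


section \<open>Moments and generating function\<close>

definition moment ::
    "('a, 'z) branching_model_scheme \<Rightarrow> (real \<Rightarrow> real) \<Rightarrow> nat \<Rightarrow> real \<Rightarrow> real \<Rightarrow> real" where
  "moment S f n t x = (\<integral>\<tau>. Z_int S t f \<tau> ^ n \<partial>tree_law S x)"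

definition survival :: "('a, 'z) branching_model_scheme \<Rightarrow> real \<Rightarrow> real \<Rightarrow> real" where
  "survival S t x = measure (tree_law S x) {\<tau> \<in> space (tree_law S x). 0 < N S t \<tau>}"

text \<open>The quotient of extended reals makes the disc the whole plane when \<open>f = 0\<close>.\<close>

definition disc :: "(real \<Rightarrow> real) \<Rightarrow> real \<Rightarrow> real \<Rightarrow> complex set" where
  "disc f bstar T = {w. ereal (cmod w) < inverse (ereal (sup_norm f * exp (bstar * T)))}"

definition H_fun ::
    "('a, 'z) branching_model_scheme \<Rightarrow> (real \<Rightarrow> real) \<Rightarrow> real \<Rightarrow> real \<Rightarrow> complex \<Rightarrow> complex" where
  "H_fun S f t x w = (\<integral>\<tau>. 1 - exp (w * of_real (Z_int S t f \<tau>)) \<partial>tree_law S x)"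

end

theory Submission
  imports Defs
begin

text \<open>
  Write \<open>u t x\<close> for the mean of \<open>\<Psi> (Z t)\<close> with \<open>\<Psi> 0 = 0\<close>; the cases of interest are
  \<open>\<Psi> z = 1 - exp (w * z)\<close>, the positive powers of \<open>z\<close>, and the indicator of \<open>z \<noteq> 0\<close>.  Conditioning on
  the first event in the life of the ancestor gives a renewal equation for \<open>u\<close> in terms of the
  operators \<open>Q\<close> that kill the motion at rate \<open>b + d\<close>, with source \<open>b * k\<close>, where \<open>k\<close> is the mean
  of \<open>\<Psi>\<close> at the sum of two independent copies of \<open>Z\<close>.  Since \<open>b - d = - (b + d) + 2 * b\<close>,
  Duhamel's formula trades \<open>Q\<close> for the Feynman--Kac operators \<open>P\<close>, at the price of replacing the
  source by \<open>b * (k - 2 * u)\<close>.  In the three cases \<open>k - 2 * u\<close> is minus the square of \<open>u\<close>, a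
  binomial sum of lower moments, and again minus the square of \<open>u\<close>.

  All this is carried out for nonnegative \<open>\<Psi>\<close> with values in \<open>[0, \<infinity>]\<close>, where no integrability is
  needed; signed and complex \<open>\<Psi>\<close> follow by linearity.  Finiteness comes from domination of the
  population by a Yule process of rate \<open>bstar\<close>, whose size at time \<open>t\<close> is geometric.  Its
  exponential moment of order \<open>c\<close> is finite when \<open>exp c * (1 - exp (- bstar * t)) < 1\<close>, and this
  holds for \<open>c < exp (- bstar * t)\<close>, which is where the radius of the disc comes from.
\<close>

section \<open>Exponential clocks and time change\<close>

text \<open>Three features of the setting shape the proof. The Markov property is given only for
  events about one future position, whereas the weights depend on a whole stretch of the trajectory.
  It is extended by expanding the exponential of a bounded nonnegative rate into iterated time
  integrals, so that one position after another can be conditioned on. Next, the death rate may be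
  unbounded and its integral along a trajectory infinite. Hence the weights live in extended
  numbers, death is reached by truncation, and in Duhamel's formula only the birth rate is
  integrated explicitly. Finally, a sum over an infinite population is 0 by default, so additivity
  over the two subtrees at a birth is available only once the population is known to be finite
  almost surely. The Yule bound is therefore proved first, for populations cut at depth
  \<open>n\<close>, by recursion on \<open>n\<close>, and the renewal equation comes after
  it.\<close>

definition exp_neg :: "ennreal \<Rightarrow> ennreal" where
  "exp_neg D = (if D = \<top> then 0 else ennreal (exp (- enn2real D)))"

lemma exp_neg_measurable [measurable]: "exp_neg \<in> borel_measurable borel"
  unfolding exp_neg_def by measurable

lemma exp_neg_ennreal: "0 \<le> d \<Longrightarrow> exp_neg (ennreal d) = ennreal (exp (- d))"
  by (simp add: exp_neg_def)

lemma exp_neg_le_1: "exp_neg D \<le> 1"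
  by (simp add: exp_neg_def)

lemma exp_neg_add: "exp_neg (C + D) = exp_neg C * exp_neg D"
  by (cases C; cases D) (auto simp: exp_neg_def exp_add[symmetric] ennreal_mult[symmetric] simp flip: ennreal_plus)

lemma exp_neg_antimono: "C \<le> D \<Longrightarrow> exp_neg D \<le> exp_neg C"
  by (cases C; cases D) (auto simp: exp_neg_def top_unique)

text \<open>Continuity has to include the point \<open>\<top>\<close>: the cumulated rate of a
  truncated death rate may increase to infinity.\<close>

lemma tendsto_exp_neg:
  assumes "(C \<longlongrightarrow> D) F"
  shows "((\<lambda>n. exp_neg (C n)) \<longlongrightarrow> exp_neg D) F"
proof (cases "D = \<top>")
  case False
  then obtain d where d: "0 \<le> d" "D = ennreal d" by (cases D) auto
  have ev: "eventually (\<lambda>n. C n < \<top>) F"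
    using order_tendstoD(2)[OF assms, of \<top>] False by (simp add: less_top)
  have "((\<lambda>n. enn2real (C n)) \<longlongrightarrow> enn2real D) F"
    using assms d by (auto intro!: tendsto_enn2real)
  then have "((\<lambda>n. ennreal (exp (- enn2real (C n)))) \<longlongrightarrow> ennreal (exp (- enn2real D))) F"
    by (intro tendsto_ennrealI tendsto_exp tendsto_minus)
  moreover have "eventually (\<lambda>n. ennreal (exp (- enn2real (C n))) = exp_neg (C n)) F"
    using ev by eventually_elim (auto simp: exp_neg_def)
  ultimately have "((\<lambda>n. exp_neg (C n)) \<longlongrightarrow> ennreal (exp (- enn2real D))) F"
    by (rule Lim_transform_eventually)
  then show ?thesis using False by (simp add: exp_neg_def[of D])
next
  case True
  have "((\<lambda>n. exp_neg (C n)) \<longlongrightarrow> 0) F"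
  proof (rule order_tendstoI)
    fix a :: ennreal assume "0 < a"
    obtain r where r: "0 < r" "ennreal r < a"
      by (metis \<open>0 < a\<close> dense ennreal_cases ennreal_less_zero_iff less_top not_less_zero order.strict_trans top.not_eq_extremum)
    define m where "m = max 0 (- ln r)"
    have "eventually (\<lambda>n. ennreal m < C n) F"
      using order_tendstoD(1)[OF assms, of "ennreal m"] True by simp
    then show "eventually (\<lambda>n. exp_neg (C n) < a) F"
    proof eventually_elim
      case (elim n)
      have "exp_neg (C n) \<le> exp_neg (ennreal m)" using elim by (intro exp_neg_antimono) auto
      also have "\<dots> = ennreal (exp (- m))" by (intro exp_neg_ennreal) (simp add: m_def)
      also have "\<dots> \<le> ennreal r"
      proof (rule ennreal_leI)
        have "exp (- m) \<le> exp (ln r)" by (auto simp: m_def)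
        then show "exp (- m) \<le> r" using r by simp
      qed
      finally show ?case using r by (simp add: order.strict_trans1)
    qed
  qed auto
  then show ?thesis using True by (simp add: exp_neg_def)
qed

lemma sets_exp1 [measurable_cong, simp]: "sets exp1 = sets borel"
  by (simp add: exp1_def)

lemma space_exp1 [simp]: "space exp1 = UNIV"
  by (simp add: exp1_def)

lemma prob_space_exp1: "prob_space exp1"
  unfolding exp1_def using prob_space_exponential_density[of 1] by simp

text \<open>Nonpositive levels are left out, a null set for the clock; on positive levels a clock
  rings at a genuine hitting time.\<close>

lemma nn_integral_exp1:
  assumes [measurable]: "h \<in> borel_measurable borel"
  shows "(\<integral>\<^sup>+e. h e \<partial>exp1) = (\<integral>\<^sup>+e\<in>{0<..}. ennreal (exp (- e)) * h e \<partial>lborel)"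
proof -
  have "(\<integral>\<^sup>+e. h e \<partial>exp1) = (\<integral>\<^sup>+e. ennreal (exponential_density 1 e) * h e \<partial>lborel)"
    unfolding exp1_def by (subst nn_integral_density) auto
  also have "\<dots> = (\<integral>\<^sup>+e\<in>{0<..}. ennreal (exp (- e)) * h e \<partial>lborel)"
    using AE_lborel_singleton[of "0::real"]
    by (intro nn_integral_cong_AE) (auto simp: exponential_density_def indicator_def)
  finally show ?thesis .
qed

lemma emeasure_exp1_greaterThan: "0 \<le> d \<Longrightarrow> emeasure exp1 {d<..} = ennreal (exp (- d))"
proof -
  assume d: "0 \<le> d"
  have "emeasure exp1 {d<..} = (\<integral>\<^sup>+e. indicator {d<..} e \<partial>exp1)"
    by simp
  also have "\<dots> = (\<integral>\<^sup>+e. ennreal (exp (- e)) * indicator {d..} e \<partial>lborel)"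
    unfolding nn_integral_exp1[OF borel_measurable_indicator[OF borel_open[OF open_greaterThan]]]
    using AE_lborel_singleton[of d] d
    by (intro nn_integral_cong_AE) (auto simp: indicator_def)
  also have "\<dots> = ennreal (0 - (- exp (- d)))"
  proof (rule nn_integral_FTC_atLeast)
    show "((\<lambda>x. - exp (- x)) has_real_derivative exp (- x)) (at x)" for x :: real
      by (rule derivative_eq_intros refl | simp)+
    show "((\<lambda>x::real. - exp (- x)) \<longlongrightarrow> 0) at_top"
      using tendsto_minus[OF filterlim_compose[OF exp_at_bot filterlim_uminus_at_bot_at_top]] by simp
  qed auto
  finally show ?thesis by simp
qed

text \<open>So \<open>exp_neg D\<close> is the probability that a clock has not rung when the
  cumulated rate is \<open>D\<close>; for infinite \<open>D\<close> it is 0 because clocks are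
  finite.\<close>

lemma nn_integral_exp1_clock: "(\<integral>\<^sup>+e. indicator {e. D < ennreal e} e \<partial>exp1) = exp_neg D"
proof (cases "D = \<top>")
  case True then show ?thesis by (simp add: exp_neg_def)
next
  case False
  then obtain d where d: "0 \<le> d" "D = ennreal d" by (cases D) auto
  then have "{e. D < ennreal e} = {d<..}" by (auto simp: ennreal_less_iff)
  then show ?thesis using d by (simp add: emeasure_exp1_greaterThan exp_neg_ennreal)
qed

section \<open>The cumulated rate along one trajectory, its inverse, and the change of
  variables\<close>

locale bounded_rate =
  fixes c :: "real \<Rightarrow> real" and K :: real
  assumes c_meas [measurable]: "c \<in> borel_measurable borel"
    and c_nonneg: "\<And>s. 0 \<le> c s" and c_le: "\<And>s. c s \<le> K"
begin

definition cum :: "real \<Rightarrow> real" where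
  "cum a = enn2real (\<integral>\<^sup>+s\<in>{0..a}. ennreal (c s) \<partial>lborel)"

text \<open>The generalised inverse of \<open>cum\<close>. The cumulated rate may be constant on
  intervals, so the first age at level \<open>e\<close> is taken; it is meaningful only for levels
  that are reached.\<close>

definition hit :: "real \<Rightarrow> real" where
  "hit e = Inf {a. 0 \<le> a \<and> e \<le> cum a}"

lemma K_nonneg: "0 \<le> K"
  using c_nonneg[of 0] c_le[of 0] by simp

lemma nn_integral_c_le: "(\<integral>\<^sup>+s\<in>A. ennreal (c s) \<partial>lborel) \<le> ennreal K * emeasure lborel A"
  if "A \<in> sets borel"
proof -
  have "(\<integral>\<^sup>+s\<in>A. ennreal (c s) \<partial>lborel) \<le> (\<integral>\<^sup>+s\<in>A. ennreal K \<partial>lborel)"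
    by (intro nn_integral_mono mult_right_mono ennreal_leI c_le) auto
  then show ?thesis using that by (simp add: nn_integral_cmult_indicator)
qed

lemma ennreal_cum: "ennreal (cum a) = (\<integral>\<^sup>+s\<in>{0..a}. ennreal (c s) \<partial>lborel)"
proof -
  have "(\<integral>\<^sup>+s\<in>{0..a}. ennreal (c s) \<partial>lborel) < \<top>"
    using nn_integral_c_le[of "{0..a}"]
    by (rule order.strict_trans1) (auto simp: ennreal_mult_less_top emeasure_lborel_Icc_eq)
  then show ?thesis by (simp add: cum_def)
qed

lemma cum_nonneg [simp]: "0 \<le> cum a"
  by (simp add: cum_def)

lemma nn_integral_c_Ioc:
  assumes "0 \<le> s" "s \<le> t"
  shows "(\<integral>\<^sup>+r\<in>{s<..t}. ennreal (c r) \<partial>lborel) = ennreal (cum t - cum s)" "cum s \<le> cum t"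
    "cum t - cum s \<le> K * (t - s)"
proof -
  have U: "{0..t} = {0..s} \<union> {s<..t}" using assms by auto
  have *: "ennreal (cum t) = ennreal (cum s) + (\<integral>\<^sup>+r\<in>{s<..t}. ennreal (c r) \<partial>lborel)"
    unfolding ennreal_cum U
    by (subst nn_integral_disjoint_pair) auto
  show le: "cum s \<le> cum t"
    by (metis * cum_nonneg ennreal_le_iff le_iff_add)
  show eq: "(\<integral>\<^sup>+r\<in>{s<..t}. ennreal (c r) \<partial>lborel) = ennreal (cum t - cum s)"
    using * by (simp add: ennreal_minus[symmetric])
  have "ennreal (cum t - cum s) \<le> ennreal (K * (t - s))"
    using nn_integral_c_le[of "{s<..t}"] assms K_nonneg by (simp add: eq ennreal_mult)
  then show "cum t - cum s \<le> K * (t - s)"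
    using assms K_nonneg by (simp add: ennreal_le_iff)
qed

lemma cum_0 [simp]: "cum 0 = 0"
proof -
  have "AE x in lborel. ennreal (c x) * indicator {0..0} x = 0"
    using AE_lborel_singleton[of "0::real"] by eventually_elim (auto simp: indicator_def)
  then have "(\<integral>\<^sup>+s\<in>{0..0}. ennreal (c s) \<partial>lborel) = 0" by (subst nn_integral_0_iff_AE) auto
  then show ?thesis by (simp add: cum_def)
qed

lemma cum_neg [simp]: "a \<le> 0 \<Longrightarrow> cum a = 0"
  by (cases "a = 0") (auto simp: cum_def)

lemma cum_mono: "s \<le> t \<Longrightarrow> cum s \<le> cum t"
  using nn_integral_c_Ioc(2)[of s t] by (cases "0 \<le> s") auto

lemma cum_Lipschitz: "s \<le> t \<Longrightarrow> cum t - cum s \<le> K * (t - s)"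
proof (cases "0 \<le> s")
  case False
  assume "s \<le> t"
  show ?thesis
  proof (cases "0 \<le> t")
    case True
    have "cum t - cum 0 \<le> K * (t - 0)" using True by (intro nn_integral_c_Ioc) auto
    also have "\<dots> \<le> K * (t - s)" using False K_nonneg by (intro mult_left_mono) auto
    finally show ?thesis using False by simp
  next
    case f: False
    then show ?thesis using False \<open>s \<le> t\<close> K_nonneg by simp
  qed
qed (auto intro: nn_integral_c_Ioc)

lemma continuous_on_cum: "continuous_on UNIV cum"
proof -
  have "K-lipschitz_on UNIV cum"
  proof (rule lipschitz_onI)
    fix x y :: real
    show "dist (cum x) (cum y) \<le> K * dist x y"
      using cum_Lipschitz[of x y] cum_Lipschitz[of y x] cum_mono[of x y] cum_mono[of y x]
      by (cases "x \<le> y") (auto simp: dist_real_def abs_if)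
  qed (rule K_nonneg)
  then show ?thesis by (rule lipschitz_on_continuous_on)
qed

lemma cum_measurable [measurable]: "cum \<in> borel_measurable borel"
  by (intro borel_measurable_continuous_onI continuous_on_cum)

text \<open>Continuity of \<open>cum\<close> makes the set under \<open>Inf\<close> closed, so the
  infimum is attained, and \<open>hit\<close> and \<open>cum\<close> form a Galois connection. The
  premises on \<open>a0\<close> say that the level is reached, so the set is not empty.\<close>

lemma hit_le_iff:
  assumes "0 \<le> a0" "e \<le> cum a0" "0 \<le> a"
  shows "hit e \<le> a \<longleftrightarrow> e \<le> cum a"
proof -
  let ?A = "{a. 0 \<le> a \<and> e \<le> cum a}"
  have "closed ?A"
  proof -
    have "?A = {0..} \<inter> cum -` {e..}" by auto
    then show ?thesis
      using continuous_closed_vimage[of "{e..}" cum] continuous_on_cum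
      by (auto intro!: closed_Int simp: continuous_on_eq_continuous_at)
  qed
  then have "hit e \<in> ?A"
    unfolding hit_def using assms by (intro closed_contains_Inf) auto
  moreover have "hit e \<le> a" if "e \<le> cum a"
    unfolding hit_def using that assms by (intro cInf_lower) auto
  ultimately show ?thesis using cum_mono[of "hit e" a] by auto
qed

lemma hit_nonneg: "0 \<le> a0 \<Longrightarrow> e \<le> cum a0 \<Longrightarrow> 0 \<le> hit e"
  unfolding hit_def by (intro cInf_greatest) auto

text \<open>The cumulated rate is continuous and starts at 0, hence cannot jump over
  \<open>e\<close>.\<close>

lemma cum_hit:
  assumes "0 \<le> a0" "e \<le> cum a0" "0 \<le> e"
  shows "cum (hit e) = e"
proof -
  have h: "0 \<le> hit e" using hit_nonneg assms by blast
  have ge: "e \<le> cum (hit e)" using hit_le_iff[of a0 e "hit e"] assms h by simp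
  have "\<exists>x\<ge>0. x \<le> hit e \<and> cum x = e"
    using IVT'[of cum 0 e "hit e"] ge assms h continuous_on_subset[OF continuous_on_cum] by auto
  then obtain x where "0 \<le> x" "x \<le> hit e" "cum x = e" by auto
  moreover have "hit e \<le> x" using calculation hit_le_iff[of a0 e x] assms by simp
  ultimately show ?thesis by simp
qed

text \<open>The cut-off at \<open>cum t\<close> keeps to levels where the Galois connection holds;
  beyond, the infimum may be over the empty set.\<close>

lemma hit_measurable: "(\<lambda>e. if e \<le> cum t then hit e else 0) \<in> borel_measurable borel" if "0 \<le> t"
proof (rule borel_measurable_iff_le[THEN iffD2], rule allI)
  fix a :: real
  have "{w. (if w \<le> cum t then hit w else 0) \<le> a} =
    (if 0 \<le> a then {w. w \<le> cum a \<or> cum t < w} else {})"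
  proof (cases "0 \<le> a")
    case True
    then show ?thesis using hit_le_iff[OF that _ True] cum_mono by auto
  next
    case False
    then show ?thesis using hit_nonneg[OF that] by force
  qed
  also have "\<dots> \<in> sets borel" by auto
  finally show "{w \<in> space borel. (if w \<le> cum t then hit w else 0) \<le> a} \<in> sets borel" by simp
qed

text \<open>The substitution \<open>e = cum r\<close> for a rate that is merely measurable. Instead
  of differentiating, two measures are compared: the image under \<open>hit\<close> of Lebesgue
  measure on the levels up to \<open>cum t\<close>, and the measure with density \<open>c\<close> on
  the times up to \<open>t\<close>. They agree on all rays by the Galois connection.\<close>

lemma nn_integral_hit:
  assumes t: "0 \<le> t" and [measurable]: "\<phi> \<in> borel_measurable borel"
  shows "(\<integral>\<^sup>+e\<in>{0<..cum t}. \<phi> (hit e) \<partial>lborel) = (\<integral>\<^sup>+r\<in>{0<..t}. ennreal (c r) * \<phi> r \<partial>lborel)"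
proof -
  define T where "T = (\<lambda>e. if e \<le> cum t then hit e else 0)"
  have [measurable]: "T \<in> borel_measurable borel"
    unfolding T_def using hit_measurable[OF t] .
  have cp [measurable]: "(\<lambda>r. ennreal (c r) * indicator {0<..t} r) \<in> borel_measurable lborel" by measurable
  have [measurable]: "indicator {0<..cum t} \<in> borel_measurable lborel" by measurable
  define M where "M = distr (density lborel (indicator {0<..cum t})) borel T"
  define L where "L = density lborel (\<lambda>r. ennreal (c r) * indicator {0<..t} r)"
  have eM: "emeasure M {x<..} = (if x < t then ennreal (cum t - cum (max 0 x)) else 0)" for x
  proof -
    have "emeasure M {x<..} = emeasure (density lborel (indicator {0<..cum t})) (T -` {x<..})"
      unfolding M_def by (subst emeasure_distr) auto
    also have "\<dots> = (\<integral>\<^sup>+e. indicator {0<..cum t} e * indicator (T -` {x<..}) e \<partial>lborel)"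
      using measurable_sets_borel[of T borel "{x<..}"] by (subst emeasure_density) auto
    also have "\<dots> = (\<integral>\<^sup>+e. indicator {cum (max 0 x)<..cum t} e \<partial>lborel)"
    proof (cases "x < 0")
      case True
      show ?thesis
      proof (intro nn_integral_cong)
        fix e
        have "e \<in> {0<..cum t} \<Longrightarrow> x < hit e" using hit_nonneg[OF t, of e] True by auto
        then show "indicator {0<..cum t} e * indicator (T -` {x<..}) e = (indicator {cum (max 0 x)<..cum t} e :: ennreal)"
          using True by (auto simp: T_def indicator_def)
      qed
    next
      case False
      have "e \<in> {0<..cum t} \<Longrightarrow> x < hit e \<longleftrightarrow> cum x < e" for e
        using hit_le_iff[OF t, of e x] False by auto
      moreover have "0 < e" if "cum x < e" for e using that cum_nonneg[of x] by linarith
      ultimately show ?thesis using False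
        by (intro nn_integral_cong) (auto simp: T_def indicator_def max_def)
    qed
    also have "\<dots> = ennreal (cum t - cum (max 0 x))" if "x < t"
      using cum_mono[of "max 0 x" t] that t by simp
    moreover have "{cum (max 0 x)<..cum t} = {}" if "\<not> x < t" using cum_mono[of t "max 0 x"] that by auto
    ultimately show ?thesis by (cases "x < t") auto
  qed
  have eL: "emeasure L {x<..} = (if x < t then ennreal (cum t - cum (max 0 x)) else 0)" for x
  proof -
    have "emeasure L {x<..} = (\<integral>\<^sup>+r. ennreal (c r) * indicator {0<..t} r * indicator {x<..} r \<partial>lborel)"
      unfolding L_def by (subst emeasure_density) auto
    also have "\<dots> = (\<integral>\<^sup>+r\<in>{max 0 x<..t}. ennreal (c r) \<partial>lborel)"
      by (intro nn_integral_cong) (auto simp: indicator_def)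
    also have "\<dots> = (if x < t then ennreal (cum t - cum (max 0 x)) else 0)"
    proof (cases "x < t")
      case True
      then show ?thesis using nn_integral_c_Ioc(1)[of "max 0 x" t] t by simp
    next
      case False
      then have "{max 0 x<..t} = {}" by auto
      then show ?thesis using False by simp
    qed
    finally show ?thesis .
  qed
  have "M = L"
    by (rule measure_eqI_lessThan) (auto simp: eM eL M_def[THEN arg_cong[where f=sets]] L_def[THEN arg_cong[where f=sets]])
  then have "(\<integral>\<^sup>+x. \<phi> x \<partial>M) = (\<integral>\<^sup>+x. \<phi> x \<partial>L)" by simp
  moreover have "(\<integral>\<^sup>+x. \<phi> x \<partial>M) = (\<integral>\<^sup>+e\<in>{0<..cum t}. \<phi> (hit e) \<partial>lborel)"
    unfolding M_def
    by (simp add: nn_integral_distr nn_integral_density) (auto intro!: nn_integral_cong simp: T_def indicator_def)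
  moreover have "(\<integral>\<^sup>+x. \<phi> x \<partial>L) = (\<integral>\<^sup>+r\<in>{0<..t}. ennreal (c r) * \<phi> r \<partial>lborel)"
    unfolding L_def
    by (simp add: nn_integral_density) (auto intro!: nn_integral_cong simp: ac_simps)
  ultimately show ?thesis by simp
qed

text \<open>The substitution in the other direction: the previous formula is applied to
  \<open>\<phi> (cum r)\<close> restricted to \<open>r > s\<close>, and \<open>cum\<close> undoes
  \<open>hit\<close>.\<close>

lemma nn_integral_cum:
  assumes s: "0 \<le> s" "s \<le> t" and [measurable]: "\<phi> \<in> borel_measurable borel"
  shows "(\<integral>\<^sup>+r\<in>{s<..t}. ennreal (c r) * \<phi> (cum r) \<partial>lborel) = (\<integral>\<^sup>+e\<in>{cum s<..cum t}. \<phi> e \<partial>lborel)"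
proof -
  have "(\<integral>\<^sup>+r\<in>{s<..t}. ennreal (c r) * \<phi> (cum r) \<partial>lborel) =
    (\<integral>\<^sup>+r\<in>{0<..t}. ennreal (c r) * (\<phi> (cum r) * indicator {s<..} r) \<partial>lborel)"
    using s by (intro nn_integral_cong) (auto simp: indicator_def)
  also have "\<dots> = (\<integral>\<^sup>+e\<in>{0<..cum t}. \<phi> (cum (hit e)) * indicator {s<..} (hit e) \<partial>lborel)"
    using s by (subst nn_integral_hit[symmetric]) auto
  also have "\<dots> = (\<integral>\<^sup>+e\<in>{cum s<..cum t}. \<phi> e \<partial>lborel)"
  proof (intro nn_integral_cong)
    fix e
    have "s < hit e \<longleftrightarrow> cum s < e" if "0 < e" "e \<le> cum t"
      using hit_le_iff[of t e s] s that by auto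
    moreover have "cum (hit e) = e" if "0 < e" "e \<le> cum t"
      using cum_hit[of t e] s that by auto
    moreover have "0 < e" if "cum s < e" using that cum_nonneg[of s] by linarith
    ultimately show "\<phi> (cum (hit e)) * indicator {s<..} (hit e) * indicator {0<..cum t} e = \<phi> e * indicator {cum s<..cum t} e"
      by (auto simp: indicator_def)
  qed
  finally show ?thesis .
qed

text \<open>Integration against the rate raises the order of a term of the exponential series by
  one; this drives the recursion in \<open>rate_power_Suc\<close>.\<close>

lemma nn_integral_cum_power:
  assumes s: "0 \<le> s" "s \<le> t"
  shows "(\<integral>\<^sup>+r\<in>{s<..t}. ennreal (c r) * ennreal ((cum t - cum r) ^ n / fact n) \<partial>lborel)
    = ennreal ((cum t - cum s) ^ Suc n / fact (Suc n))"
proof -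
  have le: "cum s \<le> cum t" using s by (intro cum_mono)
  have "(\<integral>\<^sup>+r\<in>{s<..t}. ennreal (c r) * ennreal ((cum t - cum r) ^ n / fact n) \<partial>lborel)
    = (\<integral>\<^sup>+e\<in>{cum s<..cum t}. ennreal ((cum t - e) ^ n / fact n) \<partial>lborel)"
    using nn_integral_cum[OF s, of "\<lambda>v. ennreal ((cum t - v) ^ n / fact n)"] by simp
  also have "\<dots> = (\<integral>\<^sup>+e\<in>{cum s..cum t}. ennreal ((cum t - e) ^ n / fact n) \<partial>lborel)"
    using AE_lborel_singleton[of "cum s"]
    by (intro nn_integral_cong_AE) (auto simp: indicator_def)
  also have "\<dots> = ennreal (- ((cum t - cum t) ^ Suc n / fact (Suc n)) - (- ((cum t - cum s) ^ Suc n / fact (Suc n))))"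
  proof (rule nn_integral_FTC_Icc[OF _ _ _ le])
    fix x
    show "((\<lambda>x. - ((cum t - x) ^ Suc n / fact (Suc n))) has_real_derivative (cum t - x) ^ n / fact n) (at x)"
      by (rule derivative_eq_intros refl | simp)+
  qed auto
  finally show ?thesis by simp
qed

text \<open>The integral behind Duhamel's formula on one trajectory. The exponent is doubled: one
  factor comes from the growth before \<open>r\<close>, the other from the killing after
  \<open>r\<close>.\<close>

lemma nn_integral_cum_exp:
  assumes t: "0 \<le> t"
  shows "(\<integral>\<^sup>+r\<in>{0<..t}. ennreal (c r) * ennreal (2 * exp (2 * cum r)) \<partial>lborel) = ennreal (exp (2 * cum t) - 1)"
proof -
  have "(\<integral>\<^sup>+r\<in>{0<..t}. ennreal (c r) * ennreal (2 * exp (2 * cum r)) \<partial>lborel)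
    = (\<integral>\<^sup>+e\<in>{0<..cum t}. ennreal (2 * exp (2 * e)) \<partial>lborel)"
    using nn_integral_cum[OF _ t, of "\<lambda>v. ennreal (2 * exp (2 * v))"] by simp
  also have "\<dots> = (\<integral>\<^sup>+e\<in>{0..cum t}. ennreal (2 * exp (2 * e)) \<partial>lborel)"
    using AE_lborel_singleton[of "0::real"]
    by (intro nn_integral_cong_AE) (auto simp: indicator_def)
  also have "\<dots> = ennreal (exp (2 * cum t) - exp (2 * 0))"
  proof (rule nn_integral_FTC_Icc[OF _ _ _ cum_nonneg])
    fix x
    show "((\<lambda>x. exp (2 * x)) has_real_derivative 2 * exp (2 * x)) (at x)"
      by (rule derivative_eq_intros refl | simp)+
  qed auto
  finally show ?thesis by simp
qed

end

section \<open>The motion\<close>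

lemma nn_integral_Ioc_shift:
  fixes s t :: real
  assumes [measurable]: "\<phi> \<in> borel_measurable borel"
  shows "(\<integral>\<^sup>+r\<in>{s<..s + t}. \<phi> r \<partial>lborel) = (\<integral>\<^sup>+r\<in>{0<..t}. \<phi> (s + r) \<partial>lborel)"
  by (subst nn_integral_real_affine[where c=1 and t=s])
     (auto intro!: nn_integral_cong simp: indicator_def)

lemma ennreal_exp_eq_suminf:
  assumes "0 \<le> v"
  shows "ennreal (exp v) = (\<Sum>n. ennreal (v ^ n / fact n))"
proof -
  have *: "(\<lambda>n. v ^ n / fact n) sums exp v"
    using exp_converges[of v] by (simp add: divide_inverse_commute)
  have "(\<Sum>n. ennreal (v ^ n / fact n)) = ennreal (\<Sum>n. v ^ n / fact n)"
    using assms by (intro suminf_ennreal2 sums_summable[OF *]) simp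
  then show ?thesis
    by (simp only: sums_unique[OF *, symmetric])
qed

locale markov_motion =
  fixes S :: "('a, 'z) branching_model_scheme"
  assumes markov: "markov_process S"
begin

text \<open>Times below 0 are frozen at 0, so that joint measurability holds on the whole real line
  and needs no restricted space.\<close>

definition X :: "real \<Rightarrow> 'a \<Rightarrow> real" where
  "X t \<omega> = pos S (max 0 t) \<omega>"

lemma X_eq: "0 \<le> t \<Longrightarrow> X t \<omega> = pos S t \<omega>"
  by (simp add: X_def)

lemma X_measurable [measurable (raw)]:
  assumes [measurable]: "f \<in> borel_measurable M" "g \<in> M \<rightarrow>\<^sub>M paths S"
  shows "(\<lambda>w. X (f w) (g w)) \<in> borel_measurable M"
proof -
  have [measurable]: "(\<lambda>(t, \<omega>). pos S t \<omega>) \<in> borel_measurable (restrict_space borel {0..} \<Otimes>\<^sub>M paths S)"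
    using markov by (simp add: markov_process_def)
  have "(\<lambda>w. (max 0 (f w), g w)) \<in> M \<rightarrow>\<^sub>M restrict_space borel {0..} \<Otimes>\<^sub>M paths S"
    by (intro measurable_Pair measurable_restrict_space2) auto
  from measurable_compose[OF this, where g="\<lambda>(t, \<omega>). pos S t \<omega>"] show ?thesis
    unfolding X_def by simp
qed

lemma motion_kernel [measurable]: "motion S \<in> borel \<rightarrow>\<^sub>M prob_algebra (paths S)"
  using markov by (simp add: markov_process_def)

lemma motion_kernel_sub [measurable]: "motion S \<in> borel \<rightarrow>\<^sub>M subprob_algebra (paths S)"
  by (rule measurable_prob_algebraD) simp

lemma prob_space_motion: "prob_space (motion S x)"
  and sets_motion [measurable_cong, simp]: "sets (motion S x) = sets (paths S)"
  using measurable_space[OF motion_kernel, of x] by (auto simp: space_prob_algebra)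

lemma space_motion [simp]: "space (motion S x) = space (paths S)"
  by (rule sets_eq_imp_space_eq) simp

lemma motion_nn_integral_measurable [measurable (raw)]:
  assumes "(\<lambda>(w, \<omega>). f w \<omega>) \<in> borel_measurable (M \<Otimes>\<^sub>M paths S)" "Y \<in> borel_measurable M"
  shows "(\<lambda>w. \<integral>\<^sup>+\<omega>. f w \<omega> \<partial>motion S (Y w)) \<in> borel_measurable M"
  by (rule nn_integral_measurable_subprob_algebra2[where N="paths S"])
     (use assms in \<open>measurable\<close>)

lemma motion_fubini:
  fixes f :: "real \<Rightarrow> 'a \<Rightarrow> ennreal"
  assumes [measurable]: "(\<lambda>(r, \<omega>). f r \<omega>) \<in> borel_measurable (borel \<Otimes>\<^sub>M paths S)"
  shows "(\<integral>\<^sup>+\<omega>. (\<integral>\<^sup>+r. f r \<omega> \<partial>lborel) \<partial>motion S x) = (\<integral>\<^sup>+r. (\<integral>\<^sup>+\<omega>. f r \<omega> \<partial>motion S x) \<partial>lborel)"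
proof -
  interpret prob_space "motion S x" by (rule prob_space_motion)
  interpret P: pair_sigma_finite "lborel :: real measure" "motion S x" ..
  show ?thesis
    using P.Fubini'[of f] by simp
qed

definition past_alg :: "real \<Rightarrow> 'a measure" where
  "past_alg s = sigma (space (paths S)) (past S s)"

lemma pos_measurable: "0 \<le> r \<Longrightarrow> pos S r \<in> borel_measurable (paths S)"
  using X_measurable[of "\<lambda>_. r" "paths S" "\<lambda>\<omega>. \<omega>"] by (simp add: X_eq)

lemma sets_past_alg: "sets (past_alg s) = past S s"
proof -
  have 1: "past S s \<subseteq> Pow (space (paths S))"
    unfolding past_def by (auto dest!: sigma_sets_into_sp[rotated])
  show ?thesis
    unfolding past_alg_def
    by (subst sets_measure_of[OF 1], unfold past_def, rule sigma_sets_sigma_sets_eq) auto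
qed

lemma space_past_alg [simp]: "space (past_alg s) = space (paths S)"
  unfolding past_alg_def by (simp add: space_measure_of_conv)

lemma past_alg_le: "sets (past_alg s) \<subseteq> sets (paths S)"
  unfolding sets_past_alg past_def
  by (intro sets.sigma_sets_subset) (auto intro!: measurable_sets pos_measurable)

lemma past_alg_mono: "s \<le> t \<Longrightarrow> sets (past_alg s) \<subseteq> sets (past_alg t)"
  unfolding sets_past_alg past_def by (rule sigma_sets_mono') force

lemma past_measurableD: "F \<in> past_alg s \<rightarrow>\<^sub>M L \<Longrightarrow> F \<in> paths S \<rightarrow>\<^sub>M L"
  using past_alg_le[of s] by (auto simp: measurable_def)

lemma past_measurable_mono: "F \<in> past_alg s \<rightarrow>\<^sub>M L \<Longrightarrow> s \<le> t \<Longrightarrow> F \<in> past_alg t \<rightarrow>\<^sub>M L"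
  using past_alg_mono[of s t] by (auto simp: measurable_def)

lemma X_past_measurable: "0 \<le> r \<Longrightarrow> r \<le> s \<Longrightarrow> X r \<in> borel_measurable (past_alg s)"
  by (rule measurableI) (use X_eq[of r] in \<open>auto simp: vimage_def sets_past_alg past_def intro!: sigma_sets.Basic exI[of _ r]\<close>)

lemma subalgebra_past: "subalgebra (motion S x) (past_alg s)"
  using past_alg_le by (simp add: subalgebra_def)

section \<open>The Markov property\<close>

text \<open>Monotone class argument: both sides are additive in \<open>g\<close> and continuous
  along increasing sequences, so indicators suffice. The weights are left general because the lemma
  serves both the plain Markov property and its version with killing.\<close>

lemma eq_on_indicators_imp_eq:
  assumes [measurable]: "Y \<in> borel_measurable (paths S)" "w \<in> borel_measurable (paths S)"
    "F \<in> borel_measurable (paths S)" "Z \<in> borel_measurable (paths S)"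
    "w' \<in> borel_measurable (paths S)" "Y' \<in> borel_measurable (paths S)"
  assumes *: "\<And>B. B \<in> sets borel \<Longrightarrow>
    (\<integral>\<^sup>+\<omega>. w \<omega> * indicator B (Y \<omega>) \<partial>motion S x) =
    (\<integral>\<^sup>+\<omega>. F \<omega> * (\<integral>\<^sup>+\<omega>'. w' \<omega>' * indicator B (Y' \<omega>') \<partial>motion S (Z \<omega>)) \<partial>motion S x)"
  assumes g: "g \<in> borel_measurable (borel :: real measure)"
  shows "(\<integral>\<^sup>+\<omega>. w \<omega> * g (Y \<omega>) \<partial>motion S x) =
    (\<integral>\<^sup>+\<omega>. F \<omega> * (\<integral>\<^sup>+\<omega>'. w' \<omega>' * g (Y' \<omega>') \<partial>motion S (Z \<omega>)) \<partial>motion S x)"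
  using g
proof (induction rule: borel_measurable_induct)
  case (cong f g)
  then show ?case by (simp add: ext space_borel)
next
  case (set A)
  then show ?case using *[of A] by simp
next
  case (mult u c)
  note [measurable] = mult(2)
  have "(\<integral>\<^sup>+\<omega>. w \<omega> * (c * u (Y \<omega>)) \<partial>motion S x) = c * (\<integral>\<^sup>+\<omega>. w \<omega> * u (Y \<omega>) \<partial>motion S x)"
    by (subst nn_integral_cmult[symmetric]) (auto simp: ac_simps)
  moreover have "(\<integral>\<^sup>+\<omega>'. w' \<omega>' * (c * u (Y' \<omega>')) \<partial>motion S z) = c * (\<integral>\<^sup>+\<omega>'. w' \<omega>' * u (Y' \<omega>') \<partial>motion S z)" for z
    by (subst nn_integral_cmult[symmetric]) (auto simp: ac_simps)
  moreover have "(\<integral>\<^sup>+\<omega>. F \<omega> * (c * (\<integral>\<^sup>+\<omega>'. w' \<omega>' * u (Y' \<omega>') \<partial>motion S (Z \<omega>))) \<partial>motion S x)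
     = c * (\<integral>\<^sup>+\<omega>. F \<omega> * (\<integral>\<^sup>+\<omega>'. w' \<omega>' * u (Y' \<omega>') \<partial>motion S (Z \<omega>)) \<partial>motion S x)"
    by (subst nn_integral_cmult[symmetric]) (auto simp: ac_simps)
  ultimately show ?case using mult by simp
next
  case (add u v)
  note [measurable] = add(1,3)
  note [measurable] = add(2) add(4)
  show ?case
    using add by (simp add: distrib_left nn_integral_add)
next
  case (seq U)
  note [measurable] = seq(1)
  have inc: "incseq (\<lambda>i x. a x * U i (f x))" for a :: "'a \<Rightarrow> ennreal" and f
    using \<open>incseq U\<close> by (auto simp: incseq_def le_fun_def intro!: mult_left_mono)
  have 1: "(\<integral>\<^sup>+\<omega>. w \<omega> * (SUP i. U i (Y \<omega>)) \<partial>motion S x) = (SUP i. \<integral>\<^sup>+\<omega>. w \<omega> * U i (Y \<omega>) \<partial>motion S x)"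
    unfolding SUP_mult_left_ennreal by (rule nn_integral_monotone_convergence_SUP[OF inc]) measurable
  have 2: "(\<integral>\<^sup>+\<omega>'. w' \<omega>' * (SUP i. U i (Y' \<omega>')) \<partial>motion S z) = (SUP i. \<integral>\<^sup>+\<omega>'. w' \<omega>' * U i (Y' \<omega>') \<partial>motion S z)" for z
    unfolding SUP_mult_left_ennreal by (rule nn_integral_monotone_convergence_SUP[OF inc]) measurable
  have inc2: "incseq (\<lambda>i \<omega>. F \<omega> * (\<integral>\<^sup>+\<omega>'. w' \<omega>' * U i (Y' \<omega>') \<partial>motion S (Z \<omega>)))"
    using \<open>incseq U\<close> by (auto simp: incseq_def le_fun_def intro!: mult_left_mono nn_integral_mono)
  have 3: "(\<integral>\<^sup>+\<omega>. F \<omega> * (SUP i. \<integral>\<^sup>+\<omega>'. w' \<omega>' * U i (Y' \<omega>') \<partial>motion S (Z \<omega>)) \<partial>motion S x) =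
     (SUP i. \<integral>\<^sup>+\<omega>. F \<omega> * (\<integral>\<^sup>+\<omega>'. w' \<omega>' * U i (Y' \<omega>') \<partial>motion S (Z \<omega>)) \<partial>motion S x)"
    unfolding SUP_mult_left_ennreal by (rule nn_integral_monotone_convergence_SUP[OF inc2]) measurable
  have "(SUP i. U i) y = (SUP i. U i y)" for y by (simp add: SUP_apply image_comp)
  then show ?case by (simp add: 1 2 3 seq)
qed

lemma markov_indicator:
  assumes "A \<in> sets (past_alg s)" "0 \<le> s" "0 \<le> t" and B: "B \<in> sets borel"
  shows "(\<integral>\<^sup>+\<omega>. indicator A \<omega> * indicator B (X (s + t) \<omega>) \<partial>motion S x) =
    (\<integral>\<^sup>+\<omega>. indicator A \<omega> * (\<integral>\<^sup>+\<omega>'. indicator B (X t \<omega>') \<partial>motion S (X s \<omega>)) \<partial>motion S x)"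
proof -
  have A [measurable]: "A \<in> sets (paths S)" using assms past_alg_le by auto
  note [measurable] = B
  have "emeasure (motion S x) {\<omega>\<in>A. pos S (s + t) \<omega> \<in> B} =
        (\<integral>\<^sup>+\<omega>\<in>A. emeasure (motion S (pos S s \<omega>)) {\<omega>'\<in>space (paths S). pos S t \<omega>' \<in> B} \<partial>motion S x)"
    using markov assms by (simp add: markov_process_def sets_past_alg)
  also have "emeasure (motion S x) {\<omega>\<in>A. pos S (s + t) \<omega> \<in> B} =
     (\<integral>\<^sup>+\<omega>. indicator {\<omega>\<in>A. X (s + t) \<omega> \<in> B} \<omega> \<partial>motion S x)"
  proof -
    have "{\<omega>\<in>A. X (s + t) \<omega> \<in> B} \<in> sets (paths S)"
      using sets.sets_into_space[OF A]
      by (subgoal_tac "{\<omega>\<in>A. X (s + t) \<omega> \<in> B} = A \<inter> (X (s + t) -` B \<inter> space (paths S))") auto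
    then show ?thesis using assms by (simp add: X_eq)
  qed
  also have "\<dots> = (\<integral>\<^sup>+\<omega>. indicator A \<omega> * indicator B (X (s + t) \<omega>) \<partial>motion S x)"
    by (intro nn_integral_cong) (auto simp: indicator_def)
  also have "(\<integral>\<^sup>+\<omega>\<in>A. emeasure (motion S (pos S s \<omega>)) {\<omega>'\<in>space (paths S). pos S t \<omega>' \<in> B} \<partial>motion S x) =
     (\<integral>\<^sup>+\<omega>. indicator A \<omega> * (\<integral>\<^sup>+\<omega>'. indicator B (X t \<omega>') \<partial>motion S (X s \<omega>)) \<partial>motion S x)"
  proof (intro nn_integral_cong)
    fix \<omega>
    have "{\<omega>'\<in>space (paths S). X t \<omega>' \<in> B} \<in> sets (paths S)" by measurable
    then have "emeasure (motion S (X s \<omega>)) {\<omega>'\<in>space (paths S). X t \<omega>' \<in> B} = (\<integral>\<^sup>+\<omega>'. indicator {\<omega>'\<in>space (paths S). X t \<omega>' \<in> B} \<omega>' \<partial>motion S (X s \<omega>))"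
      by simp
    also have "\<dots> = (\<integral>\<^sup>+\<omega>'. indicator B (X t \<omega>') \<partial>motion S (X s \<omega>))"
      by (intro nn_integral_cong) (auto simp: indicator_def)
    finally show "emeasure (motion S (pos S s \<omega>)) {\<omega>'\<in>space (paths S). pos S t \<omega>' \<in> B} * indicator A \<omega> =
       indicator A \<omega> * (\<integral>\<^sup>+\<omega>'. indicator B (X t \<omega>') \<partial>motion S (X s \<omega>))"
      using assms by (simp add: X_eq ac_simps)
  qed
  finally show ?thesis .
qed

text \<open>Monotone class argument in the past factor \<open>F\<close>. In the base case, an event
  of the past, the preceding reduction passes from indicators to all \<open>h\<close>.\<close>

lemma markov_nn_integral:
  assumes F: "F \<in> borel_measurable (past_alg s)" and s: "0 \<le> s" "0 \<le> t"
    and h: "h \<in> borel_measurable borel"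
  shows "(\<integral>\<^sup>+\<omega>. F \<omega> * h (X (s + t) \<omega>) \<partial>motion S x) =
    (\<integral>\<^sup>+\<omega>. F \<omega> * (\<integral>\<^sup>+\<omega>'. h (X t \<omega>') \<partial>motion S (X s \<omega>)) \<partial>motion S x)"
proof -
  note [measurable] = h
  define g where "g = (\<lambda>y. \<integral>\<^sup>+\<omega>'. h (X t \<omega>') \<partial>motion S y)"
  have [measurable]: "g \<in> borel_measurable borel" unfolding g_def by measurable
  have "(\<integral>\<^sup>+\<omega>. F \<omega> * h (X (s + t) \<omega>) \<partial>motion S x) = (\<integral>\<^sup>+\<omega>. F \<omega> * g (X s \<omega>) \<partial>motion S x)"
    using F
  proof (induction rule: borel_measurable_induct)
    case (cong f g)
    then show ?case by (simp cong: nn_integral_cong_simp)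
  next
    case (set A)
    then have [measurable]: "A \<in> sets (paths S)" using past_alg_le by auto
    have "(\<integral>\<^sup>+\<omega>. indicator A \<omega> * h (X (s + t) \<omega>) \<partial>motion S x) =
      (\<integral>\<^sup>+\<omega>. indicator A \<omega> * (\<integral>\<^sup>+\<omega>'. 1 * h (X t \<omega>') \<partial>motion S (X s \<omega>)) \<partial>motion S x)"
      by (rule eq_on_indicators_imp_eq) (use markov_indicator[OF set s] h in \<open>auto\<close>)
    then show ?case by (simp add: g_def)
  next
    case (mult u c)
    then have [measurable]: "u \<in> borel_measurable (paths S)" by (auto intro: past_measurableD)
    show ?case using mult by (simp add: nn_integral_cmult mult.assoc)
  next
    case (add u v)
    then have [measurable]: "u \<in> borel_measurable (paths S)" "v \<in> borel_measurable (paths S)"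
      by (auto intro: past_measurableD)
    show ?case using add by (simp add: distrib_right nn_integral_add)
  next
    case (seq U)
    then have [measurable]: "U i \<in> borel_measurable (paths S)" for i by (auto intro: past_measurableD)
    have inc: "incseq (\<lambda>i x. U i x * a x)" for a :: "'a \<Rightarrow> ennreal"
      using \<open>incseq U\<close> by (auto simp: incseq_def le_fun_def intro!: mult_right_mono)
    have 1: "(\<integral>\<^sup>+\<omega>. (SUP i. U i \<omega>) * a \<omega> \<partial>motion S x) = (SUP i. \<integral>\<^sup>+\<omega>. U i \<omega> * a \<omega> \<partial>motion S x)"
      if [measurable]: "a \<in> borel_measurable (paths S)" for a
      unfolding SUP_mult_right_ennreal by (rule nn_integral_monotone_convergence_SUP[OF inc]) measurable
    have "(SUP i. U i) \<omega> = (SUP i. U i \<omega>)" for \<omega> by (simp add: SUP_apply image_comp)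
    then show ?case by (simp add: 1 seq)
  qed
  then show ?thesis by (simp add: g_def)
qed

text \<open>
  The set of trajectories need not be generated by the coordinates, so a time integral along the
  trajectory is not literally a function of the past; but it agrees almost surely with its
  conditional expectation \<open>J\<close>, since the two have the same scalar product with every coordinate,
  hence with the time integral itself.
\<close>

lemma past_version_time_integral:
  fixes c :: "real \<Rightarrow> real"
  assumes [measurable]: "c \<in> borel_measurable borel" and c: "\<And>y. \<bar>c y\<bar> \<le> K" and s: "0 \<le> s"
  shows "\<exists>J\<in>borel_measurable (past_alg s). AE \<omega> in motion S x. (LBINT r:{0..s}. c (X r \<omega>)) = J \<omega>"
proof -
  interpret M: prob_space "motion S x" by (rule prob_space_motion)
  interpret F: finite_measure_subalgebra "motion S x" "past_alg s"
    by unfold_locales (rule subalgebra_past)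
  define L :: "real measure" where "L = restrict_space lborel {0..s}"
  have L_borel: "f \<in> borel_measurable borel \<Longrightarrow> f \<in> L \<rightarrow>\<^sub>M borel" for f :: "real \<Rightarrow> real"
    by (simp add: L_def measurable_restrict_space1)
  have id_L [measurable]: "(\<lambda>r. r) \<in> L \<rightarrow>\<^sub>M borel" by (rule L_borel) simp
  interpret L: finite_measure L
    by (rule finite_measureI) (auto simp: L_def emeasure_restrict_space space_restrict_space emeasure_lborel_Icc_eq)
  interpret LM: pair_sigma_finite L "motion S x" ..
  interpret LMf: finite_measure "L \<Otimes>\<^sub>M motion S x"
    by (rule finite_measure_pair_measure) unfold_locales
  define I where "I = (\<lambda>\<omega>. \<integral>r. c (X r \<omega>) \<partial>L)"
  have I_eq: "(LBINT r:{0..s}. c (X r \<omega>)) = I \<omega>" for \<omega>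
    unfolding I_def L_def set_lebesgue_integral_def using integral_restrict_space[of "{0..s}" lborel "\<lambda>r. c (X r \<omega>)"] by simp
  have [measurable]: "I \<in> borel_measurable (paths S)" unfolding I_def by measurable
  have K: "0 \<le> K" using c[of 0] by linarith
  define R where "R = K * measure L (space L)"
  have R: "0 \<le> R" using K by (simp add: R_def)
  have I_bound: "\<bar>I \<omega>\<bar> \<le> R" if "\<omega> \<in> space (paths S)" for \<omega>
  proof -
    have [measurable]: "(\<lambda>r. X r \<omega>) \<in> borel_measurable L" using that by measurable
    have int: "integrable L (\<lambda>r. c (X r \<omega>))"
      by (rule L.integrable_const_bound[where B=K]) (use c in auto)
    have "norm (I \<omega>) \<le> (\<integral>r. norm (c (X r \<omega>)) \<partial>L)" unfolding I_def by (rule integral_norm_bound)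
    also have "\<dots> \<le> (\<integral>r. K \<partial>L)"
      by (rule integral_mono) (use c int in auto)
    finally show ?thesis by (simp add: R_def mult.commute)
  qed
  have I_int: "integrable (motion S x) I"
    by (rule M.integrable_const_bound[where B=R]) (use I_bound in auto)
  define J0 where "J0 = real_cond_exp (motion S x) (past_alg s) I"
  \<comment> \<open>Clipping at \<open>R\<close> changes nothing almost surely and gives a version
    that is bounded at every point, as the orthogonality relations below require.\<close>
  define J where "J = (\<lambda>\<omega>. max (- R) (min R (J0 \<omega>)))"
  have J0 [measurable]: "J0 \<in> borel_measurable (past_alg s)" by (simp add: J0_def)
  have J: "J \<in> borel_measurable (past_alg s)" unfolding J_def by measurable
  have [measurable]: "J \<in> borel_measurable (paths S)" using past_measurableD[OF J] .
  have I_AE: "AE \<omega> in motion S x. I \<omega> \<le> R" "AE \<omega> in motion S x. - R \<le> I \<omega>"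
    using I_bound by (auto intro!: AE_I2 simp: abs_le_iff minus_le_iff)
  have "AE \<omega> in motion S x. J0 \<omega> \<le> R"
    unfolding J0_def by (intro F.real_cond_exp_le_c I_int I_AE)
  moreover have "AE \<omega> in motion S x. - R \<le> J0 \<omega>"
    unfolding J0_def by (intro F.real_cond_exp_ge_c I_int I_AE)
  ultimately have JJ0: "AE \<omega> in motion S x. J0 \<omega> = J \<omega>"
    by eventually_elim (auto simp: J_def)
  have J_bound: "\<bar>J \<omega>\<bar> \<le> R" for \<omega> using R by (auto simp: J_def)
  have orth: "(\<integral>\<omega>. g \<omega> * (I \<omega> - J \<omega>) \<partial>motion S x) = 0"
    if g: "g \<in> borel_measurable (past_alg s)" and gB: "\<And>\<omega>. \<bar>g \<omega>\<bar> \<le> B" for g B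
  proof -
    have [measurable]: "g \<in> borel_measurable (paths S)" using past_measurableD[OF g] .
    have bd: "norm (g \<omega> * h) \<le> B * R" if "\<bar>h\<bar> \<le> R" for \<omega> h
      using mult_mono[OF gB[of \<omega>] that] gB[of \<omega>] by (simp add: abs_mult)
    have i1: "integrable (motion S x) (\<lambda>\<omega>. g \<omega> * I \<omega>)"
      by (rule M.integrable_const_bound[where B="B * R"]) (use bd I_bound in auto)
    have i2: "integrable (motion S x) (\<lambda>\<omega>. g \<omega> * J \<omega>)"
      by (rule M.integrable_const_bound[where B="B * R"]) (use bd J_bound in auto)
    have "(\<integral>\<omega>. g \<omega> * J \<omega> \<partial>motion S x) = (\<integral>\<omega>. g \<omega> * J0 \<omega> \<partial>motion S x)"
      using JJ0 past_measurableD[OF J0] by (intro integral_cong_AE) auto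
    also have "\<dots> = (\<integral>\<omega>. g \<omega> * I \<omega> \<partial>motion S x)"
      unfolding J0_def by (rule F.real_cond_exp_intg(2)[OF i1 g]) simp
    finally show ?thesis using i1 i2 by (simp add: right_diff_distrib)
  qed
  have "(\<integral>\<omega>. I \<omega> * (I \<omega> - J \<omega>) \<partial>motion S x) = (\<integral>\<omega>. (\<integral>r. c (X r \<omega>) * (I \<omega> - J \<omega>) \<partial>L) \<partial>motion S x)"
    unfolding I_def by simp
  also have "\<dots> = (\<integral>r. (\<integral>\<omega>. c (X r \<omega>) * (I \<omega> - J \<omega>) \<partial>motion S x) \<partial>L)"
  proof (rule LM.Fubini_integral)
    have *: "norm (c y * (I \<omega> - J \<omega>)) \<le> K * (2 * R)" if "\<omega> \<in> space (paths S)" for y \<omega>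
      using mult_mono[OF c[of y], of "\<bar>I \<omega> - J \<omega>\<bar>" "2 * R"] I_bound[OF that] J_bound[of \<omega>] K by (simp add: abs_mult)
    have m: "(\<lambda>(r, \<omega>). c (X r \<omega>) * (I \<omega> - J \<omega>)) \<in> borel_measurable (L \<Otimes>\<^sub>M motion S x)"
      by measurable
    have "AE p in L \<Otimes>\<^sub>M motion S x. norm (case p of (r, \<omega>) \<Rightarrow> c (X r \<omega>) * (I \<omega> - J \<omega>)) \<le> K * (2 * R)"
      by (rule AE_I2) (use * in \<open>auto simp: space_pair_measure\<close>)
    then show "integrable (L \<Otimes>\<^sub>M motion S x) (\<lambda>(r, \<omega>). c (X r \<omega>) * (I \<omega> - J \<omega>))"
      using m by (rule LMf.integrable_const_bound)
  qed
  also have "\<dots> = (\<integral>r. 0 \<partial>L)"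
  proof (rule Bochner_Integration.integral_cong)
    fix r assume "r \<in> space L"
    then have r: "0 \<le> r" "r \<le> s" by (auto simp: L_def space_restrict_space)
    show "(\<integral>\<omega>. c (X r \<omega>) * (I \<omega> - J \<omega>) \<partial>motion S x) = 0"
      using measurable_compose[OF X_past_measurable[OF r] assms(1)] c by (intro orth)
  qed auto
  finally have 1: "(\<integral>\<omega>. I \<omega> * (I \<omega> - J \<omega>) \<partial>motion S x) = 0" by simp
  have 2: "(\<integral>\<omega>. J \<omega> * (I \<omega> - J \<omega>) \<partial>motion S x) = 0"
    by (rule orth[OF J J_bound])
  have bd: "norm (h * (I \<omega> - J \<omega>)) \<le> R * (2 * R)" if "\<omega> \<in> space (paths S)" "\<bar>h\<bar> \<le> R" for h \<omega>
    using mult_mono[OF that(2), of "\<bar>I \<omega> - J \<omega>\<bar>" "2 * R"] I_bound[OF that(1)] J_bound[of \<omega>] R by (simp add: abs_mult)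
  have i1: "integrable (motion S x) (\<lambda>\<omega>. I \<omega> * (I \<omega> - J \<omega>))"
    by (rule M.integrable_const_bound[where B="R * (2 * R)"]) (use bd I_bound in auto)
  have i2: "integrable (motion S x) (\<lambda>\<omega>. J \<omega> * (I \<omega> - J \<omega>))"
    by (rule M.integrable_const_bound[where B="R * (2 * R)"]) (use bd J_bound in auto)
  have i3: "integrable (motion S x) (\<lambda>\<omega>. (I \<omega> - J \<omega>)\<^sup>2)"
    using Bochner_Integration.integrable_diff[OF i1 i2] by (simp add: power2_eq_square left_diff_distrib)
  have "(\<integral>\<omega>. (I \<omega> - J \<omega>)\<^sup>2 \<partial>motion S x) = 0"
    using Bochner_Integration.integral_diff[OF i1 i2] 1 2 by (simp add: power2_eq_square left_diff_distrib)
  then have "AE \<omega> in motion S x. (I \<omega> - J \<omega>)\<^sup>2 = 0"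
    using integral_nonneg_eq_0_iff_AE[OF i3] by simp
  then show ?thesis
    using J by (intro bexI[of _ J]) (auto simp: I_eq)
qed

section \<open>Cumulated rates over time intervals and the Markov property for their
  exponentials\<close>

definition rate_over :: "(real \<Rightarrow> real) \<Rightarrow> real \<Rightarrow> real \<Rightarrow> 'a \<Rightarrow> ennreal" where
  "rate_over a s t \<omega> = (\<integral>\<^sup>+r\<in>{s<..t}. ennreal (a (X r \<omega>)) \<partial>lborel)"

lemma rate_over_measurable [measurable (raw)]:
  assumes [measurable]: "a \<in> borel_measurable borel"
    "f \<in> borel_measurable M" "g \<in> borel_measurable M" "h \<in> M \<rightarrow>\<^sub>M paths S"
  shows "(\<lambda>w. rate_over a (f w) (g w) (h w)) \<in> borel_measurable M"
proof -
  have "(\<lambda>w. \<integral>\<^sup>+r. ennreal (a (X r (h w))) * (if f w < r \<and> r \<le> g w then 1 else 0) \<partial>lborel) \<in> borel_measurable M"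
    by measurable
  then show ?thesis by (simp add: rate_over_def indicator_def)
qed

lemma X_path_measurable [measurable]:
  "\<omega> \<in> space (paths S) \<Longrightarrow> (\<lambda>r. X r \<omega>) \<in> borel_measurable borel"
  by measurable

text \<open>The reason for half-open intervals in \<open>rate_over\<close>: they concatenate without
  overlap.\<close>

lemma rate_over_split:
  assumes [measurable]: "a \<in> borel_measurable borel" and \<omega>: "\<omega> \<in> space (paths S)"
    and "s \<le> u" "u \<le> t"
  shows "rate_over a s t \<omega> = rate_over a s u \<omega> + rate_over a u t \<omega>"
proof -
  have "{s<..t} = {s<..u} \<union> {u<..t}" using assms by auto
  then show ?thesis
    unfolding rate_over_def using X_path_measurable[OF \<omega>]
    by (subst nn_integral_disjoint_pair[symmetric]) auto
qed

lemma rate_over_plus: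
  assumes [measurable]: "a \<in> borel_measurable borel" "c \<in> borel_measurable borel"
    and "\<And>y. 0 \<le> a y" "\<And>y. 0 \<le> c y" and \<omega>: "\<omega> \<in> space (paths S)"
  shows "rate_over (\<lambda>y. a y + c y) s t \<omega> = rate_over a s t \<omega> + rate_over c s t \<omega>"
  unfolding rate_over_def using X_path_measurable[OF \<omega>] assms(3,4)
  by (subst nn_integral_add[symmetric]) (auto simp: distrib_right)

lemma rate_over_const: "s \<le> t \<Longrightarrow> 0 \<le> k \<Longrightarrow> rate_over (\<lambda>_. k) s t \<omega> = ennreal (k * (t - s))"
  by (simp add: rate_over_def nn_integral_cmult_indicator ennreal_mult)

text \<open>Unbounded rates are reached from their truncations by monotone convergence; the limit
  may be infinite.\<close>

lemma rate_over_LIMSEQ: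
  assumes [measurable]: "a \<in> borel_measurable borel" and \<omega>: "\<omega> \<in> space (paths S)"
  shows "(\<lambda>k. rate_over (\<lambda>y. min (a y) (real k)) s t \<omega>) \<longlonglongrightarrow> rate_over a s t \<omega>"
  unfolding rate_over_def
proof (rule nn_integral_LIMSEQ)
  note X_path_measurable[OF \<omega>, measurable]
  show "(\<lambda>r. ennreal (min (a (X r \<omega>)) (real k)) * indicator {s<..t} r) \<in> borel_measurable lborel" for k
    by measurable
  show "incseq (\<lambda>k r. ennreal (min (a (X r \<omega>)) (real k)) * indicator {s<..t} r)"
    unfolding incseq_def le_fun_def by (intro allI impI mult_right_mono ennreal_leI min.mono) simp_all
  fix r
  have "(\<lambda>k. min (a (X r \<omega>)) (real k)) \<longlonglongrightarrow> a (X r \<omega>)"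
  proof (rule tendsto_eventually)
    obtain k0 where "a (X r \<omega>) \<le> real k0" using real_arch_simple by blast
    then show "eventually (\<lambda>k. min (a (X r \<omega>)) (real k) = a (X r \<omega>)) sequentially"
      by (intro eventually_sequentiallyI[of k0] min_absorb1) (meson of_nat_mono order_trans)
  qed
  then show "(\<lambda>k. ennreal (min (a (X r \<omega>)) (real k)) * indicator {s<..t} r) \<longlonglongrightarrow> ennreal (a (X r \<omega>)) * indicator {s<..t} r"
    by (auto simp: indicator_def intro!: tendsto_ennrealI)
qed

lemma bounded_rate_path:
  assumes "c \<in> borel_measurable borel" "\<And>y. 0 \<le> c y" "\<And>y. c y \<le> K" "\<omega> \<in> space (paths S)"
  shows "bounded_rate (\<lambda>r. c (X r \<omega>)) K"
  using assms measurable_compose[OF X_path_measurable] by unfold_locales auto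

lemma rate_over_eq_cum:
  assumes "c \<in> borel_measurable borel" "\<And>y. 0 \<le> c y" "\<And>y. c y \<le> K" "\<omega> \<in> space (paths S)"
    and "0 \<le> s" "s \<le> t"
  shows "rate_over c s t \<omega> = ennreal (bounded_rate.cum (\<lambda>r. c (X r \<omega>)) t - bounded_rate.cum (\<lambda>r. c (X r \<omega>)) s)"
proof -
  interpret bounded_rate "\<lambda>r. c (X r \<omega>)" K by (rule bounded_rate_path[OF assms(1-4)])
  show ?thesis unfolding rate_over_def by (rule nn_integral_c_Ioc(1)[OF assms(5,6)])
qed

text \<open>A term of the exponential series of the cumulated rate, equivalently an iterated
  integral of the rate over \<open>n\<close> ordered times. It is meant for bounded rates, where
  \<open>enn2real\<close> loses nothing.\<close>

definition rate_power :: "(real \<Rightarrow> real) \<Rightarrow> nat \<Rightarrow> real \<Rightarrow> real \<Rightarrow> 'a \<Rightarrow> ennreal" where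
  "rate_power c n s t \<omega> = ennreal (enn2real (rate_over c s t \<omega>) ^ n / fact n)"

lemma rate_power_measurable [measurable (raw)]:
  assumes [measurable]: "c \<in> borel_measurable borel"
    "f \<in> borel_measurable M" "g \<in> borel_measurable M" "h \<in> M \<rightarrow>\<^sub>M paths S"
  shows "(\<lambda>w. rate_power c n (f w) (g w) (h w)) \<in> borel_measurable M"
  unfolding rate_power_def by measurable

text \<open>Here \<open>r\<close> is the earliest of the ordered times; the other \<open>n\<close>
  lie in \<open>{r<..t}\<close>.\<close>

lemma rate_power_Suc:
  assumes c: "c \<in> borel_measurable borel" "\<And>y. 0 \<le> c y" "\<And>y. c y \<le> K" "\<omega> \<in> space (paths S)"
    and s: "0 \<le> s" "s \<le> t"
  shows "rate_power c (Suc n) s t \<omega> = (\<integral>\<^sup>+r\<in>{s<..t}. ennreal (c (X r \<omega>)) * rate_power c n r t \<omega> \<partial>lborel)"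
proof -
  interpret bounded_rate "\<lambda>r. c (X r \<omega>)" K by (rule bounded_rate_path[OF c])
  have eq: "rate_power c n r t \<omega> = ennreal ((cum t - cum r) ^ n / fact n)" if "0 \<le> r" "r \<le> t" for n r
    using rate_over_eq_cum[OF c that] cum_mono[OF that(2)] by (simp add: rate_power_def)
  have "(\<integral>\<^sup>+r\<in>{s<..t}. ennreal (c (X r \<omega>)) * rate_power c n r t \<omega> \<partial>lborel) =
    (\<integral>\<^sup>+r\<in>{s<..t}. ennreal (c (X r \<omega>)) * ennreal ((cum t - cum r) ^ n / fact n) \<partial>lborel)"
    using s by (intro nn_integral_cong) (auto simp: indicator_def eq)
  then show ?thesis using s by (simp add: nn_integral_cum_power[OF s] eq del: power_Suc)
qed

text \<open>Induction on the number of time points. The earliest one, \<open>r\<close>, is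
  integrated outermost. The product of \<open>F\<close> with the rate at \<open>X r\<close> belongs
  to the past of \<open>r\<close>, so the induction hypothesis at \<open>r\<close> turns everything
  later into a function of \<open>X r\<close> alone, and the plain Markov property takes that back
  from \<open>r\<close> to \<open>s\<close>. This is why the past factor and the starting time vary
  in the induction.\<close>

lemma markov_rate_power:
  assumes c: "c \<in> borel_measurable borel" "\<And>y. 0 \<le> c y" "\<And>y. c y \<le> K"
    and g: "g \<in> borel_measurable borel"
    and "F \<in> borel_measurable (past_alg s)" "0 \<le> s" "0 \<le> t"
  shows "(\<integral>\<^sup>+\<omega>. F \<omega> * (rate_power c n s (s + t) \<omega> * g (X (s + t) \<omega>)) \<partial>motion S x) =
    (\<integral>\<^sup>+\<omega>. F \<omega> * (\<integral>\<^sup>+\<omega>'. rate_power c n 0 t \<omega>' * g (X t \<omega>') \<partial>motion S (X s \<omega>)) \<partial>motion S x)"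
  using assms(5-)
proof (induction n arbitrary: F s t x)
  case 0
  then show ?case using markov_nn_integral[OF _ _ _ g] by (simp add: rate_power_def)
next
  case (Suc n)
  note [measurable] = c(1) g
  define p where "p = (\<lambda>r y. \<integral>\<^sup>+\<omega>. rate_power c n 0 r \<omega> * g (X r \<omega>) \<partial>motion S y)"
  define q where "q = (\<lambda>r y. ennreal (c y) * p r y)"
  have [measurable]: "(\<lambda>(r, y). q r y) \<in> borel_measurable (borel \<Otimes>\<^sub>M borel)"
    unfolding q_def p_def by measurable
  have q1 [measurable]: "q r \<in> borel_measurable borel" for r
    unfolding q_def p_def by measurable
  \<comment> \<open>Used twice: with the given \<open>F\<close> from time \<open>s\<close>, and with
    the factor 1 from time 0, which is the inner expectation on the right
    (\<open>B\<close>).\<close>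
  have A: "(\<integral>\<^sup>+\<omega>. F \<omega> * (rate_power c (Suc n) s (s + t) \<omega> * g (X (s + t) \<omega>)) \<partial>motion S x) =
      (\<integral>\<^sup>+r\<in>{s<..s + t}. (\<integral>\<^sup>+\<omega>. F \<omega> * q (s + t - r) (X r \<omega>) \<partial>motion S x) \<partial>lborel)"
    if F: "F \<in> borel_measurable (past_alg s)" and s: "0 \<le> s" "0 \<le> t" for F s t x
  proof -
    have [measurable]: "F \<in> borel_measurable (paths S)" by (rule past_measurableD[OF F])
    have "(\<integral>\<^sup>+\<omega>. F \<omega> * (rate_power c (Suc n) s (s + t) \<omega> * g (X (s + t) \<omega>)) \<partial>motion S x) =
      (\<integral>\<^sup>+\<omega>. (\<integral>\<^sup>+r. F \<omega> * ennreal (c (X r \<omega>)) * (rate_power c n r (s + t) \<omega> * g (X (s + t) \<omega>)) * indicator {s<..s + t} r \<partial>lborel) \<partial>motion S x)"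
    proof (intro nn_integral_cong)
      fix \<omega> assume "\<omega> \<in> space (motion S x)"
      then have \<omega>: "\<omega> \<in> space (paths S)" by simp
      note [measurable] = X_path_measurable[OF \<omega>]
      have [measurable]: "(\<lambda>r. rate_power c n r (s + t) \<omega>) \<in> borel_measurable borel"
        using \<omega> by measurable
      show "F \<omega> * (rate_power c (Suc n) s (s + t) \<omega> * g (X (s + t) \<omega>)) =
        (\<integral>\<^sup>+r. F \<omega> * ennreal (c (X r \<omega>)) * (rate_power c n r (s + t) \<omega> * g (X (s + t) \<omega>)) * indicator {s<..s + t} r \<partial>lborel)"
        using s by (subst rate_power_Suc[OF c \<omega>]) (auto simp: nn_integral_cmult[symmetric] nn_integral_multc[symmetric] ac_simps)
    qed
    also have "\<dots> = (\<integral>\<^sup>+r. (\<integral>\<^sup>+\<omega>. F \<omega> * ennreal (c (X r \<omega>)) * (rate_power c n r (s + t) \<omega> * g (X (s + t) \<omega>)) * indicator {s<..s + t} r \<partial>motion S x) \<partial>lborel)"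
      by (rule motion_fubini) measurable
    also have "\<dots> = (\<integral>\<^sup>+r\<in>{s<..s + t}. (\<integral>\<^sup>+\<omega>. F \<omega> * q (s + t - r) (X r \<omega>) \<partial>motion S x) \<partial>lborel)"
    proof (intro nn_integral_cong)
      fix r :: real
      show "(\<integral>\<^sup>+\<omega>. F \<omega> * ennreal (c (X r \<omega>)) * (rate_power c n r (s + t) \<omega> * g (X (s + t) \<omega>)) * indicator {s<..s + t} r \<partial>motion S x) =
        (\<integral>\<^sup>+\<omega>. F \<omega> * q (s + t - r) (X r \<omega>) \<partial>motion S x) * indicator {s<..s + t} r"
      proof (cases "r \<in> {s<..s + t}")
        case True
        then have r: "0 \<le> r" "0 \<le> s + t - r" "s \<le> r" using s by auto
        have "(\<lambda>\<omega>. F \<omega> * ennreal (c (X r \<omega>))) \<in> borel_measurable (past_alg r)"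
          using past_measurable_mono[OF F r(3)] X_past_measurable[OF r(1) order.refl] by measurable
        from Suc.IH[OF this r(1,2)] show ?thesis
          using True by (simp add: q_def p_def mult.assoc)
      qed simp
    qed
    finally show ?thesis .
  qed
  have B: "(\<integral>\<^sup>+\<omega>'. rate_power c (Suc n) 0 t \<omega>' * g (X t \<omega>') \<partial>motion S y) =
    (\<integral>\<^sup>+r\<in>{0<..t}. (\<integral>\<^sup>+\<omega>'. q (t - r) (X r \<omega>') \<partial>motion S y) \<partial>lborel)" for y
    using A[of "\<lambda>_. 1" 0 t y] Suc.prems by simp
  have [measurable]: "F \<in> borel_measurable (paths S)" by (rule past_measurableD[OF Suc.prems(1)])
  have "(\<integral>\<^sup>+\<omega>. F \<omega> * (rate_power c (Suc n) s (s + t) \<omega> * g (X (s + t) \<omega>)) \<partial>motion S x) =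
    (\<integral>\<^sup>+r\<in>{0<..t}. (\<integral>\<^sup>+\<omega>. F \<omega> * q (t - r) (X (s + r) \<omega>) \<partial>motion S x) \<partial>lborel)"
    unfolding A[OF Suc.prems] by (subst nn_integral_Ioc_shift) simp_all
  also have "\<dots> = (\<integral>\<^sup>+r. (\<integral>\<^sup>+\<omega>. F \<omega> * (\<integral>\<^sup>+\<omega>'. q (t - r) (X r \<omega>') \<partial>motion S (X s \<omega>)) * indicator {0<..t} r \<partial>motion S x) \<partial>lborel)"
  proof (intro nn_integral_cong)
    fix r :: real
    show "(\<integral>\<^sup>+\<omega>. F \<omega> * q (t - r) (X (s + r) \<omega>) \<partial>motion S x) * indicator {0<..t} r =
      (\<integral>\<^sup>+\<omega>. F \<omega> * (\<integral>\<^sup>+\<omega>'. q (t - r) (X r \<omega>') \<partial>motion S (X s \<omega>)) * indicator {0<..t} r \<partial>motion S x)"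
      using markov_nn_integral[OF Suc.prems(1,2), of r "q (t - r)" x] by (auto simp: indicator_def)
  qed
  also have "\<dots> = (\<integral>\<^sup>+\<omega>. (\<integral>\<^sup>+r. F \<omega> * (\<integral>\<^sup>+\<omega>'. q (t - r) (X r \<omega>') \<partial>motion S (X s \<omega>)) * indicator {0<..t} r \<partial>lborel) \<partial>motion S x)"
    by (rule motion_fubini[symmetric]) measurable
  also have "\<dots> = (\<integral>\<^sup>+\<omega>. F \<omega> * (\<integral>\<^sup>+\<omega>'. rate_power c (Suc n) 0 t \<omega>' * g (X t \<omega>') \<partial>motion S (X s \<omega>)) \<partial>motion S x)"
    unfolding B by (intro nn_integral_cong) (auto simp: nn_integral_cmult[symmetric] ac_simps)
  finally show ?case .
qed

text \<open>The previous identity summed over the exponential series, whose terms are all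
  nonnegative.\<close>

lemma markov_rate_exp:
  assumes c: "c \<in> borel_measurable borel" "\<And>y. 0 \<le> c y" "\<And>y. c y \<le> K"
    and g: "g \<in> borel_measurable borel"
    and F: "F \<in> borel_measurable (past_alg s)" and s: "0 \<le> s" "0 \<le> t"
  shows "(\<integral>\<^sup>+\<omega>. F \<omega> * (ennreal (exp (enn2real (rate_over c s (s + t) \<omega>))) * g (X (s + t) \<omega>)) \<partial>motion S x) =
    (\<integral>\<^sup>+\<omega>. F \<omega> * (\<integral>\<^sup>+\<omega>'. ennreal (exp (enn2real (rate_over c 0 t \<omega>'))) * g (X t \<omega>') \<partial>motion S (X s \<omega>)) \<partial>motion S x)"
proof -
  note [measurable] = c(1) g
  have [measurable]: "F \<in> borel_measurable (paths S)" by (rule past_measurableD[OF F])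
  have E: "ennreal (exp (enn2real (rate_over c u v \<omega>))) = (\<Sum>n. rate_power c n u v \<omega>)" for u v \<omega>
    unfolding rate_power_def by (rule ennreal_exp_eq_suminf) simp
  have "(\<integral>\<^sup>+\<omega>. F \<omega> * (ennreal (exp (enn2real (rate_over c s (s + t) \<omega>))) * g (X (s + t) \<omega>)) \<partial>motion S x) =
    (\<Sum>n. \<integral>\<^sup>+\<omega>. F \<omega> * (rate_power c n s (s + t) \<omega> * g (X (s + t) \<omega>)) \<partial>motion S x)"
    unfolding E by (subst nn_integral_suminf[symmetric]) (auto simp: ennreal_suminf_cmult ennreal_suminf_multc)
  also have "\<dots> = (\<Sum>n. \<integral>\<^sup>+\<omega>. F \<omega> * (\<integral>\<^sup>+\<omega>'. rate_power c n 0 t \<omega>' * g (X t \<omega>') \<partial>motion S (X s \<omega>)) \<partial>motion S x)"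
    by (subst markov_rate_power[OF c g F s]) simp
  also have "\<dots> = (\<integral>\<^sup>+\<omega>. F \<omega> * (\<Sum>n. \<integral>\<^sup>+\<omega>'. rate_power c n 0 t \<omega>' * g (X t \<omega>') \<partial>motion S (X s \<omega>)) \<partial>motion S x)"
    by (subst nn_integral_suminf[symmetric]) (auto simp: ennreal_suminf_cmult)
  also have "(\<lambda>y. \<Sum>n. \<integral>\<^sup>+\<omega>'. rate_power c n 0 t \<omega>' * g (X t \<omega>') \<partial>motion S y) =
     (\<lambda>y. \<integral>\<^sup>+\<omega>'. ennreal (exp (enn2real (rate_over c 0 t \<omega>'))) * g (X t \<omega>') \<partial>motion S y)"
    unfolding E by (rule ext, subst nn_integral_suminf[symmetric]) (auto simp: ennreal_suminf_multc)
  finally show ?thesis by meson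
qed

text \<open>The series of a negative exponent alternates in sign. With \<open>a = K - c\<close> the
  weight becomes \<open>exp (- (K * t))\<close> times the exponential of the cumulated rate of
  \<open>c\<close>, which is bounded and nonnegative, so the positive series applies.\<close>

lemma markov_exp_neg_bounded_rate:
  assumes a: "a \<in> borel_measurable borel" "\<And>y. 0 \<le> a y" "\<And>y. a y \<le> K"
    and g: "g \<in> borel_measurable borel"
    and F: "F \<in> borel_measurable (past_alg s)" and s: "0 \<le> s" "0 \<le> t"
  shows "(\<integral>\<^sup>+\<omega>. F \<omega> * (exp_neg (rate_over a s (s + t) \<omega>) * g (X (s + t) \<omega>)) \<partial>motion S x) =
    (\<integral>\<^sup>+\<omega>. F \<omega> * (\<integral>\<^sup>+\<omega>'. exp_neg (rate_over a 0 t \<omega>') * g (X t \<omega>') \<partial>motion S (X s \<omega>)) \<partial>motion S x)"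
proof -
  define c where "c = (\<lambda>y. K - a y)"
  note [measurable] = a(1) g
  have [measurable]: "c \<in> borel_measurable borel" unfolding c_def by measurable
  have [measurable]: "F \<in> borel_measurable (paths S)" by (rule past_measurableD[OF F])
  have c: "0 \<le> c y" "c y \<le> K" for y using a(2,3)[of y] by (auto simp: c_def)
  have K: "0 \<le> K" using a(2,3)[of 0] by simp
  have eq: "exp_neg (rate_over a u (u + t) \<omega>) = ennreal (exp (- (K * t))) * ennreal (exp (enn2real (rate_over c u (u + t) \<omega>)))"
    if u: "0 \<le> u" and \<omega>: "\<omega> \<in> space (paths S)" for u \<omega>
  proof -
    have "rate_over (\<lambda>y. a y + c y) u (u + t) \<omega> = ennreal (K * t)"
      using rate_over_const[of u "u + t" K] s K by (simp add: c_def)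
    then have sum: "rate_over a u (u + t) \<omega> + rate_over c u (u + t) \<omega> = ennreal (K * t)"
      using rate_over_plus[of a c \<omega>] a c \<omega> by simp
    then obtain r r' where r: "0 \<le> r" "0 \<le> r'" "rate_over a u (u + t) \<omega> = ennreal r" "rate_over c u (u + t) \<omega> = ennreal r'"
      by (metis ennreal_add_eq_top ennreal_cases ennreal_neq_top)
    then have "r + r' = K * t" using sum K s by (simp flip: ennreal_plus)
    then have "- r = - (K * t) + r'" by simp
    then have "exp (- r) = exp (- (K * t)) * exp r'" by (simp only: exp_add)
    then show ?thesis using r by (simp add: exp_neg_ennreal ennreal_mult)
  qed
  have "(\<integral>\<^sup>+\<omega>. F \<omega> * (exp_neg (rate_over a s (s + t) \<omega>) * g (X (s + t) \<omega>)) \<partial>motion S x) =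
    (\<integral>\<^sup>+\<omega>. ennreal (exp (- (K * t))) * (F \<omega> * (ennreal (exp (enn2real (rate_over c s (s + t) \<omega>))) * g (X (s + t) \<omega>))) \<partial>motion S x)"
    by (intro nn_integral_cong) (simp add: eq[OF s(1)] ac_simps)
  also have "\<dots> = ennreal (exp (- (K * t))) * (\<integral>\<^sup>+\<omega>. F \<omega> * (\<integral>\<^sup>+\<omega>'. ennreal (exp (enn2real (rate_over c 0 t \<omega>'))) * g (X t \<omega>') \<partial>motion S (X s \<omega>)) \<partial>motion S x)"
    by (subst nn_integral_cmult, measurable, subst markov_rate_exp[OF _ c g F s]) simp_all
  also have "\<dots> = (\<integral>\<^sup>+\<omega>. F \<omega> * (ennreal (exp (- (K * t))) * (\<integral>\<^sup>+\<omega>'. ennreal (exp (enn2real (rate_over c 0 t \<omega>'))) * g (X t \<omega>') \<partial>motion S (X s \<omega>))) \<partial>motion S x)"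
    by (subst nn_integral_cmult[symmetric]) (auto simp: ac_simps)
  also have "\<dots> = (\<integral>\<^sup>+\<omega>. F \<omega> * (\<integral>\<^sup>+\<omega>'. exp_neg (rate_over a 0 t \<omega>') * g (X t \<omega>') \<partial>motion S (X s \<omega>)) \<partial>motion S x)"
  proof -
    have "ennreal (exp (- (K * t))) * (\<integral>\<^sup>+\<omega>'. ennreal (exp (enn2real (rate_over c 0 t \<omega>'))) * g (X t \<omega>') \<partial>motion S y)
      = (\<integral>\<^sup>+\<omega>'. exp_neg (rate_over a 0 t \<omega>') * g (X t \<omega>') \<partial>motion S y)" for y
      using eq[of 0] by (subst nn_integral_cmult[symmetric]) (auto simp: mult.assoc intro!: nn_integral_cong)
    then show ?thesis by simp
  qed
  finally show ?thesis .
qed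

text \<open>The rate is truncated at level \<open>k\<close>. The weights decrease in
  \<open>k\<close>, so the limit is taken by dominated convergence; this is what the bound on
  \<open>F\<close> is for, and why the function of the final position is first reduced to an
  indicator.\<close>

lemma markov_exp_neg:
  assumes a: "a \<in> borel_measurable borel" "\<And>y. 0 \<le> a y"
    and g: "g \<in> borel_measurable borel"
    and F: "F \<in> borel_measurable (past_alg s)" "\<And>\<omega>. F \<omega> \<le> ennreal C" and s: "0 \<le> s" "0 \<le> t"
  shows "(\<integral>\<^sup>+\<omega>. F \<omega> * exp_neg (rate_over a s (s + t) \<omega>) * g (X (s + t) \<omega>) \<partial>motion S x) =
    (\<integral>\<^sup>+\<omega>. F \<omega> * (\<integral>\<^sup>+\<omega>'. exp_neg (rate_over a 0 t \<omega>') * g (X t \<omega>') \<partial>motion S (X s \<omega>)) \<partial>motion S x)"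
proof (rule eq_on_indicators_imp_eq[OF _ _ _ _ _ _ _ g])
  note [measurable] = a(1)
  have Fm [measurable]: "F \<in> borel_measurable (paths S)" by (rule past_measurableD[OF F(1)])
  show "(\<lambda>\<omega>. F \<omega> * exp_neg (rate_over a s (s + t) \<omega>)) \<in> borel_measurable (paths S)" by measurable
  show "(\<lambda>\<omega>'. exp_neg (rate_over a 0 t \<omega>')) \<in> borel_measurable (paths S)" by measurable
  show "X (s + t) \<in> borel_measurable (paths S)" "X s \<in> borel_measurable (paths S)" "X t \<in> borel_measurable (paths S)"
    by (auto intro!: X_measurable)
  show "F \<in> borel_measurable (paths S)" by (rule Fm)
  fix B :: "real set" assume [measurable]: "B \<in> sets borel"
  define ak where "ak = (\<lambda>k y. min (a y) (real k))"
  have [measurable]: "ak k \<in> borel_measurable borel" for k unfolding ak_def by measurable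
  have ak: "0 \<le> ak k y" "ak k y \<le> real k" for k y using a(2) by (auto simp: ak_def)
  have lim: "(\<lambda>k. exp_neg (rate_over (ak k) u v \<omega>)) \<longlonglongrightarrow> exp_neg (rate_over a u v \<omega>)" if "\<omega> \<in> space (paths S)" for u v \<omega>
    unfolding ak_def by (intro tendsto_exp_neg rate_over_LIMSEQ that) simp
  have fin: "(\<integral>\<^sup>+\<omega>. ennreal D \<partial>motion S y) < \<infinity>" for y D
    using prob_space.emeasure_space_1[OF prob_space_motion[of y]] by simp
  have lim_ind: "(\<lambda>k. exp_neg (rate_over (ak k) u v \<omega>) * indicator B z) \<longlonglongrightarrow> exp_neg (rate_over a u v \<omega>) * indicator B z" if "\<omega> \<in> space (paths S)" for u v \<omega> z
    using lim[OF that] by (auto simp: indicator_def)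
  have en_ind: "exp_neg D * indicator B z \<le> 1" for D z
    using exp_neg_le_1 by (auto simp: indicator_def)
  have limF: "(\<lambda>k. F \<omega> * h k) \<longlonglongrightarrow> F \<omega> * l" if "h \<longlonglongrightarrow> l" for h :: "nat \<Rightarrow> ennreal" and l \<omega>
    using F(2)[of \<omega>] that
    by (cases "F \<omega> = 0") (auto intro!: tendsto_mult_ennreal tendsto_const simp: top_unique)
  have bF: "F \<omega> * h \<le> ennreal C" if "h \<le> 1" for h \<omega>
    using mult_mono[OF F(2) that] by simp
  have inner: "(\<lambda>k. \<integral>\<^sup>+\<omega>'. exp_neg (rate_over (ak k) 0 t \<omega>') * indicator B (X t \<omega>') \<partial>motion S y)
    \<longlonglongrightarrow> (\<integral>\<^sup>+\<omega>'. exp_neg (rate_over a 0 t \<omega>') * indicator B (X t \<omega>') \<partial>motion S y)" for y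
    by (rule nn_integral_dominated_convergence[where w="\<lambda>_. ennreal 1"])
       (use lim_ind en_ind fin[where D=1] in \<open>auto intro!: AE_I2\<close>)
  have inner_le: "(\<integral>\<^sup>+\<omega>'. exp_neg (rate_over b 0 t \<omega>') * indicator B (X t \<omega>') \<partial>motion S y) \<le> 1" for b y
  proof -
    have "(\<integral>\<^sup>+\<omega>'. exp_neg (rate_over b 0 t \<omega>') * indicator B (X t \<omega>') \<partial>motion S y) \<le> (\<integral>\<^sup>+\<omega>'. 1 \<partial>motion S y)"
      by (intro nn_integral_mono en_ind)
    then show ?thesis using prob_space.emeasure_space_1[OF prob_space_motion[of y]] by simp
  qed
  have L1: "(\<lambda>k. \<integral>\<^sup>+\<omega>. F \<omega> * (exp_neg (rate_over (ak k) s (s + t) \<omega>) * indicator B (X (s + t) \<omega>)) \<partial>motion S x) \<longlonglongrightarrow>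
      (\<integral>\<^sup>+\<omega>. F \<omega> * (exp_neg (rate_over a s (s + t) \<omega>) * indicator B (X (s + t) \<omega>)) \<partial>motion S x)"
    by (rule nn_integral_dominated_convergence[where w="\<lambda>_. ennreal C"])
       (use limF[OF lim_ind] bF[OF en_ind] fin[where D=C] in \<open>auto intro!: AE_I2\<close>)
  have L2: "(\<lambda>k. \<integral>\<^sup>+\<omega>. F \<omega> * (\<integral>\<^sup>+\<omega>'. exp_neg (rate_over (ak k) 0 t \<omega>') * indicator B (X t \<omega>') \<partial>motion S (X s \<omega>)) \<partial>motion S x) \<longlonglongrightarrow>
     (\<integral>\<^sup>+\<omega>. F \<omega> * (\<integral>\<^sup>+\<omega>'. exp_neg (rate_over a 0 t \<omega>') * indicator B (X t \<omega>') \<partial>motion S (X s \<omega>)) \<partial>motion S x)"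
    by (rule nn_integral_dominated_convergence[where w="\<lambda>_. ennreal C"])
       (use limF[OF inner] bF[OF inner_le] fin[where D=C] in \<open>auto intro!: AE_I2\<close>)
  have "(\<integral>\<^sup>+\<omega>. F \<omega> * (exp_neg (rate_over (ak k) s (s + t) \<omega>) * indicator B (X (s + t) \<omega>)) \<partial>motion S x) =
     (\<integral>\<^sup>+\<omega>. F \<omega> * (\<integral>\<^sup>+\<omega>'. exp_neg (rate_over (ak k) 0 t \<omega>') * indicator B (X t \<omega>') \<partial>motion S (X s \<omega>)) \<partial>motion S x)" for k
    by (rule markov_exp_neg_bounded_rate[OF _ ak _ F(1) s]) measurable
  then show "(\<integral>\<^sup>+\<omega>. F \<omega> * exp_neg (rate_over a s (s + t) \<omega>) * indicator B (X (s + t) \<omega>) \<partial>motion S x) =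
    (\<integral>\<^sup>+\<omega>. F \<omega> * (\<integral>\<^sup>+\<omega>'. exp_neg (rate_over a 0 t \<omega>') * indicator B (X t \<omega>') \<partial>motion S (X s \<omega>)) \<partial>motion S x)"
    using LIMSEQ_unique[OF L1] L2 by (simp add: mult.assoc)
qed

text \<open>The time integrals of the truncated rates have versions measurable in the past.
  Countably many null sets are excluded, and the limit of these versions is again measurable in the
  past.\<close>

lemma past_version_rate_over:
  assumes a: "a \<in> borel_measurable borel" "\<And>y. 0 \<le> a y" and s: "0 \<le> s"
  shows "\<exists>J\<in>borel_measurable (past_alg s). AE \<omega> in motion S x. rate_over a 0 s \<omega> = J \<omega>"
proof -
  note [measurable] = a(1)
  define ak where "ak = (\<lambda>k y. min (a y) (real k))"
  have akm [measurable]: "ak k \<in> borel_measurable borel" for k unfolding ak_def by measurable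
  have ak: "0 \<le> ak k y" "ak k y \<le> real k" for k y using a(2) by (auto simp: ak_def)
  have "\<exists>J\<in>borel_measurable (past_alg s). AE \<omega> in motion S x. (LBINT r:{0..s}. ak k (X r \<omega>)) = J \<omega>" for k
    by (rule past_version_time_integral[OF akm _ s, of _ "real k"]) (use ak in \<open>simp add: abs_le_iff\<close>)
  then obtain J where Jm [measurable]: "\<And>k. J k \<in> borel_measurable (past_alg s)"
    and J: "\<And>k. AE \<omega> in motion S x. (LBINT r:{0..s}. ak k (X r \<omega>)) = J k \<omega>"
    by metis
  have eq: "rate_over (ak k) 0 s \<omega> = ennreal (LBINT r:{0..s}. ak k (X r \<omega>))" if \<omega>: "\<omega> \<in> space (paths S)" for k \<omega>
  proof -
    note [measurable] = X_path_measurable[OF \<omega>]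
    have int: "integrable lborel (\<lambda>r. indicat_real {0..s} r *\<^sub>R ak k (X r \<omega>))"
    proof (rule Bochner_Integration.integrable_bound)
      show "integrable lborel (\<lambda>r. indicat_real {0..s} r * real k)"
        by (intro integrable_mult_left integrable_real_indicator) (auto simp: emeasure_lborel_Icc_eq)
    qed (use ak in \<open>auto simp: indicator_def\<close>)
    have "(\<integral>\<^sup>+r. ennreal (indicat_real {0..s} r *\<^sub>R ak k (X r \<omega>)) \<partial>lborel) = ennreal (LBINT r:{0..s}. ak k (X r \<omega>))"
      unfolding set_lebesgue_integral_def by (rule nn_integral_eq_integral[OF int]) (use ak in auto)
    moreover have "(\<integral>\<^sup>+r. ennreal (indicat_real {0..s} r *\<^sub>R ak k (X r \<omega>)) \<partial>lborel) = rate_over (ak k) 0 s \<omega>"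
      unfolding rate_over_def using AE_lborel_singleton[of "0::real"]
      by (intro nn_integral_cong_AE) (auto simp: indicator_def)
    ultimately show ?thesis by simp
  qed
  have "AE \<omega> in motion S x. \<forall>k. (LBINT r:{0..s}. ak k (X r \<omega>)) = J k \<omega>"
    using J by (simp add: AE_all_countable)
  then have "AE \<omega> in motion S x. rate_over a 0 s \<omega> = lim (\<lambda>k. ennreal (J k \<omega>))"
    using AE_space
  proof eventually_elim
    case (elim \<omega>)
    then have "\<omega> \<in> space (paths S)" by simp
    from rate_over_LIMSEQ[OF a(1) this, of 0 s] eq[OF this] elim
    show ?case by (simp add: ak_def limI)
  qed
  then show ?thesis by (intro bexI[of _ "\<lambda>\<omega>. lim (\<lambda>k. ennreal (J k \<omega>))"]) measurable
qed

end

section \<open>The Feynman--Kac operators and Duhamel's formula\<close>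

locale branching_rates = markov_motion S for S :: "('a, 'z) branching_model_scheme" +
  fixes \<beta> :: real
  assumes hv: "HV S \<beta>"
begin

lemma birth_measurable [measurable]: "birth S \<in> borel_measurable borel"
  and death_measurable [measurable]: "death S \<in> borel_measurable borel"
  using hv by (auto simp: HV_def intro: borel_measurable_continuous_onI)

lemma birth_nonneg: "0 \<le> birth S y" and death_nonneg: "0 \<le> death S y" and birth_le: "birth S y \<le> \<beta>"
  and \<beta>_pos: "0 < \<beta>"
  using hv by (auto simp: HV_def)

text \<open>The Feynman--Kac weight as an extended number. An infinite cumulated death rate gives
  weight 0; the cumulated birth rate is finite because the birth rate is bounded.\<close>

definition growth :: "real \<Rightarrow> 'a \<Rightarrow> ennreal" where
  "growth t \<omega> = ennreal (exp (enn2real (rate_over (birth S) 0 t \<omega>))) * exp_neg (rate_over (death S) 0 t \<omega>)"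

definition event_rate :: "real \<Rightarrow> real" where
  "event_rate y = birth S y + death S y"

definition P :: "real \<Rightarrow> (real \<Rightarrow> ennreal) \<Rightarrow> real \<Rightarrow> ennreal" where
  "P t g x = (\<integral>\<^sup>+\<omega>. growth t \<omega> * g (X t \<omega>) \<partial>motion S x)"

definition Q :: "real \<Rightarrow> (real \<Rightarrow> ennreal) \<Rightarrow> real \<Rightarrow> ennreal" where
  "Q t g x = (\<integral>\<^sup>+\<omega>. exp_neg (rate_over event_rate 0 t \<omega>) * g (X t \<omega>) \<partial>motion S x)"

lemma event_rate_measurable [measurable]: "event_rate \<in> borel_measurable borel"
  unfolding event_rate_def by measurable

lemma event_rate_nonneg: "0 \<le> event_rate y"
  using birth_nonneg[of y] death_nonneg[of y] by (simp add: event_rate_def)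

lemma growth_measurable [measurable (raw)]:
  assumes [measurable]: "f \<in> borel_measurable M" "h \<in> M \<rightarrow>\<^sub>M paths S"
  shows "(\<lambda>w. growth (f w) (h w)) \<in> borel_measurable M"
  unfolding growth_def by measurable

lemma P_measurable [measurable (raw)]:
  assumes [measurable]: "(\<lambda>(w, y). g w y) \<in> borel_measurable (M \<Otimes>\<^sub>M borel)"
    "f \<in> borel_measurable M" "h \<in> borel_measurable M"
  shows "(\<lambda>w. P (f w) (g w) (h w)) \<in> borel_measurable M"
  unfolding P_def by measurable

lemma Q_measurable [measurable (raw)]:
  assumes [measurable]: "(\<lambda>(w, y). g w y) \<in> borel_measurable (M \<Otimes>\<^sub>M borel)"
    "f \<in> borel_measurable M" "h \<in> borel_measurable M"
  shows "(\<lambda>w. Q (f w) (g w) (h w)) \<in> borel_measurable M"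
  unfolding Q_def by measurable

lemmas birth_path = birth_measurable birth_nonneg birth_le

lemma growth_le:
  assumes \<omega>: "\<omega> \<in> space (paths S)" and t: "0 \<le> t"
  shows "growth t \<omega> \<le> ennreal (exp (\<beta> * t))"
proof -
  interpret bounded_rate "\<lambda>r. birth S (X r \<omega>)" \<beta>
    by (rule bounded_rate_path[OF birth_path \<omega>])
  have "growth t \<omega> \<le> ennreal (exp (enn2real (rate_over (birth S) 0 t \<omega>))) * 1"
    unfolding growth_def by (intro mult_left_mono exp_neg_le_1) simp
  also have "\<dots> \<le> ennreal (exp (\<beta> * t))"
    using cum_Lipschitz[OF t] by (simp add: rate_over_eq_cum[OF birth_path \<omega> order.refl t] ennreal_leI)
  finally show ?thesis .
qed

text \<open>The death factors before and after \<open>s\<close> combine into the factor for the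
  whole interval, which leaves the integral; this is valid even when it is 0. With \<open>B\<close>
  the cumulated birth rate up to \<open>t\<close>, the rest is
  \<open>exp (- B) * (1 + (exp (2 * B) - 1)) = exp B\<close>.\<close>

lemma growth_duhamel:
  assumes \<omega>: "\<omega> \<in> space (paths S)" and t: "0 \<le> t"
  shows "growth t \<omega> = exp_neg (rate_over event_rate 0 t \<omega>) +
    (\<integral>\<^sup>+s\<in>{0<..t}. growth s \<omega> * ennreal (2 * birth S (X s \<omega>)) * exp_neg (rate_over event_rate s t \<omega>) \<partial>lborel)"
proof -
  interpret bounded_rate "\<lambda>r. birth S (X r \<omega>)" \<beta>
    by (rule bounded_rate_path[OF birth_path \<omega>])
  note [measurable] = X_path_measurable[OF \<omega>]
  define D where "D = exp_neg (rate_over (death S) 0 t \<omega>)"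
  have ev: "exp_neg (rate_over event_rate s t \<omega>) = ennreal (exp (cum s - cum t)) * exp_neg (rate_over (death S) s t \<omega>)"
    if "0 \<le> s" "s \<le> t" for s
    using cum_mono[OF that(2)] unfolding event_rate_def
    by (subst rate_over_plus[OF _ _ birth_nonneg death_nonneg \<omega>])
       (auto simp: exp_neg_add rate_over_eq_cum[OF birth_path \<omega> that] exp_neg_ennreal)
  have gr: "growth s \<omega> = ennreal (exp (cum s)) * exp_neg (rate_over (death S) 0 s \<omega>)" if "0 \<le> s" for s
    using rate_over_eq_cum[OF birth_path \<omega> order.refl that] by (simp add: growth_def)
  have "growth s \<omega> * ennreal (2 * birth S (X s \<omega>)) * exp_neg (rate_over event_rate s t \<omega>) =
    D * ennreal (exp (- cum t)) * (ennreal (birth S (X s \<omega>)) * ennreal (2 * exp (2 * cum s)))"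
    if "0 \<le> s" "s \<le> t" for s
  proof -
    have "exp (cum s) * (2 * birth S (X s \<omega>)) * exp (cum s - cum t) = exp (- cum t) * (birth S (X s \<omega>) * (2 * exp (2 * cum s)))"
      by (simp add: exp_diff exp_minus field_simps exp_double power2_eq_square)
    then have "ennreal (exp (cum s)) * ennreal (2 * birth S (X s \<omega>)) * ennreal (exp (cum s - cum t)) =
        ennreal (exp (- cum t)) * (ennreal (birth S (X s \<omega>)) * ennreal (2 * exp (2 * cum s)))"
      using birth_nonneg by (simp add: ennreal_mult[symmetric])
    moreover have "D = exp_neg (rate_over (death S) 0 s \<omega>) * exp_neg (rate_over (death S) s t \<omega>)"
      using rate_over_split[OF death_measurable \<omega> that] by (simp add: D_def exp_neg_add)
    ultimately show ?thesis
      by (simp add: ev[OF that] gr[OF that(1)] ac_simps)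
  qed
  then have "(\<integral>\<^sup>+s\<in>{0<..t}. growth s \<omega> * ennreal (2 * birth S (X s \<omega>)) * exp_neg (rate_over event_rate s t \<omega>) \<partial>lborel) =
    (\<integral>\<^sup>+s. D * ennreal (exp (- cum t)) * (ennreal (birth S (X s \<omega>)) * ennreal (2 * exp (2 * cum s)) * indicator {0<..t} s) \<partial>lborel)"
    by (intro nn_integral_cong) (auto simp: indicator_def mult.assoc)
  also have "\<dots> = D * ennreal (exp (- cum t)) * ennreal (exp (2 * cum t) - 1)"
    by (subst nn_integral_cmult) (simp_all add: nn_integral_cum_exp[OF t])
  finally have "exp_neg (rate_over event_rate 0 t \<omega>) +
    (\<integral>\<^sup>+s\<in>{0<..t}. growth s \<omega> * ennreal (2 * birth S (X s \<omega>)) * exp_neg (rate_over event_rate s t \<omega>) \<partial>lborel)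
    = D * (ennreal (exp (- cum t)) * (1 + ennreal (exp (2 * cum t) - 1)))"
    using ev[OF order.refl t] by (simp add: D_def distrib_left ac_simps)
  also have "ennreal (exp (- cum t)) * (1 + ennreal (exp (2 * cum t) - 1)) = ennreal (exp (cum t))"
  proof -
    have "1 + ennreal (exp (2 * cum t) - 1) = ennreal (exp (2 * cum t))"
      by (subst ennreal_1[symmetric], subst ennreal_plus[symmetric]) auto
    moreover have "exp (- cum t) * exp (2 * cum t) = exp (cum t)"
      by (simp flip: exp_add)
    ultimately show ?thesis by (simp flip: ennreal_mult)
  qed
  finally show ?thesis using gr[OF t] by (simp add: D_def mult.commute)
qed

text \<open>The Markov property at the time \<open>s\<close> where the weight switches from growth
  to killing.\<close>

lemma markov_growth:
  assumes g [measurable]: "g \<in> borel_measurable borel" and s: "0 \<le> s" "s \<le> t"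
  shows "(\<integral>\<^sup>+\<omega>. growth s \<omega> * ennreal (2 * birth S (X s \<omega>)) * exp_neg (rate_over event_rate s t \<omega>) * g (X t \<omega>) \<partial>motion S x) =
    P s (\<lambda>y. ennreal (2 * birth S y) * Q (t - s) g y) x"
proof -
  define F where "F = (\<lambda>\<omega>. growth s \<omega> * ennreal (2 * birth S (X s \<omega>)))"
  define C where "C = exp (\<beta> * s) * (2 * \<beta>)"
  obtain Jb where Jb [measurable]: "Jb \<in> borel_measurable (past_alg s)" "AE \<omega> in motion S x. rate_over (birth S) 0 s \<omega> = Jb \<omega>"
    using past_version_rate_over[OF birth_measurable birth_nonneg s(1)] by metis
  obtain Jd where Jd [measurable]: "Jd \<in> borel_measurable (past_alg s)" "AE \<omega> in motion S x. rate_over (death S) 0 s \<omega> = Jd \<omega>"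
    using past_version_rate_over[OF death_measurable death_nonneg s(1)] by metis
  have [measurable]: "X s \<in> borel_measurable (past_alg s)" by (rule X_past_measurable[OF s(1) order.refl])
  \<comment> \<open>The weight up to \<open>s\<close> need not be a function of the past, so past
    versions of the two cumulated rates are substituted. The minimum with \<open>C\<close>, the
    bound from \<open>growth_le\<close> and \<open>birth_le\<close>, makes the result bounded at
    every point and is inactive almost surely.\<close>
  define F' where "F' = (\<lambda>\<omega>. min (ennreal C) (ennreal (exp (enn2real (Jb \<omega>))) * exp_neg (Jd \<omega>) * ennreal (2 * birth S (X s \<omega>))))"
  have F': "F' \<in> borel_measurable (past_alg s)" unfolding F'_def by measurable
  have F'm [measurable]: "F' \<in> borel_measurable (paths S)" by (rule past_measurableD[OF F'])
  have eq: "AE \<omega> in motion S x. F \<omega> = F' \<omega>"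
    using Jb(2) Jd(2) AE_space
  proof eventually_elim
    case (elim \<omega>)
    then have \<omega>: "\<omega> \<in> space (paths S)" by simp
    have "F \<omega> \<le> ennreal (exp (\<beta> * s)) * ennreal (2 * \<beta>)"
      unfolding F_def using growth_le[OF \<omega> s(1)] birth_le[of "X s \<omega>"]
      by (intro mult_mono ennreal_leI) (auto simp: birth_nonneg)
    also have "\<dots> = ennreal C" using \<beta>_pos by (simp add: C_def ennreal_mult)
    finally show ?case using elim by (simp add: F_def F'_def growth_def min_def)
  qed
  have "(\<integral>\<^sup>+\<omega>. F \<omega> * exp_neg (rate_over event_rate s t \<omega>) * g (X t \<omega>) \<partial>motion S x) =
     (\<integral>\<^sup>+\<omega>. F' \<omega> * exp_neg (rate_over event_rate s (s + (t - s)) \<omega>) * g (X (s + (t - s)) \<omega>) \<partial>motion S x)"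
    using eq by (intro nn_integral_cong_AE) auto
  also have "\<dots> = (\<integral>\<^sup>+\<omega>. F' \<omega> * Q (t - s) g (X s \<omega>) \<partial>motion S x)"
    unfolding Q_def
    by (rule markov_exp_neg[OF event_rate_measurable event_rate_nonneg g F', where C=C]) (use s in \<open>auto simp: F'_def\<close>)
  also have "\<dots> = (\<integral>\<^sup>+\<omega>. F \<omega> * Q (t - s) g (X s \<omega>) \<partial>motion S x)"
    using eq by (intro nn_integral_cong_AE) auto
  finally show ?thesis by (simp add: F_def P_def mult.assoc)
qed

text \<open>Expectation of the pathwise formula, by Fubini and the Markov property at the switching
  time.\<close>

lemma duhamel:
  assumes g [measurable]: "g \<in> borel_measurable borel" and t: "0 \<le> t"
  shows "P t g x = Q t g x + (\<integral>\<^sup>+s\<in>{0<..t}. P s (\<lambda>y. ennreal (2 * birth S y) * Q (t - s) g y) x \<partial>lborel)"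
proof -
  define h where "h = (\<lambda>s \<omega>. growth s \<omega> * ennreal (2 * birth S (X s \<omega>)) * exp_neg (rate_over event_rate s t \<omega>))"
  have [measurable]: "(\<lambda>(s, \<omega>). h s \<omega>) \<in> borel_measurable (borel \<Otimes>\<^sub>M paths S)"
    unfolding h_def by measurable
  have "P t g x = (\<integral>\<^sup>+\<omega>. exp_neg (rate_over event_rate 0 t \<omega>) * g (X t \<omega>) +
    (\<integral>\<^sup>+s. h s \<omega> * g (X t \<omega>) * indicator {0<..t} s \<partial>lborel) \<partial>motion S x)"
    unfolding P_def
  proof (intro nn_integral_cong)
    fix \<omega> assume "\<omega> \<in> space (motion S x)"
    then have \<omega>: "\<omega> \<in> space (paths S)" by simp
    note [measurable] = X_path_measurable[OF \<omega>]
    have [measurable]: "(\<lambda>s. h s \<omega>) \<in> borel_measurable borel"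
      using \<omega> by measurable
    show "growth t \<omega> * g (X t \<omega>) = exp_neg (rate_over event_rate 0 t \<omega>) * g (X t \<omega>) +
      (\<integral>\<^sup>+s. h s \<omega> * g (X t \<omega>) * indicator {0<..t} s \<partial>lborel)"
    proof -
      have gd: "growth t \<omega> = exp_neg (rate_over event_rate 0 t \<omega>) + (\<integral>\<^sup>+s\<in>{0<..t}. h s \<omega> \<partial>lborel)"
        unfolding h_def by (rule growth_duhamel[OF \<omega> t])
      show ?thesis
        unfolding gd distrib_right by (subst nn_integral_multc[symmetric]) (simp_all add: mult_ac)
    qed
  qed
  also have "\<dots> = Q t g x + (\<integral>\<^sup>+\<omega>. (\<integral>\<^sup>+s. h s \<omega> * g (X t \<omega>) * indicator {0<..t} s \<partial>lborel) \<partial>motion S x)"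
    unfolding Q_def by (rule nn_integral_add) measurable
  also have "(\<integral>\<^sup>+\<omega>. (\<integral>\<^sup>+s. h s \<omega> * g (X t \<omega>) * indicator {0<..t} s \<partial>lborel) \<partial>motion S x) =
     (\<integral>\<^sup>+s. (\<integral>\<^sup>+\<omega>. h s \<omega> * g (X t \<omega>) * indicator {0<..t} s \<partial>motion S x) \<partial>lborel)"
    by (rule motion_fubini) measurable
  also have "\<dots> = (\<integral>\<^sup>+s\<in>{0<..t}. P s (\<lambda>y. ennreal (2 * birth S y) * Q (t - s) g y) x \<partial>lborel)"
  proof (intro nn_integral_cong)
    fix s
    show "(\<integral>\<^sup>+\<omega>. h s \<omega> * g (X t \<omega>) * indicator {0<..t} s \<partial>motion S x) =
        P s (\<lambda>y. ennreal (2 * birth S y) * Q (t - s) g y) x * indicator {0<..t} s"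
      using markov_growth[OF g, of s t x] by (cases "s \<in> {0<..t}") (auto simp: h_def)
  qed
  finally show ?thesis .
qed

lemma P_add:
  assumes [measurable]: "g \<in> borel_measurable borel" "h \<in> borel_measurable borel"
  shows "P t (\<lambda>y. g y + h y) x = P t g x + P t h x"
  unfolding P_def distrib_left by (rule nn_integral_add) measurable

lemma P_nn_integral:
  fixes G :: "real \<Rightarrow> real \<Rightarrow> ennreal"
  assumes [measurable]: "(\<lambda>(s, y). G s y) \<in> borel_measurable (borel \<Otimes>\<^sub>M borel)"
  shows "P t (\<lambda>y. \<integral>\<^sup>+s. G s y \<partial>lborel) x = (\<integral>\<^sup>+s. P t (G s) x \<partial>lborel)"
proof -
  have "P t (\<lambda>y. \<integral>\<^sup>+s. G s y \<partial>lborel) x = (\<integral>\<^sup>+\<omega>. (\<integral>\<^sup>+s. growth t \<omega> * G s (X t \<omega>) \<partial>lborel) \<partial>motion S x)"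
    unfolding P_def by (intro nn_integral_cong nn_integral_cmult[symmetric]) measurable
  also have "\<dots> = (\<integral>\<^sup>+s. P t (G s) x \<partial>lborel)"
    unfolding P_def by (rule motion_fubini) measurable
  finally show ?thesis .
qed

text \<open>
  Duhamel's formula with the roles of \<open>P\<close> and \<open>Q\<close> as above turns the equation satisfied by \<open>u\<close>
  directly into the one for \<open>P\<close>, without an appeal to uniqueness; the term with \<open>u\<close> stays on
  the left so that all quantities are nonnegative.
\<close>

lemma renewal_equation_P:
  assumes u [measurable]: "(\<lambda>(t, x). u t x) \<in> borel_measurable (borel \<Otimes>\<^sub>M borel)"
    and k [measurable]: "(\<lambda>(t, x). k t x) \<in> borel_measurable (borel \<Otimes>\<^sub>M borel)"
    and g [measurable]: "g \<in> borel_measurable borel"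
    and eq: "\<And>t x. 0 \<le> t \<Longrightarrow> u t x = Q t g x + (\<integral>\<^sup>+s\<in>{0<..t}. Q s (\<lambda>y. ennreal (birth S y) * k (t - s) y) x \<partial>lborel)"
    and t: "0 \<le> t"
  shows "u t x + (\<integral>\<^sup>+s\<in>{0<..t}. P s (\<lambda>y. ennreal (2 * birth S y) * u (t - s) y) x \<partial>lborel) =
    P t g x + (\<integral>\<^sup>+s\<in>{0<..t}. P s (\<lambda>y. ennreal (birth S y) * k (t - s) y) x \<partial>lborel)"
proof -
  define q where "q = (\<lambda>s y. ennreal (birth S y) * k (t - s) y)"
  have [measurable]: "(\<lambda>(s, y). q s y) \<in> borel_measurable (borel \<Otimes>\<^sub>M borel)"
    unfolding q_def by measurable
  have qm [measurable]: "q s \<in> borel_measurable borel" for s unfolding q_def by measurable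
  \<comment> \<open>The integrand of Duhamel's correction to \<open>Q s (q s)\<close>: growth for a
    time \<open>r\<close>, then killing for the remaining \<open>s - r\<close>.\<close>
  define R where "R = (\<lambda>r s. P r (\<lambda>y. ennreal (2 * birth S y) * Q (s - r) (q s) y) x)"
  have [measurable]: "(\<lambda>(r, s). R r s) \<in> borel_measurable (borel \<Otimes>\<^sub>M borel)"
    unfolding R_def by measurable
  \<comment> \<open>The source part of the equation at time \<open>t - r\<close>, so that
    \<open>u (t - r)\<close> is \<open>Q (t - r) g\<close> plus \<open>w r\<close>.\<close>
  define w where "w = (\<lambda>r y. (\<integral>\<^sup>+s\<in>{0<..t - r}. Q s (\<lambda>y. ennreal (birth S y) * k (t - r - s) y) y \<partial>lborel))"
  have "(\<lambda>(r, y). \<integral>\<^sup>+s. Q s (\<lambda>y. ennreal (birth S y) * k (t - r - s) y) y * (if 0 < s \<and> s \<le> t - r then 1 else 0) \<partial>lborel) \<in> borel_measurable (borel \<Otimes>\<^sub>M borel)"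
    by measurable
  then have [measurable]: "(\<lambda>(r, y). w r y) \<in> borel_measurable (borel \<Otimes>\<^sub>M borel)"
    by (simp add: w_def indicator_def)
  \<comment> \<open>For fixed \<open>r\<close>, shifting \<open>s\<close> by \<open>r\<close>
    rebuilds \<open>w r\<close>. The condition \<open>r \<le> s \<le> t\<close> describes the
    triangle on which the order of integration is exchanged.\<close>
  have inner: "(\<integral>\<^sup>+s. R r s * (if 0 < r \<and> r \<le> s \<and> s \<le> t then 1 else 0) \<partial>lborel) =
    P r (\<lambda>y. ennreal (2 * birth S y) * w r y) x * indicator {0<..t} r"
    for r
  proof (cases "r \<in> {0<..t}")
    case True
    have "(\<integral>\<^sup>+s. R r s * (if 0 < r \<and> r \<le> s \<and> s \<le> t then 1 else 0) \<partial>lborel) = (\<integral>\<^sup>+s\<in>{r<..r + (t - r)}. R r s \<partial>lborel)"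
      using True AE_lborel_singleton[of r] by (intro nn_integral_cong_AE) (auto simp: indicator_def)
    also have "\<dots> = (\<integral>\<^sup>+s\<in>{0<..t - r}. R r (r + s) \<partial>lborel)"
      by (rule nn_integral_Ioc_shift) measurable
    also have "\<dots> = (\<integral>\<^sup>+s. P r (\<lambda>y. ennreal (2 * birth S y) * (Q s (\<lambda>y. ennreal (birth S y) * k (t - r - s) y) y * indicator {0<..t - r} s)) x \<partial>lborel)"
    proof (intro nn_integral_cong)
      fix s
      show "R r (r + s) * indicator {0<..t - r} s =
        P r (\<lambda>y. ennreal (2 * birth S y) * (Q s (\<lambda>y. ennreal (birth S y) * k (t - r - s) y) y * indicator {0<..t - r} s)) x"
        by (cases "s \<in> {0<..t - r}") (auto simp: R_def q_def P_def diff_diff_eq)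
    qed
    also have "\<dots> = P r (\<lambda>y. \<integral>\<^sup>+s. ennreal (2 * birth S y) * (Q s (\<lambda>y. ennreal (birth S y) * k (t - r - s) y) y * indicator {0<..t - r} s) \<partial>lborel) x"
      by (rule P_nn_integral[symmetric]) measurable
    also have "\<dots> = P r (\<lambda>y. ennreal (2 * birth S y) * w r y) x"
      unfolding w_def by (subst nn_integral_cmult) simp_all
    finally show ?thesis using True by simp
  next
    case False
    then have *: "\<not> (0 < r \<and> r \<le> s \<and> s \<le> t)" for s by auto
    show ?thesis using False by (simp add: *)
  qed
  have "(\<integral>\<^sup>+s\<in>{0<..t}. P s (q s) x \<partial>lborel) =
    (\<integral>\<^sup>+s. Q s (q s) x * indicator {0<..t} s + (\<integral>\<^sup>+r. R r s * (if 0 < r \<and> r \<le> s \<and> s \<le> t then 1 else 0) \<partial>lborel) \<partial>lborel)"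
  proof (intro nn_integral_cong)
    fix s
    show "P s (q s) x * indicator {0<..t} s =
      Q s (q s) x * indicator {0<..t} s + (\<integral>\<^sup>+r. R r s * (if 0 < r \<and> r \<le> s \<and> s \<le> t then 1 else 0) \<partial>lborel)"
    proof (cases "s \<in> {0<..t}")
      case True
      then have "(\<integral>\<^sup>+r. R r s * (if 0 < r \<and> r \<le> s \<and> s \<le> t then 1 else 0) \<partial>lborel) = (\<integral>\<^sup>+r\<in>{0<..s}. R r s \<partial>lborel)"
        by (intro nn_integral_cong) (auto simp: indicator_def)
      then show ?thesis using True duhamel[of "q s" s x] by (simp add: R_def)
    next
      case False
      then have *: "\<not> (0 < r \<and> r \<le> s \<and> s \<le> t)" for r by auto
      show ?thesis using False by (simp add: *)
    qed
  qed
  also have "\<dots> = (\<integral>\<^sup>+s\<in>{0<..t}. Q s (q s) x \<partial>lborel) +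
    (\<integral>\<^sup>+s. (\<integral>\<^sup>+r. R r s * (if 0 < r \<and> r \<le> s \<and> s \<le> t then 1 else 0) \<partial>lborel) \<partial>lborel)"
    by (rule nn_integral_add) measurable
  also have "(\<integral>\<^sup>+s. (\<integral>\<^sup>+r. R r s * (if 0 < r \<and> r \<le> s \<and> s \<le> t then 1 else 0) \<partial>lborel) \<partial>lborel) =
     (\<integral>\<^sup>+r. (\<integral>\<^sup>+s. R r s * (if 0 < r \<and> r \<le> s \<and> s \<le> t then 1 else 0) \<partial>lborel) \<partial>lborel)"
    by (rule lborel_pair.Fubini') measurable
  finally have 1: "(\<integral>\<^sup>+s\<in>{0<..t}. P s (q s) x \<partial>lborel) = (\<integral>\<^sup>+s\<in>{0<..t}. Q s (q s) x \<partial>lborel) +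
     (\<integral>\<^sup>+r\<in>{0<..t}. P r (\<lambda>y. ennreal (2 * birth S y) * w r y) x \<partial>lborel)"
    by (simp add: inner)
  \<comment> \<open>The equation at \<open>t - r\<close> splits the term with \<open>u\<close> into
    Duhamel's correction for \<open>g\<close> and the one for the source, found in
    \<open>1\<close>.\<close>
  have "(\<integral>\<^sup>+s\<in>{0<..t}. P s (\<lambda>y. ennreal (2 * birth S y) * u (t - s) y) x \<partial>lborel) =
     (\<integral>\<^sup>+r. P r (\<lambda>y. ennreal (2 * birth S y) * Q (t - r) g y) x * indicator {0<..t} r +
       P r (\<lambda>y. ennreal (2 * birth S y) * w r y) x * indicator {0<..t} r \<partial>lborel)"
  proof (intro nn_integral_cong)
    fix r
    show "P r (\<lambda>y. ennreal (2 * birth S y) * u (t - r) y) x * indicator {0<..t} r =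
       P r (\<lambda>y. ennreal (2 * birth S y) * Q (t - r) g y) x * indicator {0<..t} r +
       P r (\<lambda>y. ennreal (2 * birth S y) * w r y) x * indicator {0<..t} r"
      by (cases "r \<in> {0<..t}") (auto simp: eq distrib_left P_add w_def P_add[where h="\<lambda>y. ennreal (2 * birth S y) * w r y", unfolded w_def])
  qed
  also have "\<dots> = (\<integral>\<^sup>+r\<in>{0<..t}. P r (\<lambda>y. ennreal (2 * birth S y) * Q (t - r) g y) x \<partial>lborel) +
     (\<integral>\<^sup>+r\<in>{0<..t}. P r (\<lambda>y. ennreal (2 * birth S y) * w r y) x \<partial>lborel)"
    by (rule nn_integral_add) measurable
  \<comment> \<open>Both sides consist of \<open>Q t g\<close>, the source integral with
    \<open>Q\<close>, and the same two corrections.\<close>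
  finally show ?thesis
    using 1 duhamel[OF g t, of x] eq[OF t, of x] by (simp add: q_def ac_simps)
qed

end

section \<open>The branching process\<close>

declare birth_rings.simps [simp del] birth_age.simps [simp del] gives_birth.simps [simp del] active_at_age.simps [simp del]

locale branching_tree = branching_rates S \<beta> for S :: "('a, 'z) branching_model_scheme" and \<beta> +
  assumes branching: "branching_process S"
begin

lemma cum_rate_eq: "cum_rate S a \<omega> t = rate_over a 0 t \<omega>"
proof -
  have "cum_rate S a \<omega> t = (\<integral>\<^sup>+r\<in>{0..t}. ennreal (a (X r \<omega>)) \<partial>lborel)"
    unfolding cum_rate_def by (intro nn_integral_cong) (auto simp: indicator_def X_eq)
  also have "\<dots> = rate_over a 0 t \<omega>"
    unfolding rate_over_def using AE_lborel_singleton[of "0::real"]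
    by (intro nn_integral_cong_AE) (auto simp: indicator_def)
  finally show ?thesis .
qed

lemma space_mark_space: "space (mark_space S) = space (paths S) \<times> UNIV"
  by (auto simp: mark_space_def space_pair_measure)

lemma mark_measurable [measurable]:
  "fst \<in> mark_space S \<rightarrow>\<^sub>M paths S"
  "(\<lambda>m. fst (snd m)) \<in> borel_measurable (mark_space S)"
  "(\<lambda>m. snd (snd m)) \<in> borel_measurable (mark_space S)"
  unfolding mark_space_def by measurable

lemma ring_iff:
  assumes \<omega>: "\<omega> \<in> space (paths S)"
  shows "ennreal e \<le> cum_rate S (birth S) \<omega> a \<longleftrightarrow> e \<le> bounded_rate.cum (\<lambda>r. birth S (X r \<omega>)) a"
proof -
  interpret bounded_rate "\<lambda>r. birth S (X r \<omega>)" \<beta>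
    by (rule bounded_rate_path[OF birth_path \<omega>])
  have "cum_rate S (birth S) \<omega> a = ennreal (cum a)"
  proof (cases "0 \<le> a")
    case True
    then show ?thesis
      using rate_over_eq_cum[OF birth_path \<omega> order.refl] by (simp add: cum_rate_eq)
  next
    case False
    then show ?thesis by (simp add: cum_rate_def)
  qed
  then show ?thesis by (simp add: ennreal_le_iff)
qed

lemma birth_age_nonneg: "0 \<le> birth_age S m"
proof (cases m)
  case (fields \<omega> e e')
  have "0 \<le> Inf {a. 0 \<le> a \<and> ennreal e \<le> cum_rate S (birth S) \<omega> a}" if "birth_rings S (\<omega>, e, e')"
    using that by (intro cInf_greatest) (auto simp: birth_rings.simps)
  then show ?thesis by (simp add: fields birth_age.simps)
qed

lemma birth_age_le_iff:
  assumes \<omega>: "\<omega> \<in> space (paths S)" and "birth_rings S (\<omega>, e, e')" "0 \<le> a"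
  shows "birth_age S (\<omega>, e, e') \<le> a \<longleftrightarrow> ennreal e \<le> cum_rate S (birth S) \<omega> a"
proof -
  interpret bounded_rate "\<lambda>r. birth S (X r \<omega>)" \<beta>
    by (rule bounded_rate_path[OF birth_path \<omega>])
  obtain a0 where "0 \<le> a0" "e \<le> cum a0" using assms(2) by (auto simp: birth_rings.simps ring_iff[OF \<omega>])
  from hit_le_iff[OF this assms(3)] show ?thesis
    using assms(2) by (simp add: birth_age.simps ring_iff[OF \<omega>] hit_def)
qed

text \<open>Monotonicity of the cumulated rate replaces the quantifier over real ages by a countable
  one, for measurability.\<close>

lemma birth_rings_iff_nat:
  "birth_rings S m \<longleftrightarrow> (\<exists>n::nat. ennreal (fst (snd m)) \<le> rate_over (birth S) 0 (real n) (fst m))"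
proof (cases m)
  case (fields \<omega> e e')
  have "rate_over (birth S) 0 a \<omega> \<le> rate_over (birth S) 0 (real n) \<omega>" if "a \<le> real n" for a n
    unfolding rate_over_def using that by (intro nn_integral_mono) (auto simp: indicator_def)
  then show ?thesis
    unfolding fields birth_rings.simps cum_rate_eq fst_conv snd_conv
    by (metis of_nat_0_le_iff order_trans real_arch_simple)
qed

lemma birth_rings_measurable [measurable]: "Measurable.pred (mark_space S) (birth_rings S)"
  by (subst birth_rings_iff_nat[abs_def]) measurable

lemma birth_age_measurable [measurable]: "birth_age S \<in> borel_measurable (mark_space S)"
proof (rule borel_measurable_iff_le[THEN iffD2], rule allI)
  fix a :: real
  \<comment> \<open>A mark whose birth clock never rings has age 0 by convention, hence lies in
    every sublevel set with \<open>0 \<le> a\<close>.\<close>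
  have "{m \<in> space (mark_space S). birth_age S m \<le> a} =
    (if 0 \<le> a then {m \<in> space (mark_space S). \<not> birth_rings S m \<or> ennreal (fst (snd m)) \<le> rate_over (birth S) 0 a (fst m)} else {})"
  proof (cases "0 \<le> a")
    case True
    have "birth_age S m \<le> a \<longleftrightarrow> \<not> birth_rings S m \<or> ennreal (fst (snd m)) \<le> rate_over (birth S) 0 a (fst m)"
      if "m \<in> space (mark_space S)" for m
    proof (cases m)
      case (fields \<omega> e e')
      show ?thesis
      proof (cases "birth_rings S m")
        case True
        then show ?thesis
          using that birth_age_le_iff[of \<omega> e e' a] \<open>0 \<le> a\<close> unfolding fields
          by (simp add: space_mark_space cum_rate_eq)
      next
        case False
        then show ?thesis using \<open>0 \<le> a\<close> unfolding fields by (simp add: birth_age.simps)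
      qed
    qed
    then show ?thesis using True by auto
  next
    case False
    then have "\<not> birth_age S m \<le> a" for m using birth_age_nonneg[of m] by linarith
    then show ?thesis using False by simp
  qed
  also have "\<dots> \<in> sets (mark_space S)" by simp
  finally show "{m \<in> space (mark_space S). birth_age S m \<le> a} \<in> sets (mark_space S)" .
qed

lemma gives_birth_eq: "gives_birth S m \<longleftrightarrow> birth_rings S m \<and>
    rate_over (death S) 0 (birth_age S m) (fst m) < ennreal (snd (snd m))"
  by (cases m) (simp add: gives_birth.simps cum_rate_eq)

lemma gives_birth_measurable [measurable]: "Measurable.pred (mark_space S) (gives_birth S)"
  unfolding gives_birth_eq[abs_def] by measurable

lemma active_at_age_eq: "active_at_age S t m \<longleftrightarrow> 0 \<le> t \<and>
    rate_over (birth S) 0 t (fst m) < ennreal (fst (snd m)) \<and>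
    rate_over (death S) 0 t (fst m) < ennreal (snd (snd m))"
  by (cases m) (simp add: active_at_age.simps cum_rate_eq)

lemma active_at_age_measurable [measurable (raw)]:
  assumes [measurable]: "f \<in> borel_measurable M" "g \<in> M \<rightarrow>\<^sub>M mark_space S"
  shows "Measurable.pred M (\<lambda>w. active_at_age S (f w) (g w))"
  unfolding active_at_age_eq by measurable

lemma birth_trait_eq: "birth_trait S m = X (birth_age S m) (fst m)"
  by (simp add: birth_trait_def X_eq birth_age_nonneg)

lemma birth_trait_measurable [measurable]: "birth_trait S \<in> borel_measurable (mark_space S)"
  unfolding birth_trait_eq[abs_def] by measurable

text \<open>Activity requires the cumulated birth rate to be strictly below the clock, a birth
  requires it to have reached the clock. So a node that is counted has no counted
  descendants.\<close>

lemma active_imp_not_born: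
  assumes "m \<in> space (mark_space S)" "active_at_age S t m"
  shows "\<not> (gives_birth S m \<and> birth_age S m \<le> t)"
proof (cases m)
  case (fields \<omega> e e')
  then show ?thesis
    using assms birth_age_le_iff[of \<omega> e e' t]
    by (auto simp: space_mark_space active_at_age.simps gives_birth.simps)
qed

section \<open>Measurability of the random population\<close>

lemma tree_component_measurable:
  "g \<in> M \<rightarrow>\<^sub>M tree_space S \<Longrightarrow> (\<lambda>w. g w u) \<in> M \<rightarrow>\<^sub>M mark_space S"
  unfolding tree_space_def by (rule measurable_compose[OF _ measurable_component_singleton]) auto

lemma subtree_measurable:
  assumes "g \<in> M \<rightarrow>\<^sub>M tree_space S"
  shows "(\<lambda>w v. g w (i # v)) \<in> M \<rightarrow>\<^sub>M tree_space S"
proof -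
  have "(\<lambda>w. g w u) \<in> M \<rightarrow>\<^sub>M mark_space S" for u
    using assms by (rule tree_component_measurable)
  then show ?thesis
    unfolding tree_space_def by (intro measurable_PiM_single') (auto simp: measurable_def)
qed

lemma pair_tree_measurable [measurable]:
  "(\<lambda>p. snd p u) \<in> borel \<Otimes>\<^sub>M tree_space S \<rightarrow>\<^sub>M mark_space S"
  "(\<lambda>p v. snd p (i # v)) \<in> borel \<Otimes>\<^sub>M tree_space S \<rightarrow>\<^sub>M tree_space S"
  by (intro tree_component_measurable subtree_measurable measurable_snd)+

lemma graft_measurable [measurable (raw)]:
  assumes "f \<in> M \<rightarrow>\<^sub>M mark_space S" "g \<in> M \<rightarrow>\<^sub>M tree_space S" "h \<in> M \<rightarrow>\<^sub>M tree_space S"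
  shows "(\<lambda>w. graft (f w) (g w) (h w)) \<in> M \<rightarrow>\<^sub>M tree_space S"
proof -
  have *: "(\<lambda>w. graft (f w) (g w) (h w) u) \<in> M \<rightarrow>\<^sub>M mark_space S" for u
  proof (cases u)
    case (Cons i v)
    then show ?thesis
      using tree_component_measurable[OF assms(2)] tree_component_measurable[OF assms(3)] by (cases i) (simp_all add: graft_def)
  qed (use assms(1) in \<open>simp add: graft_def\<close>)
  then show ?thesis
    unfolding tree_space_def by (intro measurable_PiM_single') (auto simp: measurable_def)
qed

lemma alive_measurable_pair: "Measurable.pred (borel \<Otimes>\<^sub>M tree_space S) (\<lambda>p. alive S (fst p) u (snd p))"
proof (induction u)
  case Nil
  show ?case by simp
next
  case (Cons i u)
  have "(\<lambda>p. (fst p - birth_age S (snd p []), \<lambda>v. snd p (i # v))) \<in> borel \<Otimes>\<^sub>M tree_space S \<rightarrow>\<^sub>M borel \<Otimes>\<^sub>M tree_space S"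
    by measurable
  from measurable_compose[OF this Cons] show ?case by simp
qed

lemma alive_measurable [measurable (raw)]:
  assumes [measurable]: "f \<in> borel_measurable M" "g \<in> M \<rightarrow>\<^sub>M tree_space S"
  shows "Measurable.pred M (\<lambda>w. alive S (f w) u (g w))"
proof -
  have "(\<lambda>w. (f w, g w)) \<in> M \<rightarrow>\<^sub>M borel \<Otimes>\<^sub>M tree_space S" by measurable
  from measurable_compose[OF this alive_measurable_pair] show ?thesis by simp
qed

text \<open>The summand of one node, extended by 0: the index set of \<open>Z_int\<close> is random,
  while measurability is proved node by node.\<close>

definition contrib :: "(real \<Rightarrow> real) \<Rightarrow> real \<Rightarrow> bool list \<Rightarrow> 'a tree \<Rightarrow> real" where
  "contrib f t u \<tau> = (if alive S t u \<tau> then f (trait S t u \<tau>) else 0)"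

lemma contrib_Nil: "contrib f t [] \<tau> = (if active_at_age S t (\<tau> []) then f (X t (fst (\<tau> []))) else 0)"
  by (auto simp: contrib_def active_at_age_eq X_eq)

lemma contrib_Cons: "contrib f t (i # u) \<tau> =
    (if gives_birth S (\<tau> []) then contrib f (t - birth_age S (\<tau> [])) u (\<lambda>v. \<tau> (i # v)) else 0)"
  by (simp add: contrib_def)

lemma contrib_measurable_pair:
  assumes [measurable]: "f \<in> borel_measurable borel"
  shows "(\<lambda>p. contrib f (fst p) u (snd p)) \<in> borel_measurable (borel \<Otimes>\<^sub>M tree_space S)"
proof (induction u)
  case Nil
  show ?case unfolding contrib_Nil by measurable
next
  case (Cons i u)
  have "(\<lambda>p. (fst p - birth_age S (snd p []), \<lambda>v. snd p (i # v))) \<in> borel \<Otimes>\<^sub>M tree_space S \<rightarrow>\<^sub>M borel \<Otimes>\<^sub>M tree_space S"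
    by measurable
  from measurable_compose[OF this Cons]
  have [measurable]: "(\<lambda>p. contrib f (fst p - birth_age S (snd p [])) u (\<lambda>v. snd p (i # v))) \<in> borel_measurable (borel \<Otimes>\<^sub>M tree_space S)"
    by simp
  show ?case unfolding contrib_Cons by measurable
qed

text \<open>Finiteness of the population in a form that quantifies over countable sets only; a
  binary tree has finitely many nodes of bounded depth.\<close>

definition bounded_depth :: "real \<Rightarrow> 'a tree \<Rightarrow> bool" where
  "bounded_depth t \<tau> \<longleftrightarrow> (\<exists>n. \<forall>u. alive S t u \<tau> \<longrightarrow> length u < n)"

lemma finite_lists_shorter: "finite {u :: bool list. length u < n}"
proof -
  have "{u :: bool list. length u < n} \<subseteq> {u. set u \<subseteq> UNIV \<and> length u \<le> n}" by auto
  then show ?thesis 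
    by (rule finite_subset) (rule finite_lists_length_le, simp)
qed

lemma finite_population_iff: "finite (population S t \<tau>) \<longleftrightarrow> bounded_depth t \<tau>"
proof
  assume "finite (population S t \<tau>)"
  then have "finite (length ` population S t \<tau>)" by simp
  then obtain n where "\<forall>l\<in>length ` population S t \<tau>. l < n"
    by (auto simp: finite_nat_set_iff_bounded)
  then show "bounded_depth t \<tau>" by (auto simp: bounded_depth_def population_def)
next
  assume "bounded_depth t \<tau>"
  then obtain n where "population S t \<tau> \<subseteq> {u. length u < n}" by (auto simp: bounded_depth_def population_def)
  then show "finite (population S t \<tau>)" using finite_lists_shorter by (rule finite_subset)
qed

lemma bounded_depth_measurable [measurable (raw)]:
  assumes [measurable]: "f \<in> borel_measurable M" "g \<in> M \<rightarrow>\<^sub>M tree_space S"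
  shows "Measurable.pred M (\<lambda>w. bounded_depth (f w) (g w))"
  unfolding bounded_depth_def by measurable

text \<open>Over an infinite population the sum in \<open>Z_int\<close> is 0 by default, hence the
  second branch. In the first the partial sums are eventually constant.\<close>

lemma Z_int_eq_lim:
  "Z_int S t f \<tau> = (if bounded_depth t \<tau> then lim (\<lambda>n. \<Sum>u | length u < n. contrib f t u \<tau>) else 0)"
proof (cases "bounded_depth t \<tau>")
  case True
  then obtain n0 where n0: "\<And>u. alive S t u \<tau> \<Longrightarrow> length u < n0" by (auto simp: bounded_depth_def)
  have "(\<Sum>u | length u < n. contrib f t u \<tau>) = Z_int S t f \<tau>" if "n0 \<le> n" for n
    unfolding Z_int_def contrib_def using n0 that finite_lists_shorter
    by (intro sum.mono_neutral_cong_right) (auto simp: population_def intro: less_le_trans)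
  then have "(\<lambda>n. \<Sum>u | length u < n. contrib f t u \<tau>) \<longlonglongrightarrow> Z_int S t f \<tau>"
    by (intro tendsto_eventually eventually_sequentiallyI)
  then show ?thesis using True by (simp add: limI)
next
  case False
  then show ?thesis by (simp add: Z_int_def finite_population_iff[symmetric])
qed

lemma Z_int_measurable [measurable (raw)]:
  assumes F: "F \<in> borel_measurable borel" and f [measurable]: "f \<in> borel_measurable M" "g \<in> M \<rightarrow>\<^sub>M tree_space S"
  shows "(\<lambda>w. Z_int S (f w) F (g w)) \<in> borel_measurable M"
proof -
  have "(\<lambda>w. (f w, g w)) \<in> M \<rightarrow>\<^sub>M borel \<Otimes>\<^sub>M tree_space S" by measurable
  from measurable_compose[OF this contrib_measurable_pair[OF F]]
  have [measurable]: "(\<lambda>w. contrib F (f w) u (g w)) \<in> borel_measurable M" for u by simp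
  show ?thesis unfolding Z_int_eq_lim by measurable
qed

section \<open>The population after the first event\<close>

text \<open>Active nodes have nonnegative age, and the time left only shrinks along a line of
  descent. Hence no descendant exists before the birth has happened.\<close>

lemma alive_nonneg: "alive S t u \<tau> \<Longrightarrow> 0 \<le> t"
proof (induction u arbitrary: t \<tau>)
  case Nil
  then show ?case by (simp add: active_at_age_eq)
next
  case (Cons i u)
  then have "alive S (t - birth_age S (\<tau> [])) u (\<lambda>v. \<tau> (i # v))" by simp
  then have "0 \<le> t - birth_age S (\<tau> [])" by (rule Cons.IH)
  then show ?case using birth_age_nonneg[of "\<tau> []"] by linarith
qed

lemma graft_Nil [simp]: "graft m \<tau>0 \<tau>1 [] = m"
  by (simp add: graft_def)

lemma graft_Cons [simp]: "(\<lambda>v. graft m \<tau>0 \<tau>1 (i # v)) = (if i then \<tau>1 else \<tau>0)"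
  by (auto simp: graft_def)

definition born :: "real \<Rightarrow> 'a mark \<Rightarrow> bool" where
  "born t m \<longleftrightarrow> gives_birth S m \<and> birth_age S m \<le> t"

lemma born_measurable [measurable (raw)]:
  assumes [measurable]: "f \<in> borel_measurable M" "g \<in> M \<rightarrow>\<^sub>M mark_space S"
  shows "Measurable.pred M (\<lambda>w. born (f w) (g w))"
  unfolding born_def by measurable

lemma alive_graft_Cons:
  "alive S t (i # u) (graft m \<tau>0 \<tau>1) \<longleftrightarrow> born t m \<and> alive S (t - birth_age S m) u (if i then \<tau>1 else \<tau>0)"
  using alive_nonneg[of "t - birth_age S m" u "if i then \<tau>1 else \<tau>0"] by (auto simp: born_def)

lemma population_graft_active:
  assumes "m \<in> space (mark_space S)" "active_at_age S t m"
  shows "population S t (graft m \<tau>0 \<tau>1) = {[]}"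
proof -
  have "alive S t u (graft m \<tau>0 \<tau>1) \<longleftrightarrow> u = []" for u
    using active_imp_not_born[OF assms] assms(2) by (cases u) (auto simp: alive_graft_Cons born_def simp del: alive.simps(2))
  then show ?thesis by (auto simp: population_def)
qed

lemma population_graft_born:
  assumes "m \<in> space (mark_space S)" "born t m"
  shows "population S t (graft m \<tau>0 \<tau>1) =
    (#) False ` population S (t - birth_age S m) \<tau>0 \<union> (#) True ` population S (t - birth_age S m) \<tau>1"
proof -
  have "\<not> active_at_age S t m" using active_imp_not_born[OF assms(1)] assms(2) by (auto simp: born_def)
  then have "alive S t u (graft m \<tau>0 \<tau>1) \<longleftrightarrow>
    u \<in> (#) False ` population S (t - birth_age S m) \<tau>0 \<union> (#) True ` population S (t - birth_age S m) \<tau>1" for u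
    using assms(2) by (cases u) (auto simp: alive_graft_Cons population_def simp del: alive.simps(2))
  then show ?thesis by (auto simp: population_def)
qed

lemma population_graft_dead:
  assumes "\<not> active_at_age S t m" "\<not> born t m"
  shows "population S t (graft m \<tau>0 \<tau>1) = {}"
proof -
  have "\<not> alive S t u (graft m \<tau>0 \<tau>1)" for u
    using assms by (cases u) (auto simp: alive_graft_Cons simp del: alive.simps(2))
  then show ?thesis by (auto simp: population_def)
qed

lemma Z_int_graft_active:
  assumes "m \<in> space (mark_space S)" "active_at_age S t m"
  shows "Z_int S t f (graft m \<tau>0 \<tau>1) = f (X t (fst m))"
  using assms(2) by (simp add: Z_int_def population_graft_active[OF assms] X_eq active_at_age_eq)

text \<open>Both subpopulations must be finite: if just one were infinite, the left side would be 0
  by default while the right side need not be.\<close>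

lemma Z_int_graft_born:
  assumes "m \<in> space (mark_space S)" "born t m"
    "bounded_depth (t - birth_age S m) \<tau>0" "bounded_depth (t - birth_age S m) \<tau>1"
  shows "Z_int S t f (graft m \<tau>0 \<tau>1) = Z_int S (t - birth_age S m) f \<tau>0 + Z_int S (t - birth_age S m) f \<tau>1"
  using assms(3,4)
  by (simp add: Z_int_def population_graft_born[OF assms(1,2)] finite_population_iff[symmetric],
      subst sum.union_disjoint) (auto simp: sum.reindex)

lemma Z_int_graft_dead:
  assumes "\<not> active_at_age S t m" "\<not> born t m"
  shows "Z_int S t f (graft m \<tau>0 \<tau>1) = 0"
  by (simp add: Z_int_def population_graft_dead[OF assms])

section \<open>The tree law as a kernel, and its recursion\<close>

lemma tree_law_kernel [measurable]: "tree_law S \<in> borel \<rightarrow>\<^sub>M prob_algebra (tree_space S)"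
  using branching by (simp add: branching_process_def)

lemma tree_law_kernel_sub [measurable]: "tree_law S \<in> borel \<rightarrow>\<^sub>M subprob_algebra (tree_space S)"
  by (rule measurable_prob_algebraD) simp

lemma prob_space_tree_law: "prob_space (tree_law S x)"
  and sets_tree_law [measurable_cong, simp]: "sets (tree_law S x) = sets (tree_space S)"
  using measurable_space[OF tree_law_kernel, of x] by (auto simp: space_prob_algebra)

lemma space_tree_law [simp]: "space (tree_law S x) = space (tree_space S)"
  by (rule sets_eq_imp_space_eq) simp

lemma tree_nn_integral_measurable [measurable (raw)]:
  assumes "(\<lambda>(w, \<tau>). f w \<tau>) \<in> borel_measurable (M \<Otimes>\<^sub>M tree_space S)" "Y \<in> borel_measurable M"
  shows "(\<lambda>w. \<integral>\<^sup>+\<tau>. f w \<tau> \<partial>tree_law S (Y w)) \<in> borel_measurable M"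
  by (rule nn_integral_measurable_subprob_algebra2[where N="tree_space S"])
     (use assms in \<open>measurable\<close>)

lemma sets_mark_law [measurable_cong, simp]: "sets (mark_law S x) = sets (mark_space S)"
  unfolding mark_law_def mark_space_def by (intro sets_pair_measure_cong) auto

lemma space_mark_law [simp]: "space (mark_law S x) = space (mark_space S)"
  by (rule sets_eq_imp_space_eq) simp

lemma nn_integral_mark_law:
  assumes [measurable]: "h \<in> borel_measurable (mark_space S)"
  shows "(\<integral>\<^sup>+m. h m \<partial>mark_law S x) = (\<integral>\<^sup>+\<omega>. \<integral>\<^sup>+e. \<integral>\<^sup>+e'. h (\<omega>, e, e') \<partial>exp1 \<partial>exp1 \<partial>motion S x)"
proof -
  interpret E: prob_space exp1 by (rule prob_space_exp1)
  interpret M: prob_space "motion S x" by (rule prob_space_motion)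
  interpret EE: pair_prob_space exp1 exp1 ..
  have [measurable]: "h \<in> borel_measurable (motion S x \<Otimes>\<^sub>M exp1 \<Otimes>\<^sub>M exp1)"
    by (subst measurable_cong_sets[OF sets_mark_law[unfolded mark_law_def] refl]) (rule assms)
  have "(\<integral>\<^sup>+m. h m \<partial>mark_law S x) = (\<integral>\<^sup>+\<omega>. \<integral>\<^sup>+p. h (\<omega>, p) \<partial>(exp1 \<Otimes>\<^sub>M exp1) \<partial>motion S x)"
    unfolding mark_law_def by (rule sigma_finite_measure.nn_integral_fst[OF prob_space_imp_sigma_finite[OF EE.prob_space_axioms], symmetric]) measurable
  also have "\<dots> = (\<integral>\<^sup>+\<omega>. \<integral>\<^sup>+e. \<integral>\<^sup>+e'. h (\<omega>, e, e') \<partial>exp1 \<partial>exp1 \<partial>motion S x)"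
    by (intro nn_integral_cong E.nn_integral_fst[symmetric]) simp
  finally show ?thesis .
qed

text \<open>The fixed-point equation of \<open>branching_process\<close>, read as an iterated
  integral over one mark and two independent trees; the branching property is used in this
  form.\<close>

lemma nn_integral_tree_law:
  assumes \<Phi> [measurable]: "\<Phi> \<in> borel_measurable (tree_space S)"
  shows "(\<integral>\<^sup>+\<tau>. \<Phi> \<tau> \<partial>tree_law S x) = (\<integral>\<^sup>+m. (\<integral>\<^sup>+\<tau>0. (\<integral>\<^sup>+\<tau>1. \<Phi> (graft m \<tau>0 \<tau>1)
     \<partial>tree_law S (birth_trait S m)) \<partial>tree_law S (birth_trait S m)) \<partial>mark_law S x)"
proof -
  have eq: "tree_law S x = mark_law S x \<bind> (\<lambda>m. tree_law S (birth_trait S m) \<bind>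
     (\<lambda>\<tau>0. tree_law S (birth_trait S m) \<bind> (\<lambda>\<tau>1. return (tree_space S) (graft m \<tau>0 \<tau>1))))"
    using branching unfolding branching_process_def by blast
  have 1: "(\<lambda>m. tree_law S (birth_trait S m) \<bind>
     (\<lambda>\<tau>0. tree_law S (birth_trait S m) \<bind> (\<lambda>\<tau>1. return (tree_space S) (graft m \<tau>0 \<tau>1))))
     \<in> mark_space S \<rightarrow>\<^sub>M prob_algebra (tree_space S)"
    by measurable
  have 2: "(\<lambda>\<tau>0. tree_law S y \<bind> (\<lambda>\<tau>1. return (tree_space S) (graft m \<tau>0 \<tau>1)))
     \<in> tree_law S z \<rightarrow>\<^sub>M prob_algebra (tree_space S)" if "m \<in> space (mark_space S)" for m y z
    using that by measurable
  have 3: "(\<lambda>\<tau>1. return (tree_space S) (graft m \<tau>0 \<tau>1)) \<in> tree_law S z \<rightarrow>\<^sub>M prob_algebra (tree_space S)"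
    if "m \<in> space (mark_space S)" "\<tau>0 \<in> space (tree_space S)" for m \<tau>0 z
    using that by measurable
  have "(\<integral>\<^sup>+\<tau>. \<Phi> \<tau> \<partial>tree_law S x) = (\<integral>\<^sup>+m. (\<integral>\<^sup>+\<tau>. \<Phi> \<tau> \<partial>(tree_law S (birth_trait S m) \<bind>
     (\<lambda>\<tau>0. tree_law S (birth_trait S m) \<bind> (\<lambda>\<tau>1. return (tree_space S) (graft m \<tau>0 \<tau>1))))) \<partial>mark_law S x)"
    by (subst eq, rule nn_integral_bind[OF \<Phi>])
       (subst measurable_cong_sets[OF sets_mark_law refl], rule measurable_prob_algebraD[OF 1])
  also have "\<dots> = (\<integral>\<^sup>+m. (\<integral>\<^sup>+\<tau>0. (\<integral>\<^sup>+\<tau>1. \<Phi> (graft m \<tau>0 \<tau>1)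
     \<partial>tree_law S (birth_trait S m)) \<partial>tree_law S (birth_trait S m)) \<partial>mark_law S x)"
  proof (intro nn_integral_cong)
    fix m assume "m \<in> space (mark_law S x)"
    then have m [measurable]: "m \<in> space (mark_space S)" by simp
    show "(\<integral>\<^sup>+\<tau>. \<Phi> \<tau> \<partial>(tree_law S (birth_trait S m) \<bind>
     (\<lambda>\<tau>0. tree_law S (birth_trait S m) \<bind> (\<lambda>\<tau>1. return (tree_space S) (graft m \<tau>0 \<tau>1))))) =
      (\<integral>\<^sup>+\<tau>0. (\<integral>\<^sup>+\<tau>1. \<Phi> (graft m \<tau>0 \<tau>1) \<partial>tree_law S (birth_trait S m)) \<partial>tree_law S (birth_trait S m))"
    proof (subst nn_integral_bind[OF \<Phi> measurable_prob_algebraD[OF 2[OF m]]], intro nn_integral_cong)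
      fix \<tau>0 assume "\<tau>0 \<in> space (tree_law S (birth_trait S m))"
      then have \<tau>0 [measurable]: "\<tau>0 \<in> space (tree_space S)" by simp
      show "(\<integral>\<^sup>+\<tau>. \<Phi> \<tau> \<partial>(tree_law S (birth_trait S m) \<bind> (\<lambda>\<tau>1. return (tree_space S) (graft m \<tau>0 \<tau>1)))) =
        (\<integral>\<^sup>+\<tau>1. \<Phi> (graft m \<tau>0 \<tau>1) \<partial>tree_law S (birth_trait S m))"
      proof (subst nn_integral_bind[OF \<Phi> measurable_prob_algebraD[OF 3[OF m \<tau>0]]], intro nn_integral_cong)
        fix \<tau>1 assume "\<tau>1 \<in> space (tree_law S (birth_trait S m))"
        then have [measurable]: "\<tau>1 \<in> space (tree_space S)" by simp
        have "(\<lambda>_::unit. graft m \<tau>0 \<tau>1) \<in> count_space UNIV \<rightarrow>\<^sub>M tree_space S"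
          by measurable
        then have "graft m \<tau>0 \<tau>1 \<in> space (tree_space S)"
          by (auto dest: measurable_space)
        then show "(\<integral>\<^sup>+\<tau>. \<Phi> \<tau> \<partial>return (tree_space S) (graft m \<tau>0 \<tau>1)) = \<Phi> (graft m \<tau>0 \<tau>1)"
          by (intro nn_integral_return \<Phi>)
      qed
    qed
  qed
  finally show ?thesis .
qed

end

text \<open>
  The generating function at \<open>z\<close> of a Yule process of rate 1, at time \<open>v\<close>: it solves
  \<open>y' = y\<^sup>2 - y\<close>, \<open>y 0 = z\<close>.
\<close>

definition yule_gf :: "real \<Rightarrow> real \<Rightarrow> real" where
  "yule_gf z v = z / (z - (z - 1) * exp v)"

context
  fixes z :: real
  assumes z: "1 \<le> z"
begin

text \<open>The denominator decreases in time, so its positivity at one time guarantees that there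
  is no explosion at any earlier one.\<close>

lemma yule_denominator_mono: "v \<le> w \<Longrightarrow> z - (z - 1) * exp w \<le> z - (z - 1) * exp v"
  using z by (simp add: mult_left_mono)

lemma yule_gf_mono:
  assumes "v \<le> w" "(z - 1) * exp w < z"
  shows "yule_gf z v \<le> yule_gf z w"
  unfolding yule_gf_def using yule_denominator_mono[OF assms(1)] assms z by (intro divide_left_mono) auto

lemma yule_gf_0: "yule_gf z 0 = z"
  by (simp add: yule_gf_def)

lemma yule_gf_ge: "0 \<le> v \<Longrightarrow> (z - 1) * exp v < z \<Longrightarrow> z \<le> yule_gf z v"
  using yule_gf_mono[of 0 v] by (simp add: yule_gf_0)

text \<open>The differential equation in integrated form, which is the renewal equation of the Yule
  process at its first branching time \<open>e\<close>. The derivative of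
  \<open>- (exp (- e) * y (v - e))\<close> is \<open>exp (- e)\<close> times the value of
  \<open>y + y'\<close> at \<open>v - e\<close>, and \<open>y + y' = y\<^sup>2\<close>.\<close>

lemma yule_gf_integral:
  assumes v: "0 \<le> v" "(z - 1) * exp v < z"
  shows "(\<integral>\<^sup>+e\<in>{0..v}. ennreal (exp (- e) * (yule_gf z (v - e))\<^sup>2) \<partial>lborel) + ennreal (z * exp (- v)) =
    ennreal (yule_gf z v)"
proof -
  have pos: "0 < z - (z - 1) * exp (v - e)" if "0 \<le> e" for e
    using yule_denominator_mono[of "v - e" v] that v by auto
  have d: "((\<lambda>e. - (exp (- e) * yule_gf z (v - e))) has_real_derivative exp (- e) * (yule_gf z (v - e))\<^sup>2) (at e)"
    if "0 \<le> e" for e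
  proof -
    have p: "z - (z - 1) * exp (v - e) \<noteq> 0" using pos[OF that] by simp
    show ?thesis
      unfolding yule_gf_def
      by (rule derivative_eq_intros refl p | simp)+
         (use p in \<open>simp add: power2_eq_square divide_simps, simp add: algebra_simps\<close>)
  qed
  have "(\<integral>\<^sup>+e\<in>{0..v}. ennreal (exp (- e) * (yule_gf z (v - e))\<^sup>2) \<partial>lborel) =
    ennreal (- (exp (- v) * yule_gf z (v - v)) - - (exp (- 0) * yule_gf z (v - 0)))"
    by (rule nn_integral_FTC_Icc[OF _ d _ v(1)]) (auto simp: yule_gf_def)
  also have "\<dots> = ennreal (yule_gf z v - z * exp (- v))"
    by (simp add: yule_gf_0 mult.commute)
  also have "\<dots> + ennreal (z * exp (- v)) = ennreal (yule_gf z v)"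
  proof -
    have "z * exp (- v) \<le> z * 1" using z v by (intro mult_left_mono) auto
    then have "0 \<le> yule_gf z v - z * exp (- v)" using yule_gf_ge[OF v] by simp
    then show ?thesis using z by (subst ennreal_plus[symmetric]) auto
  qed
  finally show ?thesis by simp
qed

end

context branching_tree
begin

lemma emeasure_tree_law [simp]: "emeasure (tree_law S x) (space (tree_space S)) = 1"
  using prob_space.emeasure_space_1[OF prob_space_tree_law[of x]] by simp

lemma measure_tree_law [simp]: "measure (tree_law S x) (space (tree_space S)) = 1"
  by (simp add: measure_def)

section \<open>Comparison with a Yule process\<close>

text \<open>Only nodes of depth below \<open>n\<close> are counted, so that the quantity is
  meaningful before the population is known to be finite, and obeys a recursion in
  \<open>n\<close>.\<close>

definition pop_power :: "real \<Rightarrow> nat \<Rightarrow> real \<Rightarrow> 'a tree \<Rightarrow> ennreal" where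
  "pop_power z n t \<tau> = ennreal (z ^ card (population S t \<tau> \<inter> {u. length u < n}))"

lemma pop_power_measurable [measurable (raw)]:
  assumes [measurable]: "f \<in> borel_measurable M" "g \<in> M \<rightarrow>\<^sub>M tree_space S"
  shows "(\<lambda>w. pop_power z n (f w) (g w)) \<in> borel_measurable M"
proof -
  have "z ^ card (population S t \<tau> \<inter> {u. length u < n}) = (\<Prod>u | length u < n. if alive S t u \<tau> then z else 1)" for t \<tau>
    using finite_lists_shorter[of n]
    by (subst prod.inter_filter[symmetric]) (auto simp: population_def intro!: arg_cong[where f="\<lambda>A. z ^ card A"])
  then show ?thesis
    unfolding pop_power_def by simp
qed

lemma card_graft_born:
  assumes "m \<in> space (mark_space S)" "born t m"
  shows "card (population S t (graft m \<tau>0 \<tau>1) \<inter> {u. length u < Suc n}) =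
    card (population S (t - birth_age S m) \<tau>0 \<inter> {u. length u < n}) +
    card (population S (t - birth_age S m) \<tau>1 \<inter> {u. length u < n})"
proof -
  have "population S t (graft m \<tau>0 \<tau>1) \<inter> {u. length u < Suc n} =
     (#) False ` (population S (t - birth_age S m) \<tau>0 \<inter> {u. length u < n}) \<union>
     (#) True ` (population S (t - birth_age S m) \<tau>1 \<inter> {u. length u < n})"
    unfolding population_graft_born[OF assms] by auto
  then show ?thesis
    using finite_lists_shorter[of n]
    by (simp only:) (subst card_Un_disjoint, auto simp: card_image)
qed

text \<open>
  The clock \<open>e\<close> of a birth at age \<open>a\<close> satisfies \<open>e \<le> \<beta> * a\<close>, so a Yule process of rate \<open>\<beta>\<close>
  driven by the same clocks branches earlier.
\<close>

lemma pop_power_bound: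
  assumes z: "1 \<le> z"
  shows "0 \<le> t \<Longrightarrow> (z - 1) * exp (\<beta> * t) < z \<Longrightarrow>
    (\<integral>\<^sup>+\<tau>. pop_power z n t \<tau> \<partial>tree_law S x) \<le> ennreal (yule_gf z (\<beta> * t))"
proof (induction n arbitrary: t x)
  case 0
  have "\<beta> * t \<ge> 0" using 0 \<beta>_pos by simp
  then have "1 \<le> yule_gf z (\<beta> * t)" using yule_gf_ge[OF z] 0 z by force
  then show ?case
    by (simp add: pop_power_def)
next
  case (Suc n)
  let ?G = "yule_gf z"
  have \<beta>t: "0 \<le> \<beta> * t" using Suc.prems \<beta>_pos by simp
  have ge: "z \<le> ?G v" if "0 \<le> v" "v \<le> \<beta> * t" for v
    using yule_gf_ge[OF z that(1)] yule_denominator_mono[OF z that(2)] Suc.prems by simp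
  \<comment> \<open>Marks without a birth by time \<open>t\<close> contribute at most
    \<open>z\<close>; the inequality puts them below the bound for two subtrees.\<close>
  have sq: "z \<le> (?G v)\<^sup>2" if "0 \<le> v" "v \<le> \<beta> * t" for v
  proof -
    have "z * 1 \<le> ?G v * ?G v" using ge[OF that] z by (intro mult_mono) auto
    then show ?thesis by (simp add: power2_eq_square)
  qed
  \<comment> \<open>A bound in terms of the birth clock alone, uniform in the trajectory and the
    death clock: a square, for two subtrees, if a Yule process with this clock branches by time
    \<open>t\<close>, and \<open>z\<close> otherwise. Clocks \<open>e \<le> 0\<close> have
    probability 0 and get a trivial bound.\<close>
  define R :: "real \<Rightarrow> ennreal" where
    "R e = (if e \<le> 0 then \<top> else if e \<le> \<beta> * t then ennreal ((?G (\<beta> * t - e))\<^sup>2) else ennreal z)" for e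
  have Rm [measurable]: "R \<in> borel_measurable borel"
    unfolding R_def yule_gf_def by measurable
  have zR: "ennreal z \<le> R e" for e
    using sq[of "\<beta> * t - e"] by (auto simp: R_def intro!: ennreal_leI)
  have bound: "(\<integral>\<^sup>+\<tau>0. (\<integral>\<^sup>+\<tau>1. pop_power z (Suc n) t (graft m \<tau>0 \<tau>1)
     \<partial>tree_law S (birth_trait S m)) \<partial>tree_law S (birth_trait S m)) \<le> R (fst (snd m))"
    if m: "m \<in> space (mark_space S)" for m
  proof (cases "born t m")
    case False
    have le: "pop_power z (Suc n) t (graft m \<tau>0 \<tau>1) \<le> ennreal z" for \<tau>0 \<tau>1
      using z population_graft_active[OF m, of t \<tau>0 \<tau>1] population_graft_dead[OF _ False, of \<tau>0 \<tau>1]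
      by (cases "active_at_age S t m") (auto simp: pop_power_def ennreal_leI)
    have "(\<integral>\<^sup>+\<tau>0. (\<integral>\<^sup>+\<tau>1. pop_power z (Suc n) t (graft m \<tau>0 \<tau>1)
       \<partial>tree_law S (birth_trait S m)) \<partial>tree_law S (birth_trait S m)) \<le>
      (\<integral>\<^sup>+\<tau>0. (\<integral>\<^sup>+\<tau>1. ennreal z \<partial>tree_law S (birth_trait S m)) \<partial>tree_law S (birth_trait S m))"
      by (intro nn_integral_mono le)
    also have "\<dots> = ennreal z"
      by simp
    finally show ?thesis using zR order_trans by blast
  next
    case True
    obtain \<omega> e e' where me: "m = (\<omega>, e, e')" by (cases m)
    then have \<omega>: "\<omega> \<in> space (paths S)" using m by (simp add: space_mark_space)
    interpret c: bounded_rate "\<lambda>r. birth S (X r \<omega>)" \<beta>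
      by (rule bounded_rate_path[OF birth_path \<omega>])
    define s where "s = t - birth_age S m"
    have rings: "birth_rings S (\<omega>, e, e')" using True by (simp add: born_def gives_birth_eq me)
    have "e \<le> c.cum (birth_age S m)"
      using birth_age_le_iff[OF \<omega> rings birth_age_nonneg, of m] by (simp add: me ring_iff[OF \<omega>])
    also have "\<dots> \<le> \<beta> * birth_age S m"
      using c.cum_Lipschitz[OF birth_age_nonneg[of m]] by simp
    finally have e: "\<beta> * s \<le> \<beta> * t - e" by (simp add: s_def algebra_simps)
    have s: "0 \<le> s" "s \<le> t" using True birth_age_nonneg[of m] by (auto simp: s_def born_def)
    have \<beta>s: "0 \<le> \<beta> * s" using s \<beta>_pos by simp
    have "\<beta> * s \<le> \<beta> * t" using s \<beta>_pos by simp
    then have zs: "(z - 1) * exp (\<beta> * s) < z"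
      using yule_denominator_mono[OF z, of "\<beta> * s" "\<beta> * t"] Suc.prems by simp
    have "(\<integral>\<^sup>+\<tau>0. (\<integral>\<^sup>+\<tau>1. pop_power z (Suc n) t (graft m \<tau>0 \<tau>1)
       \<partial>tree_law S (birth_trait S m)) \<partial>tree_law S (birth_trait S m)) =
       (\<integral>\<^sup>+\<tau>0. (\<integral>\<^sup>+\<tau>1. pop_power z n s \<tau>0 * pop_power z n s \<tau>1
       \<partial>tree_law S (birth_trait S m)) \<partial>tree_law S (birth_trait S m))"
      using z by (simp add: pop_power_def card_graft_born[OF m True] s_def power_add ennreal_mult)
    also have "\<dots> = (\<integral>\<^sup>+\<tau>. pop_power z n s \<tau> \<partial>tree_law S (birth_trait S m)) * (\<integral>\<^sup>+\<tau>. pop_power z n s \<tau> \<partial>tree_law S (birth_trait S m))"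
      by (simp add: nn_integral_cmult nn_integral_multc)
    also have "\<dots> \<le> ennreal (?G (\<beta> * s)) * ennreal (?G (\<beta> * s))"
      by (intro mult_mono Suc.IH s zs) auto
    also have "\<dots> = ennreal ((?G (\<beta> * s))\<^sup>2)"
      using yule_gf_ge[OF z \<beta>s zs] z by (simp add: ennreal_mult power2_eq_square)
    also have "\<dots> \<le> R e"
    proof (cases "0 < e")
      case True
      have "(z - 1) * exp (\<beta> * t - e) < z"
        using yule_denominator_mono[OF z, of "\<beta> * t - e" "\<beta> * t"] Suc.prems True by simp
      from yule_gf_mono[OF z e this] have "?G (\<beta> * s) \<le> ?G (\<beta> * t - e)" .
      then have "(?G (\<beta> * s))\<^sup>2 \<le> (?G (\<beta> * t - e))\<^sup>2"
        using yule_gf_ge[OF z \<beta>s zs] z by (intro power_mono) auto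
      then show ?thesis using True e \<beta>s by (auto simp: R_def ennreal_leI)
    qed (simp add: R_def)
    finally show ?thesis by (simp add: me)
  qed
  have "(\<integral>\<^sup>+\<tau>. pop_power z (Suc n) t \<tau> \<partial>tree_law S x) \<le> (\<integral>\<^sup>+m. R (fst (snd m)) \<partial>mark_law S x)"
    by (subst nn_integral_tree_law) (auto intro!: nn_integral_mono bound)
  also have "\<dots> = (\<integral>\<^sup>+e. R e \<partial>exp1)"
    using prob_space.emeasure_space_1[OF prob_space_exp1] prob_space.emeasure_space_1[OF prob_space_motion]
    by (subst nn_integral_mark_law) auto
  also have "\<dots> = (\<integral>\<^sup>+e\<in>{0<..}. ennreal (exp (- e)) * R e \<partial>lborel)"
    by (rule nn_integral_exp1) measurable
  \<comment> \<open>Splitting at \<open>\<beta> * t\<close> produces the two terms of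
    \<open>yule_gf_integral\<close>.\<close>
  also have "\<dots> = (\<integral>\<^sup>+e. ennreal (exp (- e) * (?G (\<beta> * t - e))\<^sup>2) * indicator {0..\<beta> * t} e +
      ennreal z * (ennreal (exp (- e)) * indicator {\<beta> * t<..} e * indicator {0<..} e) \<partial>lborel)"
    using AE_lborel_singleton[of "0::real"] \<beta>t z
    by (intro nn_integral_cong_AE) (auto simp: R_def indicator_def ennreal_mult mult.commute)
  also have "\<dots> = (\<integral>\<^sup>+e\<in>{0..\<beta> * t}. ennreal (exp (- e) * (?G (\<beta> * t - e))\<^sup>2) \<partial>lborel) +
      ennreal z * (\<integral>\<^sup>+e\<in>{0<..}. ennreal (exp (- e)) * indicator {\<beta> * t<..} e \<partial>lborel)"
    by (subst nn_integral_add, (simp add: yule_gf_def)+) (simp add: nn_integral_cmult)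
  also have "(\<integral>\<^sup>+e\<in>{0<..}. ennreal (exp (- e)) * indicator {\<beta> * t<..} e \<partial>lborel) = ennreal (exp (- (\<beta> * t)))"
    by (subst nn_integral_exp1[symmetric]) (simp_all add: emeasure_exp1_greaterThan[OF \<beta>t])
  finally show ?case
    using yule_gf_integral[OF z \<beta>t Suc.prems(2)] z by (simp add: ennreal_mult)
qed

lemma pop_power_SUP_bound:
  assumes z: "1 \<le> z" and t: "0 \<le> t" "(z - 1) * exp (\<beta> * t) < z"
  shows "(\<integral>\<^sup>+\<tau>. (SUP n. pop_power z n t \<tau>) \<partial>tree_law S x) \<le> ennreal (yule_gf z (\<beta> * t))"
proof -
  have "card (population S t \<tau> \<inter> {u. length u < m}) \<le> card (population S t \<tau> \<inter> {u. length u < n})" if "m \<le> n" for m n \<tau>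
    using that finite_lists_shorter[of n] by (intro card_mono) auto
  then have "incseq (\<lambda>n \<tau>. pop_power z n t \<tau>)"
    using z by (auto simp: incseq_def le_fun_def pop_power_def intro!: ennreal_leI power_increasing)
  then have "(\<integral>\<^sup>+\<tau>. (SUP n. pop_power z n t \<tau>) \<partial>tree_law S x) = (SUP n. \<integral>\<^sup>+\<tau>. pop_power z n t \<tau> \<partial>tree_law S x)"
    by (rule nn_integral_monotone_convergence_SUP) measurable
  also have "\<dots> \<le> ennreal (yule_gf z (\<beta> * t))"
    by (intro SUP_least pop_power_bound z t)
  finally show ?thesis .
qed

lemma pop_power_eventually:
  assumes "bounded_depth t \<tau>" "1 \<le> z"
  shows "ennreal (z ^ card (population S t \<tau>)) \<le> (SUP n. pop_power z n t \<tau>)"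
proof -
  obtain n where "population S t \<tau> \<subseteq> {u. length u < n}"
    using assms by (auto simp: bounded_depth_def population_def)
  then have "pop_power z n t \<tau> = ennreal (z ^ card (population S t \<tau>))"
    by (simp add: pop_power_def Int_absorb2)
  then show ?thesis by (metis SUP_upper UNIV_I)
qed

text \<open>In an infinite population, \<open>k\<close> nodes of bounded depth can be found for
  every \<open>k\<close>, so the supremum of \<open>pop_power\<close> exceeds every
  \<open>z ^ k\<close>. For some \<open>z > 1\<close> this supremum has finite expectation, hence is
  finite almost surely.\<close>

lemma AE_bounded_depth: "AE \<tau> in tree_law S x. bounded_depth t \<tau>"
proof (cases "0 \<le> t")
  case False
  then have "\<not> alive S t u \<tau>" for u \<tau> using alive_nonneg by blast
  then show ?thesis by (simp add: bounded_depth_def)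
next
  case True
  \<comment> \<open>With this choice \<open>(z - 1) * exp (\<beta> * t)\<close> equals 1, which is
    less than \<open>z\<close>.\<close>
  define z where "z = 1 + exp (- (\<beta> * t))"
  have z: "1 < z" "(z - 1) * exp (\<beta> * t) < z" by (auto simp: z_def simp flip: exp_add)
  have "(\<integral>\<^sup>+\<tau>. (SUP n. pop_power z n t \<tau>) \<partial>tree_law S x) \<noteq> \<infinity>"
    using pop_power_SUP_bound[OF less_imp_le[OF z(1)] True z(2), of x] by (auto simp: top_unique)
  then have "AE \<tau> in tree_law S x. (SUP n. pop_power z n t \<tau>) \<noteq> \<infinity>"
    by (rule nn_integral_PInf_AE[rotated]) measurable
  then show ?thesis
  proof eventually_elim
    case (elim \<tau>)
    show ?case
    proof (rule ccontr)
      assume "\<not> bounded_depth t \<tau>"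
      then have inf: "infinite (population S t \<tau>)" by (simp add: finite_population_iff)
      have le: "ennreal (z ^ k) \<le> (SUP n. pop_power z n t \<tau>)" for k
      proof -
        obtain B where B: "finite B" "card B = k" "B \<subseteq> population S t \<tau>"
          using infinite_arbitrarily_large[OF inf] by blast
        obtain n where n: "\<forall>l\<in>length ` B. l < n"
          using B(1) by (metis finite_imageI finite_nat_set_iff_bounded)
        then have "k \<le> card (population S t \<tau> \<inter> {u. length u < n})"
          unfolding B(2)[symmetric] using B finite_lists_shorter[of n] by (intro card_mono) auto
        then have "ennreal (z ^ k) \<le> pop_power z n t \<tau>"
          using z unfolding pop_power_def by (intro ennreal_leI power_increasing) auto
        then show ?thesis by (rule order_trans) (rule SUP_upper, simp)
      qed
      obtain r where r: "(SUP n. pop_power z n t \<tau>) = ennreal r" "0 \<le> r"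
        using elim by (cases "SUP n. pop_power z n t \<tau>") auto
      obtain k where "r < z ^ k" using real_arch_pow[OF z(1)] by blast
      moreover have "z ^ k \<le> r" using le[of k] r by (simp add: ennreal_le_iff)
      ultimately show False by simp
    qed
  qed
qed

lemma nn_integral_card_power:
  assumes z: "1 \<le> z" and t: "0 \<le> t" "(z - 1) * exp (\<beta> * t) < z"
  shows "(\<integral>\<^sup>+\<tau>. ennreal (z ^ card (population S t \<tau>)) \<partial>tree_law S x) \<le> ennreal (yule_gf z (\<beta> * t))"
proof -
  have "(\<integral>\<^sup>+\<tau>. ennreal (z ^ card (population S t \<tau>)) \<partial>tree_law S x) \<le> (\<integral>\<^sup>+\<tau>. (SUP n. pop_power z n t \<tau>) \<partial>tree_law S x)"
    using AE_bounded_depth[where x=x and t=t] by (intro nn_integral_mono_AE) (auto intro: pop_power_eventually z)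
  also have "\<dots> \<le> ennreal (yule_gf z (\<beta> * t))" by (rule pop_power_SUP_bound[OF z t])
  finally show ?thesis .
qed

section \<open>The renewal equation\<close>

context
  fixes \<Psi> :: "real \<Rightarrow> ennreal" and f :: "real \<Rightarrow> real"
  assumes \<Psi> [measurable]: "\<Psi> \<in> borel_measurable borel" and \<Psi>0: "\<Psi> 0 = 0"
    and f [measurable]: "f \<in> borel_measurable borel"
begin

definition mean :: "real \<Rightarrow> real \<Rightarrow> ennreal" where
  "mean t x = (\<integral>\<^sup>+\<tau>. \<Psi> (Z_int S t f \<tau>) \<partial>tree_law S x)"

definition mean2 :: "real \<Rightarrow> real \<Rightarrow> ennreal" where
  "mean2 t x = (\<integral>\<^sup>+\<tau>0. (\<integral>\<^sup>+\<tau>1. \<Psi> (Z_int S t f \<tau>0 + Z_int S t f \<tau>1) \<partial>tree_law S x) \<partial>tree_law S x)"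

lemma mean_measurable [measurable]: "(\<lambda>(t, x). mean t x) \<in> borel_measurable (borel \<Otimes>\<^sub>M borel)"
  unfolding mean_def by measurable

lemma mean2_measurable [measurable]: "(\<lambda>(t, x). mean2 t x) \<in> borel_measurable (borel \<Otimes>\<^sub>M borel)"
  unfolding mean2_def by measurable

text \<open>At time \<open>t\<close> the ancestor is active, has branched, or is dead, and these
  cases exclude each other. Death leaves no term because \<open>\<Psi> 0 = 0\<close>. After a birth,
  additivity over the subtrees holds almost surely, since both populations are almost surely
  finite.\<close>

lemma mean_first_event:
  "mean t x = (\<integral>\<^sup>+m. (if active_at_age S t m then \<Psi> (f (X t (fst m))) else 0) +
     (if born t m then mean2 (t - birth_age S m) (birth_trait S m) else 0) \<partial>mark_law S x)"
proof -
  have "mean t x = (\<integral>\<^sup>+m. (\<integral>\<^sup>+\<tau>0. (\<integral>\<^sup>+\<tau>1. \<Psi> (Z_int S t f (graft m \<tau>0 \<tau>1))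
     \<partial>tree_law S (birth_trait S m)) \<partial>tree_law S (birth_trait S m)) \<partial>mark_law S x)"
    unfolding mean_def by (rule nn_integral_tree_law) measurable
  also have "\<dots> = (\<integral>\<^sup>+m. (if active_at_age S t m then \<Psi> (f (X t (fst m))) else 0) +
     (if born t m then mean2 (t - birth_age S m) (birth_trait S m) else 0) \<partial>mark_law S x)"
  proof (intro nn_integral_cong)
    fix m assume "m \<in> space (mark_law S x)"
    then have m: "m \<in> space (mark_space S)" by simp
    let ?y = "birth_trait S m" and ?s = "t - birth_age S m"
    have one: "(\<integral>\<^sup>+\<tau>0. (\<integral>\<^sup>+\<tau>1. c \<partial>tree_law S ?y) \<partial>tree_law S ?y) = c" for c
      by simp
    consider "active_at_age S t m" "\<not> born t m" | "\<not> active_at_age S t m" "born t m"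
      | "\<not> active_at_age S t m" "\<not> born t m"
      using active_imp_not_born[OF m] by (auto simp: born_def)
    then show "(\<integral>\<^sup>+\<tau>0. (\<integral>\<^sup>+\<tau>1. \<Psi> (Z_int S t f (graft m \<tau>0 \<tau>1)) \<partial>tree_law S ?y) \<partial>tree_law S ?y) =
      (if active_at_age S t m then \<Psi> (f (X t (fst m))) else 0) + (if born t m then mean2 ?s ?y else 0)"
    proof cases
      case 1
      then show ?thesis by (simp add: Z_int_graft_active[OF m] one)
    next
      case 3
      then show ?thesis by (simp add: Z_int_graft_dead \<Psi>0)
    next
      case 2
      have "(\<integral>\<^sup>+\<tau>0. (\<integral>\<^sup>+\<tau>1. \<Psi> (Z_int S t f (graft m \<tau>0 \<tau>1)) \<partial>tree_law S ?y) \<partial>tree_law S ?y) = mean2 ?s ?y"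
        unfolding mean2_def
      proof (rule nn_integral_cong_AE)
        show "AE \<tau>0 in tree_law S ?y. (\<integral>\<^sup>+\<tau>1. \<Psi> (Z_int S t f (graft m \<tau>0 \<tau>1)) \<partial>tree_law S ?y) =
          (\<integral>\<^sup>+\<tau>1. \<Psi> (Z_int S ?s f \<tau>0 + Z_int S ?s f \<tau>1) \<partial>tree_law S ?y)"
          using AE_bounded_depth[where x="?y" and t="?s"]
        proof eventually_elim
          case (elim \<tau>0)
          then show ?case
            using AE_bounded_depth[where x="?y" and t="?s"]
            by (intro nn_integral_cong_AE) (auto simp: Z_int_graft_born[OF m 2(2)])
        qed
      qed
      then show ?thesis using 2 by simp
    qed
  qed
  finally show ?thesis .
qed

text \<open>The clocks are independent of each other and of the trajectory, so the probability that
  both outlast their cumulated rates is the product of the two tails: killing at rate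
  \<open>event_rate\<close>.\<close>

lemma nn_integral_active:
  "(\<integral>\<^sup>+m. (if active_at_age S t m then \<Psi> (f (X t (fst m))) else 0) \<partial>mark_law S x) = Q t (\<lambda>y. \<Psi> (f y)) x"
  if t: "0 \<le> t"
proof -
  have "(\<integral>\<^sup>+m. (if active_at_age S t m then \<Psi> (f (X t (fst m))) else 0) \<partial>mark_law S x) =
    (\<integral>\<^sup>+\<omega>. \<integral>\<^sup>+e. \<integral>\<^sup>+e'. \<Psi> (f (X t \<omega>)) * (indicator {e. rate_over (birth S) 0 t \<omega> < ennreal e} e *
      indicator {e. rate_over (death S) 0 t \<omega> < ennreal e} e') \<partial>exp1 \<partial>exp1 \<partial>motion S x)"
    using t by (subst nn_integral_mark_law) (auto simp: active_at_age_eq indicator_def intro!: nn_integral_cong)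
  also have "\<dots> = (\<integral>\<^sup>+\<omega>. \<Psi> (f (X t \<omega>)) * (exp_neg (rate_over (birth S) 0 t \<omega>) * exp_neg (rate_over (death S) 0 t \<omega>)) \<partial>motion S x)"
    by (simp add: nn_integral_cmult nn_integral_multc nn_integral_exp1_clock)
  also have "\<dots> = Q t (\<lambda>y. \<Psi> (f y)) x"
    unfolding Q_def event_rate_def
    by (intro nn_integral_cong)
       (simp add: rate_over_plus[OF _ _ birth_nonneg death_nonneg] exp_neg_add mult.commute)
  finally show ?thesis .
qed

text \<open>For a fixed trajectory the birth clock is integrated by the substitution
  \<open>e = cum r\<close>: its density turns into the birth rate times the survival of the birth
  clock up to \<open>r\<close>, and the death clock contributes its own survival.\<close>

lemma nn_integral_born:
  assumes t: "0 \<le> t" and k [measurable]: "(\<lambda>(s, y). k s y) \<in> borel_measurable (borel \<Otimes>\<^sub>M borel)"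
  shows "(\<integral>\<^sup>+m. (if born t m then k (t - birth_age S m) (birth_trait S m) else 0) \<partial>mark_law S x) =
    (\<integral>\<^sup>+s\<in>{0<..t}. Q s (\<lambda>y. ennreal (birth S y) * k (t - s) y) x \<partial>lborel)"
proof -
  interpret E: prob_space exp1 by (rule prob_space_exp1)
  define h where "h = (\<lambda>m. if born t m then k (t - birth_age S m) (birth_trait S m) else (0 :: ennreal))"
  have hm [measurable]: "h \<in> borel_measurable (mark_space S)" unfolding h_def by measurable
  have inner: "(\<integral>\<^sup>+e. \<integral>\<^sup>+e'. h (\<omega>, e, e') \<partial>exp1 \<partial>exp1) =
    (\<integral>\<^sup>+s. exp_neg (rate_over event_rate 0 s \<omega>) * (ennreal (birth S (X s \<omega>)) * k (t - s) (X s \<omega>)) * indicator {0<..t} s \<partial>lborel)"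
    if \<omega>: "\<omega> \<in> space (paths S)" for \<omega>
  proof -
    interpret c: bounded_rate "\<lambda>r. birth S (X r \<omega>)" \<beta>
      by (rule bounded_rate_path[OF birth_path \<omega>])
    note [measurable] = X_path_measurable[OF \<omega>]
    have [measurable]: "(\<lambda>(e, e'). h (\<omega>, e, e')) \<in> borel_measurable (borel \<Otimes>\<^sub>M exp1)"
    proof -
      have "(\<lambda>p. (\<omega>, p)) \<in> borel \<Otimes>\<^sub>M exp1 \<rightarrow>\<^sub>M mark_space S"
        unfolding mark_space_def using \<omega> by measurable
      from measurable_compose[OF this hm] show ?thesis by (simp add: split_beta')
    qed
    have [measurable]: "(\<lambda>r. rate_over a 0 r \<omega>) \<in> borel_measurable borel" if [measurable]: "a \<in> borel_measurable borel" for a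
      using \<omega> by measurable
    \<comment> \<open>The integrand as a function of the birth age \<open>r = hit e\<close>; since
      \<open>cum (hit e) = e\<close>, the density \<open>exp (- e)\<close> depends on
      \<open>r\<close> alone.\<close>
    define \<phi> where "\<phi> = (\<lambda>r. ennreal (exp (- c.cum r)) * exp_neg (rate_over (death S) 0 r \<omega>) * k (t - r) (X r \<omega>))"
    have [measurable]: "\<phi> \<in> borel_measurable borel" unfolding \<phi>_def by measurable
    have "(\<integral>\<^sup>+e. \<integral>\<^sup>+e'. h (\<omega>, e, e') \<partial>exp1 \<partial>exp1) = (\<integral>\<^sup>+e\<in>{0<..}. ennreal (exp (- e)) * (\<integral>\<^sup>+e'. h (\<omega>, e, e') \<partial>exp1) \<partial>lborel)"
      by (rule nn_integral_exp1) measurable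
    also have "\<dots> = (\<integral>\<^sup>+e\<in>{0<..c.cum t}. \<phi> (c.hit e) \<partial>lborel)"
    proof (intro nn_integral_cong)
      fix e :: real
      show "ennreal (exp (- e)) * (\<integral>\<^sup>+e'. h (\<omega>, e, e') \<partial>exp1) * indicator {0<..} e = \<phi> (c.hit e) * indicator {0<..c.cum t} e"
      proof (cases "0 < e \<and> e \<le> c.cum t")
        case True
        have rings: "birth_rings S (\<omega>, e, e')" for e'
          using True t by (auto simp: birth_rings.simps ring_iff[OF \<omega>])
        have age: "birth_age S (\<omega>, e, e') = c.hit e" for e'
          using rings[of e'] by (simp add: birth_age.simps ring_iff[OF \<omega>] c.hit_def)
        have "c.hit e \<le> t" using c.hit_le_iff[OF t _ t, of e] True by simp
        then have "h (\<omega>, e, e') = k (t - c.hit e) (X (c.hit e) \<omega>) * indicator {e'. rate_over (death S) 0 (c.hit e) \<omega> < ennreal e'} e'" for e'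
          by (simp add: h_def born_def gives_birth_eq rings age birth_trait_eq indicator_def)
        then have "(\<integral>\<^sup>+e'. h (\<omega>, e, e') \<partial>exp1) = k (t - c.hit e) (X (c.hit e) \<omega>) * exp_neg (rate_over (death S) 0 (c.hit e) \<omega>)"
          by (simp add: nn_integral_cmult nn_integral_exp1_clock)
        then show ?thesis
          using True c.cum_hit[OF t, of e] by (simp add: \<phi>_def ac_simps)
      next
        case False
        \<comment> \<open>Here the clock exceeds the cumulated rate up to \<open>t\<close>, so it
          has not rung by then.\<close>
        have "\<not> born t (\<omega>, e, e')" if "0 < e" for e'
          using birth_age_le_iff[OF \<omega> _ t, of e e'] False that by (auto simp: born_def gives_birth_eq ring_iff[OF \<omega>])
        then show ?thesis using False by (auto simp: indicator_def h_def)
      qed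
    qed
    also have "\<dots> = (\<integral>\<^sup>+r\<in>{0<..t}. ennreal (birth S (X r \<omega>)) * \<phi> r \<partial>lborel)"
      by (rule c.nn_integral_hit[OF t]) measurable
    also have "\<dots> = (\<integral>\<^sup>+s. exp_neg (rate_over event_rate 0 s \<omega>) * (ennreal (birth S (X s \<omega>)) * k (t - s) (X s \<omega>)) * indicator {0<..t} s \<partial>lborel)"
    proof (intro nn_integral_cong)
      fix s
      show "ennreal (birth S (X s \<omega>)) * \<phi> s * indicator {0<..t} s =
         exp_neg (rate_over event_rate 0 s \<omega>) * (ennreal (birth S (X s \<omega>)) * k (t - s) (X s \<omega>)) * indicator {0<..t} s"
      proof (cases "s \<in> {0<..t}")
        case True
        then have "exp_neg (rate_over event_rate 0 s \<omega>) = ennreal (exp (- c.cum s)) * exp_neg (rate_over (death S) 0 s \<omega>)"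
          unfolding event_rate_def
          by (simp add: rate_over_plus[OF _ _ birth_nonneg death_nonneg \<omega>] exp_neg_add exp_neg_ennreal
              rate_over_eq_cum[OF birth_path \<omega> order.refl])
        then show ?thesis by (simp add: \<phi>_def ac_simps)
      qed simp
    qed
    finally show ?thesis .
  qed
  have "(\<integral>\<^sup>+m. h m \<partial>mark_law S x) = (\<integral>\<^sup>+\<omega>. (\<integral>\<^sup>+s. exp_neg (rate_over event_rate 0 s \<omega>) *
     (ennreal (birth S (X s \<omega>)) * k (t - s) (X s \<omega>)) * indicator {0<..t} s \<partial>lborel) \<partial>motion S x)"
    by (subst nn_integral_mark_law[OF hm]) (simp add: inner cong: nn_integral_cong_simp)
  also have "\<dots> = (\<integral>\<^sup>+s. (\<integral>\<^sup>+\<omega>. exp_neg (rate_over event_rate 0 s \<omega>) *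
     (ennreal (birth S (X s \<omega>)) * k (t - s) (X s \<omega>)) * indicator {0<..t} s \<partial>motion S x) \<partial>lborel)"
    by (rule motion_fubini) measurable
  also have "\<dots> = (\<integral>\<^sup>+s\<in>{0<..t}. Q s (\<lambda>y. ennreal (birth S y) * k (t - s) y) x \<partial>lborel)"
    unfolding Q_def by (intro nn_integral_cong nn_integral_multc) measurable
  finally show ?thesis by (simp add: h_def)
qed

theorem mean_equation:
  assumes t: "0 \<le> t"
  shows "mean t x + (\<integral>\<^sup>+s\<in>{0<..t}. P s (\<lambda>y. ennreal (2 * birth S y) * mean (t - s) y) x \<partial>lborel) =
    P t (\<lambda>y. \<Psi> (f y)) x + (\<integral>\<^sup>+s\<in>{0<..t}. P s (\<lambda>y. ennreal (birth S y) * mean2 (t - s) y) x \<partial>lborel)"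
proof (rule renewal_equation_P[OF _ _ _ _ t])
  fix t x :: real assume t: "0 \<le> t"
  have "mean t x = (\<integral>\<^sup>+m. (if active_at_age S t m then \<Psi> (f (X t (fst m))) else 0) \<partial>mark_law S x) +
     (\<integral>\<^sup>+m. (if born t m then mean2 (t - birth_age S m) (birth_trait S m) else 0) \<partial>mark_law S x)"
    unfolding mean_first_event by (rule nn_integral_add) measurable
  then show "mean t x = Q t (\<lambda>y. \<Psi> (f y)) x + (\<integral>\<^sup>+s\<in>{0<..t}. Q s (\<lambda>y. ennreal (birth S y) * mean2 (t - s) y) x \<partial>lborel)"
    by (simp only: nn_integral_active[OF t] nn_integral_born[OF t mean2_measurable])
qed measurable

end

end

lemma (in prob_space) norm_expectation_le:
  fixes f :: "'a \<Rightarrow> 'c::{banach, second_countable_topology}"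
  assumes f: "integrable M f" and B: "\<And>x. x \<in> space M \<Longrightarrow> norm (f x) \<le> B"
  shows "norm (expectation f) \<le> B"
proof -
  have "norm (expectation f) \<le> expectation (\<lambda>x. norm (f x))" by (rule integral_norm_bound)
  also have "\<dots> \<le> expectation (\<lambda>_. B)" by (rule integral_mono) (use f B in auto)
  finally show ?thesis by (simp add: prob_space)
qed

context branching_tree
begin

section \<open>Comparison with the Feynman--Kac operators\<close>

lemma emeasure_motion [simp]: "emeasure (motion S x) (space (paths S)) = 1"
  using prob_space.emeasure_space_1[OF prob_space_motion[of x]] by simp

lemma set_integrable_birth_path:
  assumes \<omega>: "\<omega> \<in> space (paths S)"
  shows "set_integrable lborel {0..t} (\<lambda>s. birth S (X s \<omega>))"
proof -
  note [measurable] = X_path_measurable[OF \<omega>]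
  have "set_integrable lborel {0..t} (\<lambda>s. \<beta>)"
    unfolding set_integrable_def by (intro integrable_scaleR_left integrable_real_indicator) (auto simp: emeasure_lborel_Icc_eq)
  then show ?thesis
    by (rule set_integrable_bound) (auto simp: set_borel_measurable_def birth_nonneg intro!: birth_le order_trans[OF _ abs_ge_self])
qed

text \<open>The conventions for infinite integrals agree. As the birth rate is bounded,
  \<open>V\<close> fails to be integrable along a trajectory exactly when the cumulated death rate
  is infinite, and then both weights are 0.\<close>

lemma FK_weight_eq:
  assumes \<omega>: "\<omega> \<in> space (paths S)" and t: "0 \<le> t"
  shows "FK_weight S t \<omega> = enn2real (growth t \<omega>)"
proof -
  note [measurable] = X_path_measurable[OF \<omega>]
  note ib = set_integrable_birth_path[OF \<omega>, of t]
  have nn: "rate_over a 0 t \<omega> = (\<integral>\<^sup>+s. ennreal (indicator {0..t} s *\<^sub>R a (X s \<omega>)) \<partial>lborel)" for a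
    unfolding rate_over_def using AE_lborel_singleton[of "0::real"]
    by (intro nn_integral_cong_AE) (auto simp: indicator_def)
  have V_pos: "set_integrable lborel {0..t} (\<lambda>s. V S (pos S s \<omega>)) \<longleftrightarrow> set_integrable lborel {0..t} (\<lambda>s. birth S (X s \<omega>) - death S (X s \<omega>))"
    by (intro set_integrable_cong) (auto simp: V_def X_eq)
  have V_int: "(LBINT s:{0..t}. V S (pos S s \<omega>)) = (LBINT s:{0..t}. birth S (X s \<omega>) - death S (X s \<omega>))"
    by (intro set_lebesgue_integral_cong) (auto simp: V_def X_eq)
  have id_iff: "set_integrable lborel {0..t} (\<lambda>s. death S (X s \<omega>)) \<longleftrightarrow> rate_over (death S) 0 t \<omega> \<noteq> \<top>"
  proof -
    have "set_integrable lborel {0..t} (\<lambda>s. death S (X s \<omega>)) \<longleftrightarrow>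
      (\<integral>\<^sup>+s. ennreal (norm (indicator {0..t} s *\<^sub>R death S (X s \<omega>))) \<partial>lborel) < \<infinity>"
      unfolding set_integrable_def integrable_iff_bounded by simp
    then show ?thesis unfolding nn by (simp add: death_nonneg less_top abs_mult)
  qed
  have iV_iff: "set_integrable lborel {0..t} (\<lambda>s. birth S (X s \<omega>) - death S (X s \<omega>)) \<longleftrightarrow> set_integrable lborel {0..t} (\<lambda>s. death S (X s \<omega>))"
  proof
    assume "set_integrable lborel {0..t} (\<lambda>s. birth S (X s \<omega>) - death S (X s \<omega>))"
    from set_integral_diff(1)[OF ib this] show "set_integrable lborel {0..t} (\<lambda>s. death S (X s \<omega>))" by simp
  qed (rule set_integral_diff(1)[OF ib])
  have rb: "rate_over (birth S) 0 t \<omega> = ennreal (LBINT s:{0..t}. birth S (X s \<omega>))"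
    unfolding nn set_lebesgue_integral_def
    by (rule nn_integral_eq_integral) (use ib in \<open>auto simp: set_integrable_def birth_nonneg\<close>)
  show ?thesis
  proof (cases "rate_over (death S) 0 t \<omega> = \<top>")
    case True
    then show ?thesis
      by (simp add: FK_weight_def V_pos iV_iff id_iff growth_def exp_neg_def)
  next
    case False
    then have idt: "set_integrable lborel {0..t} (\<lambda>s. death S (X s \<omega>))" by (simp add: id_iff)
    have rd: "rate_over (death S) 0 t \<omega> = ennreal (LBINT s:{0..t}. death S (X s \<omega>))"
      unfolding nn set_lebesgue_integral_def
      by (rule nn_integral_eq_integral) (use idt in \<open>auto simp: set_integrable_def death_nonneg\<close>)
    have nonneg: "0 \<le> (LBINT s:{0..t}. birth S (X s \<omega>))" "0 \<le> (LBINT s:{0..t}. death S (X s \<omega>))"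
      unfolding set_lebesgue_integral_def by (auto intro!: integral_nonneg_AE simp: birth_nonneg death_nonneg)
    show ?thesis
      using False nonneg
      by (simp add: FK_weight_def V_pos iV_iff id_iff V_int set_integral_diff(2)[OF ib idt] growth_def
          rb rd exp_neg_ennreal ennreal_mult[symmetric] exp_add[symmetric])
  qed
qed

lemma ennreal_FK_weight:
  assumes "\<omega> \<in> space (paths S)" "0 \<le> t"
  shows "ennreal (FK_weight S t \<omega>) = growth t \<omega>"
  using order.strict_trans1[OF growth_le[OF assms], of \<top>] by (simp add: FK_weight_eq[OF assms])

lemma FK_weight_bound:
  assumes "\<omega> \<in> space (paths S)" "0 \<le> t"
  shows "\<bar>FK_weight S t \<omega>\<bar> \<le> exp (\<beta> * t)"
proof -
  have "ennreal (FK_weight S t \<omega>) \<le> ennreal (exp (\<beta> * t))"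
    using growth_le[OF assms] by (simp add: ennreal_FK_weight[OF assms])
  moreover have "0 \<le> FK_weight S t \<omega>" by (simp add: FK_weight_eq[OF assms])
  ultimately show ?thesis by (simp add: ennreal_le_iff)
qed

lemma FK_weight_measurable:
  "0 \<le> t \<Longrightarrow> FK_weight S t \<in> borel_measurable (paths S)"
  by (subst measurable_cong[OF FK_weight_eq]) measurable

lemma FK_defined_bounded:
  fixes g :: "real \<Rightarrow> real"
  assumes t: "0 \<le> t" and [measurable]: "g \<in> borel_measurable borel" and B: "\<And>y. \<bar>g y\<bar> \<le> B"
  shows "FK_defined S t g x"
proof -
  interpret prob_space "motion S x" by (rule prob_space_motion)
  note [measurable] = FK_weight_measurable[OF t]
  have "norm (FK_weight S t \<omega> *\<^sub>R g (X t \<omega>)) \<le> exp (\<beta> * t) * B" if "\<omega> \<in> space (paths S)" for \<omega>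
    using FK_weight_bound[OF that t] B[of "X t \<omega>"] by (simp add: abs_mult mult_mono)
  then have "integrable (motion S x) (\<lambda>\<omega>. FK_weight S t \<omega> *\<^sub>R g (X t \<omega>))"
    by (intro integrable_const_bound[where B="exp (\<beta> * t) * B"] AE_I2) auto
  then show ?thesis using t by (simp add: FK_defined_def X_eq)
qed

lemma P_eq_FK:
  fixes g :: "real \<Rightarrow> real"
  assumes t: "0 \<le> t" and g [measurable]: "g \<in> borel_measurable borel" and B: "\<And>y. g y \<le> B" and nonneg: "\<And>y. 0 \<le> g y"
  shows "P t (\<lambda>y. ennreal (g y)) x = ennreal (FK S t g x)" "0 \<le> FK S t g x"
proof -
  have "integrable (motion S x) (\<lambda>\<omega>. FK_weight S t \<omega> *\<^sub>R g (X t \<omega>))"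
    using FK_defined_bounded[OF t g, of B] B nonneg t by (simp add: FK_defined_def X_eq)
  moreover have w: "0 \<le> FK_weight S t \<omega>" if "\<omega> \<in> space (paths S)" for \<omega>
    by (simp add: FK_weight_eq[OF that t])
  ultimately have "(\<integral>\<^sup>+\<omega>. ennreal (FK_weight S t \<omega> *\<^sub>R g (X t \<omega>)) \<partial>motion S x) = ennreal (FK S t g x)"
    unfolding FK_def using t nonneg by (subst nn_integral_eq_integral) (auto simp: X_eq)
  moreover have "(\<integral>\<^sup>+\<omega>. ennreal (FK_weight S t \<omega> *\<^sub>R g (X t \<omega>)) \<partial>motion S x) = P t (\<lambda>y. ennreal (g y)) x"
    unfolding P_def
    by (intro nn_integral_cong) (simp add: ennreal_mult' nonneg ennreal_FK_weight[OF _ t] mult.commute w)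
  ultimately show "P t (\<lambda>y. ennreal (g y)) x = ennreal (FK S t g x)" by simp
  show "0 \<le> FK S t g x"
    unfolding FK_def using w nonneg by (intro integral_nonneg_AE AE_I2) (auto simp: FK_weight_eq[OF _ t])
qed

section \<open>Time integrals of source terms\<close>

lemma FK_diff:
  fixes g h :: "real \<Rightarrow> 'c::{banach, second_countable_topology}"
  assumes "FK_defined S t g x" "FK_defined S t h x"
  shows "FK_defined S t (\<lambda>y. g y - h y) x" "FK S t (\<lambda>y. g y - h y) x = FK S t g x - FK S t h x"
  using assms by (simp_all add: FK_defined_def FK_def scaleR_diff_right)

text \<open>Measurability and boundedness are asked of a substitute \<open>G'\<close> that matches
  \<open>G\<close> on \<open>{0..t}\<close>. The sources of interest contain Bochner integrals that
  are controlled at these times only and may be default values elsewhere.\<close>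

definition source :: "real \<Rightarrow> (real \<Rightarrow> real \<Rightarrow> real) \<Rightarrow> bool" where
  "source t G \<longleftrightarrow> (\<exists>G' B. (\<lambda>(s, y). G' s y) \<in> borel_measurable (borel \<Otimes>\<^sub>M borel) \<and>
     (\<forall>s\<in>{0..t}. \<forall>y. G s y = G' s y \<and> \<bar>G' s y\<bar> \<le> B))"

abbreviation source_integral :: "real \<Rightarrow> (real \<Rightarrow> real \<Rightarrow> real) \<Rightarrow> real \<Rightarrow> real" where
  "source_integral t G x \<equiv> (LBINT s:{0..t}. FK S s (G s) x)"

lemma sourceI:
  assumes "(\<lambda>(s, y). G s y) \<in> borel_measurable (borel \<Otimes>\<^sub>M borel)" "\<And>s y. s \<in> {0..t} \<Longrightarrow> \<bar>G s y\<bar> \<le> B"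
  shows "source t G"
  unfolding source_def using assms by blast

lemma sourceD:
  assumes "source t G"
  obtains B where "\<And>s. s \<in> {0..t} \<Longrightarrow> G s \<in> borel_measurable borel" "\<And>s y. s \<in> {0..t} \<Longrightarrow> \<bar>G s y\<bar> \<le> B"
proof -
  obtain G' B where G': "(\<lambda>(s, y). G' s y) \<in> borel_measurable (borel \<Otimes>\<^sub>M borel)"
    "\<And>s y. s \<in> {0..t} \<Longrightarrow> G s y = G' s y" "\<And>s y. s \<in> {0..t} \<Longrightarrow> \<bar>G' s y\<bar> \<le> B"
    using assms unfolding source_def by blast
  have "G' s \<in> borel_measurable borel" for s
    using G'(1) by measurable
  moreover have "G s = G' s" if "s \<in> {0..t}" for s using G'(2)[OF that] by auto
  ultimately show ?thesis using that[of B] G'(2,3) by auto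
qed

lemma source_FK_defined: "source t G \<Longrightarrow> s \<in> {0..t} \<Longrightarrow> FK_defined S s (G s) x"
  by (erule sourceD) (auto intro!: FK_defined_bounded)

text \<open>With \<open>growth\<close> and \<open>G'\<close> the integrand gets a version that is
  measurable in time on the whole line; bounds on the weight and on the source make it
  integrable.\<close>

lemma source_defined:
  assumes "source t G"
  shows "FK_source_defined S t G x"
proof -
  interpret prob_space "motion S x" by (rule prob_space_motion)
  obtain G' B where G' [measurable]: "(\<lambda>(s, y). G' s y) \<in> borel_measurable (borel \<Otimes>\<^sub>M borel)"
    and eq: "\<And>s y. s \<in> {0..t} \<Longrightarrow> G s y = G' s y" and B: "\<And>s y. s \<in> {0..t} \<Longrightarrow> \<bar>G' s y\<bar> \<le> B"
    using assms unfolding source_def by blast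
  define F where "F = (\<lambda>s. \<integral>\<omega>. enn2real (growth s \<omega>) *\<^sub>R G' s (X s \<omega>) \<partial>motion S x)"
  have [measurable]: "F \<in> borel_measurable borel" unfolding F_def by measurable
  have F: "FK S s (G s) x = F s" if s: "s \<in> {0..t}" for s
    unfolding FK_def F_def using s
    by (intro Bochner_Integration.integral_cong) (auto simp: FK_weight_eq X_eq eq[OF s])
  have F_bound: "\<bar>F s\<bar> \<le> exp (\<beta> * t) * B" if s: "s \<in> {0..t}" for s
  proof -
    have w: "\<bar>FK_weight S s \<omega>\<bar> \<le> exp (\<beta> * t)" if "\<omega> \<in> space (paths S)" for \<omega>
      using FK_weight_bound[OF that, of s] s \<beta>_pos by (force intro: order_trans)
    have "norm (\<integral>\<omega>. FK_weight S s \<omega> *\<^sub>R G s (pos S s \<omega>) \<partial>motion S x) \<le> exp (\<beta> * t) * B"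
    proof (rule norm_expectation_le)
      show "integrable (motion S x) (\<lambda>\<omega>. FK_weight S s \<omega> *\<^sub>R G s (pos S s \<omega>))"
        using source_FK_defined[OF assms s] by (simp add: FK_defined_def)
      show "norm (FK_weight S s \<omega> *\<^sub>R G s (pos S s \<omega>)) \<le> exp (\<beta> * t) * B" if "\<omega> \<in> space (motion S x)" for \<omega>
        using w[of \<omega>] that B[OF s, of "pos S s \<omega>"] by (simp add: abs_mult mult_mono eq[OF s])
    qed
    then show ?thesis by (simp add: F[OF s, symmetric] FK_def)
  qed
  have "set_integrable lborel {0..t} F"
  proof (rule set_integrable_bound)
    show "set_integrable lborel {0..t} (\<lambda>s. exp (\<beta> * t) * B)"
      unfolding set_integrable_def by (intro integrable_scaleR_left integrable_real_indicator) (auto simp: emeasure_lborel_Icc_eq)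
  qed (use F_bound in \<open>force simp: set_borel_measurable_def\<close>)+
  then have "set_integrable lborel {0..t} (\<lambda>s. FK S s (G s) x)"
    by (subst set_integrable_cong[OF refl refl F]) auto
  then show ?thesis using source_FK_defined[OF assms] by (simp add: FK_source_defined_def)
qed

lemma source_diff:
  assumes G: "source t G" and H: "source t H"
  shows "source t (\<lambda>s y. G s y - H s y)"
    "source_integral t (\<lambda>s y. G s y - H s y) x = source_integral t G x - source_integral t H x"
proof -
  obtain G' B where G' [measurable]: "(\<lambda>(s, y). G' s y) \<in> borel_measurable (borel \<Otimes>\<^sub>M borel)"
    and eqG: "\<And>s y. s \<in> {0..t} \<Longrightarrow> G s y = G' s y" and B: "\<And>s y. s \<in> {0..t} \<Longrightarrow> \<bar>G' s y\<bar> \<le> B"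
    using G unfolding source_def by blast
  obtain H' C where H' [measurable]: "(\<lambda>(s, y). H' s y) \<in> borel_measurable (borel \<Otimes>\<^sub>M borel)"
    and eqH: "\<And>s y. s \<in> {0..t} \<Longrightarrow> H s y = H' s y" and C: "\<And>s y. s \<in> {0..t} \<Longrightarrow> \<bar>H' s y\<bar> \<le> C"
    using H unfolding source_def by blast
  have "(\<lambda>(s, y). G' s y - H' s y) \<in> borel_measurable (borel \<Otimes>\<^sub>M borel)" by measurable
  moreover have "\<forall>s\<in>{0..t}. \<forall>y. G s y - H s y = G' s y - H' s y \<and> \<bar>G' s y - H' s y\<bar> \<le> B + C"
  proof (intro ballI allI conjI)
    fix s y assume s: "s \<in> {0..t}"
    show "G s y - H s y = G' s y - H' s y" using eqG[OF s] eqH[OF s] by simp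
    show "\<bar>G' s y - H' s y\<bar> \<le> B + C" using B[OF s, of y] C[OF s, of y] by linarith
  qed
  ultimately show "source t (\<lambda>s y. G s y - H s y)"
    unfolding source_def by blast
  have "source_integral t (\<lambda>s y. G s y - H s y) x = (LBINT s:{0..t}. FK S s (G s) x - FK S s (H s) x)"
    by (intro set_lebesgue_integral_cong) (auto simp: FK_diff source_FK_defined[OF G] source_FK_defined[OF H])
  also have "\<dots> = source_integral t G x - source_integral t H x"
    using source_defined[OF G, of x] source_defined[OF H, of x]
    by (intro set_integral_diff(2)) (simp_all add: FK_source_defined_def)
  finally show "source_integral t (\<lambda>s y. G s y - H s y) x = source_integral t G x - source_integral t H x" .
qed

text \<open>The bridge from the equation in extended numbers to Bochner integrals; the endpoint 0 is
  a null set.\<close>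

lemma nn_integral_source:
  assumes G: "source t G" and nonneg: "\<And>s y. s \<in> {0..t} \<Longrightarrow> 0 \<le> G s y"
  shows "(\<integral>\<^sup>+s\<in>{0<..t}. P s (\<lambda>y. ennreal (G s y)) x \<partial>lborel) = ennreal (source_integral t G x)"
    "0 \<le> source_integral t G x"
proof -
  obtain B where Gm: "\<And>s. s \<in> {0..t} \<Longrightarrow> G s \<in> borel_measurable borel" and B: "\<And>s y. s \<in> {0..t} \<Longrightarrow> \<bar>G s y\<bar> \<le> B"
    using sourceD[OF G] by blast
  have PF: "P s (\<lambda>y. ennreal (G s y)) x = ennreal (FK S s (G s) x)" "0 \<le> FK S s (G s) x" if s: "s \<in> {0..t}" for s
    using P_eq_FK[OF _ Gm[OF s] _ nonneg[OF s], where B=B and x=x] B[OF s] s by (auto simp: abs_le_iff)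
  have "(\<integral>\<^sup>+s\<in>{0<..t}. P s (\<lambda>y. ennreal (G s y)) x \<partial>lborel) = (\<integral>\<^sup>+s. ennreal (indicator {0..t} s *\<^sub>R FK S s (G s) x) \<partial>lborel)"
    using AE_lborel_singleton[of "0::real"]
    by (intro nn_integral_cong_AE) (auto simp: indicator_def PF)
  also have "\<dots> = ennreal (source_integral t G x)"
    unfolding set_lebesgue_integral_def
    by (rule nn_integral_eq_integral) (use source_defined[OF G, of x] PF in \<open>auto simp: FK_source_defined_def set_integrable_def indicator_def\<close>)
  finally show "(\<integral>\<^sup>+s\<in>{0<..t}. P s (\<lambda>y. ennreal (G s y)) x \<partial>lborel) = ennreal (source_integral t G x)" .
  show "0 \<le> source_integral t G x"
    unfolding set_lebesgue_integral_def by (intro integral_nonneg_AE AE_I2) (auto simp: indicator_def PF)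
qed

end

section \<open>Signed and complex functionals\<close>

lemma integrable_complexI:
  fixes f :: "'b \<Rightarrow> complex"
  assumes "integrable M (\<lambda>x. Re (f x))" "integrable M (\<lambda>x. Im (f x))"
  shows "integrable M f" "integral\<^sup>L M f = Complex (\<integral>x. Re (f x) \<partial>M) (\<integral>x. Im (f x) \<partial>M)"
proof -
  have eq: "f = (\<lambda>x. complex_of_real (Re (f x)) + \<i> * complex_of_real (Im (f x)))"
    by (rule ext) (rule complex_eq)
  show f: "integrable M f"
    by (subst eq) (intro Bochner_Integration.integrable_add integrable_mult_right integrable_of_real assms)
  show "integral\<^sup>L M f = Complex (\<integral>x. Re (f x) \<partial>M) (\<integral>x. Im (f x) \<partial>M)"
    using integral_Re[OF f] integral_Im[OF f] by (simp add: complex_eq_iff)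
qed

lemma set_integrable_complexI:
  fixes f :: "'b \<Rightarrow> complex"
  assumes "set_integrable M A (\<lambda>x. Re (f x))" "set_integrable M A (\<lambda>x. Im (f x))"
  shows "set_integrable M A f"
    "set_lebesgue_integral M A f = Complex (set_lebesgue_integral M A (\<lambda>x. Re (f x))) (set_lebesgue_integral M A (\<lambda>x. Im (f x)))"
  using assms integrable_complexI[of M "\<lambda>x. indicat_real A x *\<^sub>R f x"]
  by (simp_all add: set_integrable_def set_lebesgue_integral_def)

context branching_tree
begin

lemma FK_complexI:
  fixes g :: "real \<Rightarrow> complex"
  assumes "FK_defined S t (\<lambda>y. Re (g y)) x" "FK_defined S t (\<lambda>y. Im (g y)) x"
  shows "FK_defined S t g x" "FK S t g x = Complex (FK S t (\<lambda>y. Re (g y)) x) (FK S t (\<lambda>y. Im (g y)) x)"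
  using assms integrable_complexI[of "motion S x" "\<lambda>\<omega>. FK_weight S t \<omega> *\<^sub>R g (pos S t \<omega>)"]
  by (simp_all add: FK_defined_def FK_def)

lemma FK_source_complexI:
  fixes g :: "real \<Rightarrow> real \<Rightarrow> complex"
  assumes R: "FK_source_defined S t (\<lambda>s y. Re (g s y)) x" and I: "FK_source_defined S t (\<lambda>s y. Im (g s y)) x"
  shows "FK_source_defined S t g x"
    "(LBINT s:{0..t}. FK S s (g s) x) =
      Complex (LBINT s:{0..t}. FK S s (\<lambda>y. Re (g s y)) x) (LBINT s:{0..t}. FK S s (\<lambda>y. Im (g s y)) x)"
proof -
  have d: "FK_defined S s (g s) x" "FK S s (g s) x = Complex (FK S s (\<lambda>y. Re (g s y)) x) (FK S s (\<lambda>y. Im (g s y)) x)"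
    if "s \<in> {0..t}" for s
    using FK_complexI[of s "g s" x] that R I by (auto simp: FK_source_defined_def)
  have Re: "Re (FK S s (g s) x) = FK S s (\<lambda>y. Re (g s y)) x" and Im: "Im (FK S s (g s) x) = FK S s (\<lambda>y. Im (g s y)) x"
    if "s \<in> {0..t}" for s
    using d(2)[OF that] by simp_all
  have "set_integrable lborel {0..t} (\<lambda>s. Re (FK S s (g s) x))"
    using R by (subst set_integrable_cong[OF refl refl Re]) (auto simp: FK_source_defined_def)
  moreover have "set_integrable lborel {0..t} (\<lambda>s. Im (FK S s (g s) x))"
    using I by (subst set_integrable_cong[OF refl refl Im]) (auto simp: FK_source_defined_def)
  ultimately have *: "set_integrable lborel {0..t} (\<lambda>s. FK S s (g s) x)"
    "(LBINT s:{0..t}. FK S s (g s) x) = Complex (LBINT s:{0..t}. Re (FK S s (g s) x)) (LBINT s:{0..t}. Im (FK S s (g s) x))"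
    by (rule set_integrable_complexI)+
  show "FK_source_defined S t g x" using *(1) d(1) by (simp add: FK_source_defined_def)
  have "(LBINT s:{0..t}. Re (FK S s (g s) x)) = (LBINT s:{0..t}. FK S s (\<lambda>y. Re (g s y)) x)"
    "(LBINT s:{0..t}. Im (FK S s (g s) x)) = (LBINT s:{0..t}. FK S s (\<lambda>y. Im (g s y)) x)"
    by (intro set_lebesgue_integral_cong; simp add: Re Im)+
  then show "(LBINT s:{0..t}. FK S s (g s) x) =
      Complex (LBINT s:{0..t}. FK S s (\<lambda>y. Re (g s y)) x) (LBINT s:{0..t}. FK S s (\<lambda>y. Im (g s y)) x)"
    using *(2) by simp
qed

lemma source_cong:
  assumes "source t G" "\<And>s y. s \<in> {0..t} \<Longrightarrow> G s y = H s y"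
  shows "source t H" "source_integral t G x = source_integral t H x"
proof -
  show "source t H" using assms unfolding source_def by force
  have "G s = H s" if "s \<in> {0..t}" for s using assms(2)[OF that] by auto
  then show "source_integral t G x = source_integral t H x"
    by (intro set_lebesgue_integral_cong) auto
qed

text \<open>The Bochner counterpart of \<open>mean\<close>, as \<open>avg2\<close> is of
  \<open>mean2\<close>; the value type covers real and complex functionals.\<close>

definition avg :: "(real \<Rightarrow> 'c::{banach, second_countable_topology}) \<Rightarrow> (real \<Rightarrow> real) \<Rightarrow> real \<Rightarrow> real \<Rightarrow> 'c" where
  "avg \<Psi> f s y = (\<integral>\<tau>. \<Psi> (Z_int S s f \<tau>) \<partial>tree_law S y)"

definition avg2 :: "(real \<Rightarrow> 'c::{banach, second_countable_topology}) \<Rightarrow> (real \<Rightarrow> real) \<Rightarrow> real \<Rightarrow> real \<Rightarrow> 'c" where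
  "avg2 \<Psi> f s y = (\<integral>\<tau>0. (\<integral>\<tau>1. \<Psi> (Z_int S s f \<tau>0 + Z_int S s f \<tau>1) \<partial>tree_law S y) \<partial>tree_law S y)"

end

section \<open>Exponential moments and integrable functionals\<close>

lemma power_div_fact_le_exp:
  fixes v :: real
  assumes "0 \<le> v"
  shows "v ^ n / fact n \<le> exp v"
proof -
  have s: "(\<lambda>n. v ^ n / fact n) sums exp v"
    using exp_converges[of v] by (simp add: divide_inverse_commute)
  have "(\<Sum>k\<in>{n}. v ^ k / fact k) \<le> (\<Sum>k. v ^ k / fact k)"
    using assms by (intro sum_le_suminf sums_summable[OF s]) auto
  then show ?thesis using sums_unique[OF s] by simp
qed

text \<open>The class of functionals that the Yule bound makes integrable, also at the sum of two
  independent copies. Exponentials, powers and indicators belong to it for suitable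
  \<open>a\<close>.\<close>

definition exp_bounded :: "real \<Rightarrow> (real \<Rightarrow> 'c::real_normed_vector) \<Rightarrow> bool" where
  "exp_bounded a \<Psi> \<longleftrightarrow> \<Psi> \<in> borel_measurable borel \<and> (\<exists>C. \<forall>v. norm (\<Psi> v) \<le> C * exp (a * \<bar>v\<bar>))"

text \<open>The bound on \<open>a * M\<close> is the disc condition in abstract form, with
  \<open>a\<close> in the role of \<open>cmod w\<close> and \<open>M\<close> in that of
  \<open>sup_norm f\<close>.\<close>

locale exp_moments = branching_tree S \<beta> for S :: "('a, 'z) branching_model_scheme" and \<beta> +
  fixes f :: "real \<Rightarrow> real" and M a t :: real
  assumes f [measurable]: "f \<in> borel_measurable borel" and f_le: "\<And>y. \<bar>f y\<bar> \<le> M"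
    and a: "0 \<le> a" "a * M < exp (- (\<beta> * t))" and t: "0 \<le> t"
begin

definition E :: real where
  "E = yule_gf (exp (a * M)) (\<beta> * t)"

lemma M_nonneg: "0 \<le> M"
  using f_le[of 0] by simp

lemma z_ge_1: "1 \<le> exp (a * M)"
  using a M_nonneg by simp

text \<open>With \<open>q = exp (- (\<beta> * t))\<close> the claim is
  \<open>exp (a * M) * (1 - q) < 1\<close>; it follows from \<open>1 - q \<le> exp (- q)\<close> and
  \<open>a * M < q\<close>.\<close>

lemma z_less: "(exp (a * M) - 1) * exp (\<beta> * t) < exp (a * M)"
proof -
  define q where "q = exp (- (\<beta> * t))"
  have q: "0 < q" "q \<le> 1" using \<beta>_pos t by (auto simp: q_def)
  have "exp (a * M) * (1 - q) \<le> exp (a * M) * exp (- q)"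
    using exp_ge_add_one_self[of "- q"] by (intro mult_left_mono) auto
  also have "\<dots> < 1" using a by (simp add: q_def flip: exp_add)
  finally have "exp (a * M) - 1 < exp (a * M) * q" by (simp add: algebra_simps)
  then have "(exp (a * M) - 1) * exp (\<beta> * t) < exp (a * M) * q * exp (\<beta> * t)"
    by (rule mult_strict_right_mono) simp
  also have "\<dots> = exp (a * M)" by (simp add: q_def mult.assoc flip: exp_add)
  finally show ?thesis .
qed

lemma E_nonneg: "0 \<le> E"
proof -
  have "0 \<le> \<beta> * t" using t \<beta>_pos by simp
  from yule_gf_ge[OF z_ge_1 this z_less] show ?thesis using z_ge_1 unfolding E_def by linarith
qed

text \<open>Each individual contributes at most \<open>M\<close> in absolute value. Infinite
  populations obey the bound too, as both the sum and the cardinality are then 0 by default.\<close>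

lemma Z_exp_le: "exp (a * \<bar>Z_int S s f \<tau>\<bar>) \<le> exp (a * M) ^ card (population S s \<tau>)"
proof -
  have "\<bar>Z_int S s f \<tau>\<bar> \<le> (\<Sum>u\<in>population S s \<tau>. M)"
    unfolding Z_int_def by (intro order_trans[OF sum_abs] sum_mono f_le)
  then have "a * \<bar>Z_int S s f \<tau>\<bar> \<le> a * (real (card (population S s \<tau>)) * M)"
    using a by (intro mult_left_mono) simp_all
  then have "exp (a * \<bar>Z_int S s f \<tau>\<bar>) \<le> exp (real (card (population S s \<tau>)) * (a * M))"
    by (simp add: ac_simps)
  then show ?thesis by (simp only: exp_of_nat_mult)
qed

lemma nn_integral_exp_Z:
  assumes s: "s \<in> {0..t}"
  shows "(\<integral>\<^sup>+\<tau>. ennreal (exp (a * \<bar>Z_int S s f \<tau>\<bar>)) \<partial>tree_law S y) \<le> ennreal E"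
proof -
  have le: "\<beta> * s \<le> \<beta> * t" using s \<beta>_pos by simp
  have "(\<integral>\<^sup>+\<tau>. ennreal (exp (a * \<bar>Z_int S s f \<tau>\<bar>)) \<partial>tree_law S y) \<le>
    (\<integral>\<^sup>+\<tau>. ennreal (exp (a * M) ^ card (population S s \<tau>)) \<partial>tree_law S y)"
    by (intro nn_integral_mono ennreal_leI Z_exp_le)
  also have "\<dots> \<le> ennreal (yule_gf (exp (a * M)) (\<beta> * s))"
    using s yule_denominator_mono[OF z_ge_1 le] z_less by (intro nn_integral_card_power z_ge_1) auto
  also have "\<dots> \<le> ennreal E"
    unfolding E_def by (intro ennreal_leI yule_gf_mono z_ge_1 le z_less)
  finally show ?thesis .
qed

lemma integrable_exp_Z:
  assumes s: "s \<in> {0..t}"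
  shows "integrable (tree_law S y) (\<lambda>\<tau>. exp (a * \<bar>Z_int S s f \<tau>\<bar>))"
    "(\<integral>\<tau>. exp (a * \<bar>Z_int S s f \<tau>\<bar>) \<partial>tree_law S y) \<le> E"
proof -
  show i: "integrable (tree_law S y) (\<lambda>\<tau>. exp (a * \<bar>Z_int S s f \<tau>\<bar>))"
    using order.strict_trans1[OF nn_integral_exp_Z[OF s, of y], of \<top>]
    by (intro integrableI_bounded) auto
  have "ennreal (\<integral>\<tau>. exp (a * \<bar>Z_int S s f \<tau>\<bar>) \<partial>tree_law S y) \<le> ennreal E"
    using nn_integral_exp_Z[OF s, of y] by (subst nn_integral_eq_integral[symmetric, OF i]) auto
  then show "(\<integral>\<tau>. exp (a * \<bar>Z_int S s f \<tau>\<bar>) \<partial>tree_law S y) \<le> E"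
    using E_nonneg by (simp add: ennreal_le_iff)
qed

lemma integrable_\<Psi>:
  fixes \<Psi> :: "real \<Rightarrow> 'c::{banach, second_countable_topology}"
  assumes [measurable]: "\<Psi> \<in> borel_measurable borel" and C: "\<And>v. norm (\<Psi> v) \<le> C * exp (a * \<bar>v\<bar>)"
    and s: "s \<in> {0..t}"
  shows "integrable (tree_law S y) (\<lambda>\<tau>. \<Psi> (Z_int S s f \<tau>))" "norm (avg \<Psi> f s y) \<le> C * E"
proof -
  have C0: "0 \<le> C" using order_trans[OF norm_ge_zero C[of 0]] by simp
  note ie = integrable_exp_Z[OF s, of y]
  show i: "integrable (tree_law S y) (\<lambda>\<tau>. \<Psi> (Z_int S s f \<tau>))"
    by (rule Bochner_Integration.integrable_bound[OF integrable_mult_right[OF ie(1), of C]])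
       (use C C0 in \<open>auto intro!: AE_I2\<close>)
  have "norm (avg \<Psi> f s y) \<le> (\<integral>\<tau>. norm (\<Psi> (Z_int S s f \<tau>)) \<partial>tree_law S y)"
    unfolding avg_def by (rule integral_norm_bound)
  also have "\<dots> \<le> (\<integral>\<tau>. C * exp (a * \<bar>Z_int S s f \<tau>\<bar>) \<partial>tree_law S y)"
    by (rule integral_mono) (use i ie C in auto)
  also have "\<dots> \<le> C * E" using ie C0 by (simp add: mult_left_mono)
  finally show "norm (avg \<Psi> f s y) \<le> C * E" .
qed

text \<open>By the triangle inequality a shift by \<open>v\<close> costs the factor
  \<open>exp (a * \<bar>v\<bar>)\<close>. So the inner integral again grows at most exponentially in
  \<open>v\<close>, and the one-copy bound can be applied a second time for the outer one.\<close>

lemma integrable_\<Psi>2_inner: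
  fixes \<Psi> :: "real \<Rightarrow> 'c::{banach, second_countable_topology}"
  assumes [measurable]: "\<Psi> \<in> borel_measurable borel" and C: "\<And>v. norm (\<Psi> v) \<le> C * exp (a * \<bar>v\<bar>)"
    and s: "s \<in> {0..t}"
  shows "integrable (tree_law S y) (\<lambda>\<tau>. \<Psi> (v + Z_int S s f \<tau>))"
    "norm (\<integral>\<tau>. \<Psi> (v + Z_int S s f \<tau>) \<partial>tree_law S y) \<le> C * exp (a * \<bar>v\<bar>) * E"
proof -
  have C0: "0 \<le> C" using order_trans[OF norm_ge_zero C[of 0]] by simp
  have "norm (\<Psi> (v + v')) \<le> C * exp (a * \<bar>v\<bar>) * exp (a * \<bar>v'\<bar>)" for v'
  proof -
    have "a * \<bar>v + v'\<bar> \<le> a * (\<bar>v\<bar> + \<bar>v'\<bar>)" using a by (intro mult_left_mono) auto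
    then have "exp (a * \<bar>v + v'\<bar>) \<le> exp (a * \<bar>v\<bar>) * exp (a * \<bar>v'\<bar>)"
      by (simp add: distrib_left flip: exp_add)
    from mult_left_mono[OF this C0] show ?thesis using C[of "v + v'"] by (simp add: mult.assoc)
  qed
  from integrable_\<Psi>[of "\<lambda>v'. \<Psi> (v + v')", OF _ this s, of y]
  show "integrable (tree_law S y) (\<lambda>\<tau>. \<Psi> (v + Z_int S s f \<tau>))"
    "norm (\<integral>\<tau>. \<Psi> (v + Z_int S s f \<tau>) \<partial>tree_law S y) \<le> C * exp (a * \<bar>v\<bar>) * E"
    by (simp_all add: avg_def)
qed

lemma integrable_\<Psi>2:
  fixes \<Psi> :: "real \<Rightarrow> 'c::{banach, second_countable_topology}"
  assumes [measurable]: "\<Psi> \<in> borel_measurable borel" and C: "\<And>v. norm (\<Psi> v) \<le> C * exp (a * \<bar>v\<bar>)"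
    and s: "s \<in> {0..t}"
  shows "integrable (tree_law S y) (\<lambda>\<tau>0. \<integral>\<tau>1. \<Psi> (Z_int S s f \<tau>0 + Z_int S s f \<tau>1) \<partial>tree_law S y)"
    "norm (avg2 \<Psi> f s y) \<le> C * E * E"
proof -
  interpret prob_space "tree_law S y" by (rule prob_space_tree_law)
  define g where "g = (\<lambda>v. \<integral>\<tau>. \<Psi> (v + Z_int S s f \<tau>) \<partial>tree_law S y)"
  have [measurable]: "g \<in> borel_measurable borel" unfolding g_def by measurable
  have "norm (g v) \<le> C * E * exp (a * \<bar>v\<bar>)" for v
    using integrable_\<Psi>2_inner(2)[OF assms(1) C s, of y v] by (simp add: g_def ac_simps)
  from integrable_\<Psi>[of g, OF _ this s, of y]
  show "integrable (tree_law S y) (\<lambda>\<tau>0. \<integral>\<tau>1. \<Psi> (Z_int S s f \<tau>0 + Z_int S s f \<tau>1) \<partial>tree_law S y)"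
    "norm (avg2 \<Psi> f s y) \<le> C * E * E"
    by (simp_all add: g_def avg_def avg2_def)
qed

context
  fixes \<Psi> :: "real \<Rightarrow> real" and C :: real
  assumes \<Psi> [measurable]: "\<Psi> \<in> borel_measurable borel"
    and C: "\<And>v. norm (\<Psi> v) \<le> C * exp (a * \<bar>v\<bar>)" and \<Psi>0: "\<Psi> 0 = 0"
begin

lemma mean_eq_avg:
  assumes nonneg: "\<And>v. 0 \<le> \<Psi> v" and s: "s \<in> {0..t}"
  shows "mean (\<lambda>v. ennreal (\<Psi> v)) f s y = ennreal (avg \<Psi> f s y)" "mean2 (\<lambda>v. ennreal (\<Psi> v)) f s y = ennreal (avg2 \<Psi> f s y)"
    "0 \<le> avg \<Psi> f s y" "0 \<le> avg2 \<Psi> f s y"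
proof -
  have m: "(\<lambda>v. ennreal (\<Psi> v)) \<in> borel_measurable borel" "ennreal (\<Psi> 0) = 0" by (auto simp: \<Psi>0)
  show "mean (\<lambda>v. ennreal (\<Psi> v)) f s y = ennreal (avg \<Psi> f s y)"
    unfolding mean_def[OF m f] avg_def
    by (rule nn_integral_eq_integral[OF integrable_\<Psi>(1)[OF \<Psi> C s]]) (simp add: nonneg)
  show "mean2 (\<lambda>v. ennreal (\<Psi> v)) f s y = ennreal (avg2 \<Psi> f s y)"
    unfolding mean2_def[OF m f] avg2_def
    by (subst nn_integral_eq_integral[OF integrable_\<Psi>2_inner(1)[OF \<Psi> C s]], simp add: nonneg,
        subst nn_integral_eq_integral[OF integrable_\<Psi>2(1)[OF \<Psi> C s]]) (auto simp: nonneg intro!: integral_nonneg_AE)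
  show "0 \<le> avg \<Psi> f s y" "0 \<le> avg2 \<Psi> f s y"
    unfolding avg_def avg2_def by (intro integral_nonneg_AE AE_I2 nonneg)+
qed

text \<open>The jointly measurable substitutes come from the extended-valued \<open>mean\<close> and
  \<open>mean2\<close>, which are measurable in time and trait without restriction.\<close>

lemma avg_source_nonneg:
  assumes nonneg: "\<And>v. 0 \<le> \<Psi> v"
  shows "source t (\<lambda>s y. 2 * birth S y * avg \<Psi> f (t - s) y)" "source t (\<lambda>s y. birth S y * avg2 \<Psi> f (t - s) y)"
proof -
  have m: "(\<lambda>v. ennreal (\<Psi> v)) \<in> borel_measurable borel" "ennreal (\<Psi> 0) = 0" by (auto simp: \<Psi>0)
  note [measurable] = mean_measurable[OF m f] mean2_measurable[OF m f]
  have eq: "enn2real (mean (\<lambda>v. ennreal (\<Psi> v)) f s y) = avg \<Psi> f s y" "enn2real (mean2 (\<lambda>v. ennreal (\<Psi> v)) f s y) = avg2 \<Psi> f s y"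
    if "s \<in> {0..t}" for s y
    using mean_eq_avg[OF nonneg that, of y] by simp_all
  have ts: "t - s \<in> {0..t}" if "s \<in> {0..t}" for s using that by auto
  have bb: "\<bar>birth S y\<bar> \<le> \<beta>" for y using birth_le birth_nonneg by simp
  have "source t (\<lambda>s y. 2 * birth S y * enn2real (mean (\<lambda>v. ennreal (\<Psi> v)) f (t - s) y))"
  proof (rule sourceI)
    fix s y assume "s \<in> {0..t}"
    then have "\<bar>avg \<Psi> f (t - s) y\<bar> \<le> C * E" using integrable_\<Psi>(2)[OF \<Psi> C ts, of s y] by simp
    from mult_mono[OF bb[of y] this] show "\<bar>2 * birth S y * enn2real (mean (\<lambda>v. ennreal (\<Psi> v)) f (t - s) y)\<bar> \<le> 2 * (\<beta> * (C * E))"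
      using \<open>s \<in> {0..t}\<close> \<beta>_pos by (simp add: eq[OF ts] abs_mult)
  qed measurable
  then show "source t (\<lambda>s y. 2 * birth S y * avg \<Psi> f (t - s) y)"
    by (rule source_cong) (simp add: eq[OF ts])
  have "source t (\<lambda>s y. birth S y * enn2real (mean2 (\<lambda>v. ennreal (\<Psi> v)) f (t - s) y))"
  proof (rule sourceI)
    fix s y assume "s \<in> {0..t}"
    then have "\<bar>avg2 \<Psi> f (t - s) y\<bar> \<le> C * E * E" using integrable_\<Psi>2(2)[OF \<Psi> C ts, of s y] by simp
    from mult_mono[OF bb[of y] this] show "\<bar>birth S y * enn2real (mean2 (\<lambda>v. ennreal (\<Psi> v)) f (t - s) y)\<bar> \<le> \<beta> * (C * E * E)"
      using \<open>s \<in> {0..t}\<close> \<beta>_pos by (simp add: eq[OF ts] abs_mult)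
  qed measurable
  then show "source t (\<lambda>s y. birth S y * avg2 \<Psi> f (t - s) y)"
    by (rule source_cong) (simp add: eq[OF ts])
qed

lemma \<Psi>f_bounded: "\<bar>\<Psi> (f y)\<bar> \<le> C * exp (a * M)"
proof -
  have C0: "0 \<le> C" using order_trans[OF norm_ge_zero C[of 0]] by simp
  have "\<bar>\<Psi> (f y)\<bar> \<le> C * exp (a * \<bar>f y\<bar>)" using C[of "f y"] by simp
  also have "\<dots> \<le> C * exp (a * M)" using C0 a f_le[of y] by (intro mult_left_mono) (auto intro: mult_left_mono)
  finally show ?thesis .
qed

text \<open>All terms of \<open>mean_equation\<close> are finite under the exponential bound, so it
  becomes an identity of real numbers.\<close>

lemma avg_equation_nonneg:
  assumes nonneg: "\<And>v. 0 \<le> \<Psi> v"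
  shows "avg \<Psi> f t x + source_integral t (\<lambda>s y. 2 * birth S y * avg \<Psi> f (t - s) y) x =
    FK S t (\<lambda>y. \<Psi> (f y)) x + source_integral t (\<lambda>s y. birth S y * avg2 \<Psi> f (t - s) y) x"
proof -
  have m: "(\<lambda>v. ennreal (\<Psi> v)) \<in> borel_measurable borel" "ennreal (\<Psi> 0) = 0" by (auto simp: \<Psi>0)
  note src = avg_source_nonneg[OF nonneg]
  have ts: "t - s \<in> {0..t}" if "s \<in> {0..t}" for s using that by auto
  have "(\<integral>\<^sup>+s\<in>{0<..t}. P s (\<lambda>y. ennreal (2 * birth S y) * mean (\<lambda>v. ennreal (\<Psi> v)) f (t - s) y) x \<partial>lborel) =
    (\<integral>\<^sup>+s\<in>{0<..t}. P s (\<lambda>y. ennreal (2 * birth S y * avg \<Psi> f (t - s) y)) x \<partial>lborel)"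
    by (intro nn_integral_cong) (auto simp: indicator_def mean_eq_avg[OF nonneg] birth_nonneg ennreal_mult)
  also have "\<dots> = ennreal (source_integral t (\<lambda>s y. 2 * birth S y * avg \<Psi> f (t - s) y) x)"
    by (rule nn_integral_source(1)[OF src(1)]) (simp add: birth_nonneg mean_eq_avg[OF nonneg])
  finally have 1: "(\<integral>\<^sup>+s\<in>{0<..t}. P s (\<lambda>y. ennreal (2 * birth S y) * mean (\<lambda>v. ennreal (\<Psi> v)) f (t - s) y) x \<partial>lborel) =
    ennreal (source_integral t (\<lambda>s y. 2 * birth S y * avg \<Psi> f (t - s) y) x)" .
  have "(\<integral>\<^sup>+s\<in>{0<..t}. P s (\<lambda>y. ennreal (birth S y) * mean2 (\<lambda>v. ennreal (\<Psi> v)) f (t - s) y) x \<partial>lborel) =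
    (\<integral>\<^sup>+s\<in>{0<..t}. P s (\<lambda>y. ennreal (birth S y * avg2 \<Psi> f (t - s) y)) x \<partial>lborel)"
    by (intro nn_integral_cong) (auto simp: indicator_def mean_eq_avg[OF nonneg] birth_nonneg ennreal_mult)
  also have "\<dots> = ennreal (source_integral t (\<lambda>s y. birth S y * avg2 \<Psi> f (t - s) y) x)"
    by (rule nn_integral_source(1)[OF src(2)]) (simp add: birth_nonneg mean_eq_avg[OF nonneg])
  finally have 2: "(\<integral>\<^sup>+s\<in>{0<..t}. P s (\<lambda>y. ennreal (birth S y) * mean2 (\<lambda>v. ennreal (\<Psi> v)) f (t - s) y) x \<partial>lborel) =
    ennreal (source_integral t (\<lambda>s y. birth S y * avg2 \<Psi> f (t - s) y) x)" .
  have 3: "P t (\<lambda>y. ennreal (\<Psi> (f y))) x = ennreal (FK S t (\<lambda>y. \<Psi> (f y)) x)" "0 \<le> FK S t (\<lambda>y. \<Psi> (f y)) x"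
    using \<Psi>f_bounded by (auto intro!: P_eq_FK[OF t, where B="C * exp (a * M)"] nonneg simp: abs_le_iff)
  have nn: "0 \<le> source_integral t (\<lambda>s y. 2 * birth S y * avg \<Psi> f (t - s) y) x"
    "0 \<le> source_integral t (\<lambda>s y. birth S y * avg2 \<Psi> f (t - s) y) x"
    by (intro nn_integral_source(2)[OF src(1)] nn_integral_source(2)[OF src(2)]; simp add: birth_nonneg mean_eq_avg[OF nonneg])+
  have tt: "t \<in> {0..t}" using t by simp
  show ?thesis
    using mean_equation[OF m f t, of x] nn 3(2) mean_eq_avg(3)[OF nonneg tt, of x]
    by (simp add: 1 2 3(1) mean_eq_avg(1)[OF nonneg tt] flip: ennreal_plus)
qed

end

text \<open>The equation is linear in \<open>\<Psi>\<close>, so it passes to differences; the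
  positive and negative parts keep the value 0 at 0 and the growth bound.\<close>

lemma avg_equation:
  fixes \<Psi> :: "real \<Rightarrow> real"
  assumes \<Psi>: "exp_bounded a \<Psi>" and \<Psi>0: "\<Psi> 0 = 0"
  shows "FK_defined S t (\<lambda>y. \<Psi> (f y)) x" "source t (\<lambda>s y. 2 * birth S y * avg \<Psi> f (t - s) y)"
    "source t (\<lambda>s y. birth S y * avg2 \<Psi> f (t - s) y)"
    "avg \<Psi> f t x + source_integral t (\<lambda>s y. 2 * birth S y * avg \<Psi> f (t - s) y) x =
      FK S t (\<lambda>y. \<Psi> (f y)) x + source_integral t (\<lambda>s y. birth S y * avg2 \<Psi> f (t - s) y) x"
proof -
  obtain C where \<Psi>m [measurable]: "\<Psi> \<in> borel_measurable borel" and C: "\<And>v. norm (\<Psi> v) \<le> C * exp (a * \<bar>v\<bar>)"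
    using \<Psi> by (auto simp: exp_bounded_def)
  define A where "A = (\<lambda>v. max 0 (\<Psi> v))"
  define B where "B = (\<lambda>v. max 0 (- \<Psi> v))"
  have m [measurable]: "A \<in> borel_measurable borel" "B \<in> borel_measurable borel" unfolding A_def B_def by measurable
  have AC: "norm (A v) \<le> C * exp (a * \<bar>v\<bar>)" and BC: "norm (B v) \<le> C * exp (a * \<bar>v\<bar>)" for v
    using C[of v] by (auto simp: A_def B_def)
  have A0: "A 0 = 0" "B 0 = 0" by (simp_all add: A_def B_def \<Psi>0)
  have nonneg: "0 \<le> A v" "0 \<le> B v" for v by (simp_all add: A_def B_def)
  have eq: "\<Psi> v = A v - B v" for v by (auto simp: A_def B_def)
  have avg: "avg \<Psi> f s y = avg A f s y - avg B f s y" if s: "s \<in> {0..t}" for s y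
    unfolding avg_def eq
    by (rule Bochner_Integration.integral_diff[OF integrable_\<Psi>(1)[OF m(1) AC s] integrable_\<Psi>(1)[OF m(2) BC s]])
  have avg2: "avg2 \<Psi> f s y = avg2 A f s y - avg2 B f s y" if s: "s \<in> {0..t}" for s y
    unfolding avg2_def eq
    by (simp add: Bochner_Integration.integral_diff[OF integrable_\<Psi>2_inner(1)[OF m(1) AC s] integrable_\<Psi>2_inner(1)[OF m(2) BC s]]
        Bochner_Integration.integral_diff[OF integrable_\<Psi>2(1)[OF m(1) AC s] integrable_\<Psi>2(1)[OF m(2) BC s]])
  have FKd: "FK_defined S t (\<lambda>y. A (f y)) x" "FK_defined S t (\<lambda>y. B (f y)) x"
    using \<Psi>f_bounded[OF m(1) AC A0(1)] \<Psi>f_bounded[OF m(2) BC A0(2)] by (auto intro!: FK_defined_bounded[OF t])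
  show "FK_defined S t (\<lambda>y. \<Psi> (f y)) x" unfolding eq by (rule FK_diff(1)[OF FKd])
  note sA = avg_source_nonneg[OF m(1) AC A0(1) nonneg(1)]
  note sB = avg_source_nonneg[OF m(2) BC A0(2) nonneg(2)]
  note d1 = source_diff[OF sA(1) sB(1)] and d2 = source_diff[OF sA(2) sB(2)]
  have c1: "2 * birth S y * avg A f (t - s) y - 2 * birth S y * avg B f (t - s) y = 2 * birth S y * avg \<Psi> f (t - s) y"
    and c2: "birth S y * avg2 A f (t - s) y - birth S y * avg2 B f (t - s) y = birth S y * avg2 \<Psi> f (t - s) y"
    if "s \<in> {0..t}" for s y
    using that by (auto simp: avg avg2 right_diff_distrib)
  show "source t (\<lambda>s y. 2 * birth S y * avg \<Psi> f (t - s) y)" by (rule source_cong(1)[OF d1(1) c1])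
  show "source t (\<lambda>s y. birth S y * avg2 \<Psi> f (t - s) y)" by (rule source_cong(1)[OF d2(1) c2])
  show "avg \<Psi> f t x + source_integral t (\<lambda>s y. 2 * birth S y * avg \<Psi> f (t - s) y) x =
      FK S t (\<lambda>y. \<Psi> (f y)) x + source_integral t (\<lambda>s y. birth S y * avg2 \<Psi> f (t - s) y) x"
    using avg_equation_nonneg[OF m(1) AC A0(1) nonneg(1), of x] avg_equation_nonneg[OF m(2) BC A0(2) nonneg(2), of x]
      d1(2)[of x] d2(2)[of x] source_cong(2)[OF d1(1) c1, of x] source_cong(2)[OF d2(1) c2, of x]
      avg[of t x] t FK_diff(2)[OF FKd, folded eq]
    by simp
qed

text \<open>With all terms finite, the term with \<open>2 * avg\<close> can be moved to the right,
  where only the remainder \<open>h\<close> survives. This sign fits the moments; the version with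
  the opposite sign fits the squares.\<close>

lemma avg_equation_plus:
  fixes \<Psi> :: "real \<Rightarrow> real"
  assumes \<Psi>: "exp_bounded a \<Psi>" "\<Psi> 0 = 0"
    and h: "\<And>s y. s \<in> {0..t} \<Longrightarrow> avg2 \<Psi> f s y = 2 * avg \<Psi> f s y + h s y"
  shows "FK_source_defined S t (\<lambda>s y. birth S y * h (t - s) y) x"
    "avg \<Psi> f t x = FK S t (\<lambda>y. \<Psi> (f y)) x + source_integral t (\<lambda>s y. birth S y * h (t - s) y) x"
proof -
  note e = avg_equation[OF \<Psi>]
  note d = source_diff[OF e(3) e(2)]
  have c: "birth S y * avg2 \<Psi> f (t - s) y - 2 * birth S y * avg \<Psi> f (t - s) y = birth S y * h (t - s) y" if "s \<in> {0..t}" for s y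
    using that by (simp add: h distrib_left)
  show "FK_source_defined S t (\<lambda>s y. birth S y * h (t - s) y) x"
    by (rule source_defined[OF source_cong(1)[OF d(1) c]])
  show "avg \<Psi> f t x = FK S t (\<lambda>y. \<Psi> (f y)) x + source_integral t (\<lambda>s y. birth S y * h (t - s) y) x"
    using e(4)[of x] d(2)[of x] source_cong(2)[OF d(1) c, of x] by linarith
qed

lemma avg_equation_minus:
  fixes \<Psi> :: "real \<Rightarrow> real"
  assumes \<Psi>: "exp_bounded a \<Psi>" "\<Psi> 0 = 0"
    and h: "\<And>s y. s \<in> {0..t} \<Longrightarrow> avg2 \<Psi> f s y = 2 * avg \<Psi> f s y - h s y"
  shows "FK_source_defined S t (\<lambda>s y. birth S y * h (t - s) y) x"
    "avg \<Psi> f t x = FK S t (\<lambda>y. \<Psi> (f y)) x - source_integral t (\<lambda>s y. birth S y * h (t - s) y) x"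
proof -
  note e = avg_equation[OF \<Psi>]
  note d = source_diff[OF e(2) e(3)]
  have c: "2 * birth S y * avg \<Psi> f (t - s) y - birth S y * avg2 \<Psi> f (t - s) y = birth S y * h (t - s) y" if "s \<in> {0..t}" for s y
    using that by (simp add: h right_diff_distrib)
  show "FK_source_defined S t (\<lambda>s y. birth S y * h (t - s) y) x"
    by (rule source_defined[OF source_cong(1)[OF d(1) c]])
  show "avg \<Psi> f t x = FK S t (\<lambda>y. \<Psi> (f y)) x - source_integral t (\<lambda>s y. birth S y * h (t - s) y) x"
    using e(4)[of x] d(2)[of x] source_cong(2)[OF d(1) c, of x] by linarith
qed

text \<open>Real and imaginary parts are treated separately, with those of \<open>h\<close> as
  remainders. Hence \<open>h\<close> stays abstract: it will be a square, whose real and imaginary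
  parts mix those of the average.\<close>

lemma avg_equation_complex:
  fixes \<Psi> :: "real \<Rightarrow> complex"
  assumes \<Psi>: "exp_bounded a \<Psi>" and \<Psi>0: "\<Psi> 0 = 0"
    and h: "\<And>s y. s \<in> {0..t} \<Longrightarrow> avg2 \<Psi> f s y = 2 * avg \<Psi> f s y - h s y"
  shows "FK_defined S t (\<lambda>y. \<Psi> (f y)) x" "FK_source_defined S t (\<lambda>s y. complex_of_real (birth S y) * h (t - s) y) x"
    "avg \<Psi> f t x = FK S t (\<lambda>y. \<Psi> (f y)) x - (LBINT s:{0..t}. FK S s (\<lambda>y. complex_of_real (birth S y) * h (t - s) y) x)"
proof -
  obtain C where \<Psi>m [measurable]: "\<Psi> \<in> borel_measurable borel" and C: "\<And>v. norm (\<Psi> v) \<le> C * exp (a * \<bar>v\<bar>)"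
    using \<Psi> by (auto simp: exp_bounded_def)
  have R: "exp_bounded a (\<lambda>v. Re (\<Psi> v))" and I: "exp_bounded a (\<lambda>v. Im (\<Psi> v))"
    unfolding exp_bounded_def using order_trans[OF abs_Re_le_cmod C] order_trans[OF abs_Im_le_cmod C] by auto
  have avg: "avg (\<lambda>v. Re (\<Psi> v)) f s y = Re (avg \<Psi> f s y)" "avg (\<lambda>v. Im (\<Psi> v)) f s y = Im (avg \<Psi> f s y)"
    if s: "s \<in> {0..t}" for s y
    unfolding avg_def using integrable_\<Psi>(1)[OF \<Psi>m C s, of y] by simp_all
  have avg2: "avg2 (\<lambda>v. Re (\<Psi> v)) f s y = Re (avg2 \<Psi> f s y)" "avg2 (\<lambda>v. Im (\<Psi> v)) f s y = Im (avg2 \<Psi> f s y)"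
    if s: "s \<in> {0..t}" for s y
    unfolding avg2_def using integrable_\<Psi>2_inner(1)[OF \<Psi>m C s, of y] integrable_\<Psi>2(1)[OF \<Psi>m C s, of y] by simp_all
  have hR: "avg2 (\<lambda>v. Re (\<Psi> v)) f s y = 2 * avg (\<lambda>v. Re (\<Psi> v)) f s y - Re (h s y)"
    and hI: "avg2 (\<lambda>v. Im (\<Psi> v)) f s y = 2 * avg (\<lambda>v. Im (\<Psi> v)) f s y - Im (h s y)" if "s \<in> {0..t}" for s y
    using h[OF that] by (simp_all add: avg[OF that] avg2[OF that])
  have R0: "Re (\<Psi> 0) = 0" "Im (\<Psi> 0) = 0" by (simp_all add: \<Psi>0)
  note ER = avg_equation_minus[OF R R0(1) hR, of x] and EI = avg_equation_minus[OF I R0(2) hI, of x]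
  note K = FK_complexI[OF avg_equation(1)[OF R R0(1)] avg_equation(1)[OF I R0(2)], of x]
  note SC = FK_source_complexI[of t "\<lambda>s y. complex_of_real (birth S y) * h (t - s) y" x]
  show "FK_defined S t (\<lambda>y. \<Psi> (f y)) x" by (rule K(1))
  show "FK_source_defined S t (\<lambda>s y. complex_of_real (birth S y) * h (t - s) y) x"
    by (rule SC(1)) (use ER(1) EI(1) in simp_all)
  have "(LBINT s:{0..t}. FK S s (\<lambda>y. complex_of_real (birth S y) * h (t - s) y) x) =
    Complex (source_integral t (\<lambda>s y. birth S y * Re (h (t - s) y)) x) (source_integral t (\<lambda>s y. birth S y * Im (h (t - s) y)) x)"
    using SC(2) ER(1) EI(1) by simp
  moreover have tt: "t \<in> {0..t}" using t by simp
  ultimately show "avg \<Psi> f t x = FK S t (\<lambda>y. \<Psi> (f y)) x - (LBINT s:{0..t}. FK S s (\<lambda>y. complex_of_real (birth S y) * h (t - s) y) x)"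
    using ER(2) EI(2) K(2) by (simp add: avg[OF tt] complex_eq_iff)
qed

section \<open>Generating function, moments and survival\<close>

text \<open>The hypothesis says that \<open>1 - \<Psi>\<close> is multiplicative, so by independence
  \<open>1 - avg2\<close> is the square of \<open>1 - avg\<close>. It is asked on values of
  \<open>Z_int\<close> only: the indicator of nonzero numbers has this property among nonnegative
  numbers, but not across signs.\<close>

lemma avg2_multiplicative:
  fixes \<Psi> :: "real \<Rightarrow> 'c::{real_normed_field, banach, second_countable_topology}"
  assumes \<Psi>: "exp_bounded a \<Psi>" and s: "s \<in> {0..t}"
    and mult: "\<And>\<tau>0 \<tau>1. \<Psi> (Z_int S s f \<tau>0 + Z_int S s f \<tau>1) =
      \<Psi> (Z_int S s f \<tau>0) + \<Psi> (Z_int S s f \<tau>1) - \<Psi> (Z_int S s f \<tau>0) * \<Psi> (Z_int S s f \<tau>1)"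
  shows "avg2 \<Psi> f s y = 2 * avg \<Psi> f s y - (avg \<Psi> f s y)\<^sup>2"
proof -
  interpret prob_space "tree_law S y" by (rule prob_space_tree_law)
  obtain C where m: "\<Psi> \<in> borel_measurable borel" and C: "\<And>v. norm (\<Psi> v) \<le> C * exp (a * \<bar>v\<bar>)"
    using \<Psi> by (auto simp: exp_bounded_def)
  note i = integrable_\<Psi>(1)[OF m C s, of y]
  let ?u = "\<integral>\<tau>. \<Psi> (Z_int S s f \<tau>) \<partial>tree_law S y"
  have "(\<integral>\<tau>1. \<Psi> (Z_int S s f \<tau>0 + Z_int S s f \<tau>1) \<partial>tree_law S y) = \<Psi> (Z_int S s f \<tau>0) + ?u - \<Psi> (Z_int S s f \<tau>0) * ?u" for \<tau>0
    unfolding mult using i by simp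
  then show ?thesis
    unfolding avg2_def avg_def using i by (simp add: power2_eq_square)
qed

lemma gf_exp_bounded:
  assumes w: "cmod w \<le> a"
  shows "exp_bounded a (\<lambda>v. 1 - exp (w * complex_of_real v))"
proof -
  have "cmod (1 - exp (w * complex_of_real v)) \<le> 2 * exp (a * \<bar>v\<bar>)" for v
  proof -
    have "cmod (1 - exp (w * complex_of_real v)) \<le> 1 + cmod (exp (w * complex_of_real v))"
      using norm_triangle_ineq4[of 1 "exp (w * complex_of_real v)"] by simp
    also have "\<dots> \<le> 1 + exp (cmod w * \<bar>v\<bar>)"
      using norm_exp[of "w * complex_of_real v"] by (simp add: norm_mult)
    also have "\<dots> \<le> exp (a * \<bar>v\<bar>) + exp (a * \<bar>v\<bar>)"
      using w a by (intro add_mono) (auto intro: mult_right_mono)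
    finally show ?thesis by simp
  qed
  then show ?thesis by (auto simp: exp_bounded_def)
qed

lemma H_fun_eq_avg: "H_fun S f s y w = avg (\<lambda>v. 1 - exp (w * complex_of_real v)) f s y"
  by (simp add: H_fun_def avg_def)

lemma gf_integrable:
  assumes "cmod w \<le> a"
  shows "integrable (tree_law S x) (\<lambda>\<tau>. 1 - exp (w * complex_of_real (Z_int S t f \<tau>)))"
proof -
  obtain C where "\<And>v. norm (1 - exp (w * complex_of_real v)) \<le> C * exp (a * \<bar>v\<bar>)"
    using gf_exp_bounded[OF assms] by (auto simp: exp_bounded_def)
  from integrable_\<Psi>(1)[of "\<lambda>v. 1 - exp (w * complex_of_real v)", OF _ this, of t x] t show ?thesis by simp
qed

lemma gf_equation:
  assumes w: "cmod w \<le> a"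
  shows "FK_defined S t (\<lambda>y. 1 - exp (w * complex_of_real (f y))) x"
    "FK_source_defined S t (\<lambda>s y. complex_of_real (birth S y) * (H_fun S f (t - s) y w)\<^sup>2) x"
    "H_fun S f t x w = FK S t (\<lambda>y. 1 - exp (w * complex_of_real (f y))) x -
      (LBINT s:{0..t}. FK S s (\<lambda>y. complex_of_real (birth S y) * (H_fun S f (t - s) y w)\<^sup>2) x)"
proof -
  have "avg2 (\<lambda>v. 1 - exp (w * complex_of_real v)) f s y =
    2 * avg (\<lambda>v. 1 - exp (w * complex_of_real v)) f s y - (H_fun S f s y w)\<^sup>2" if "s \<in> {0..t}" for s y
    unfolding H_fun_eq_avg
    by (rule avg2_multiplicative[OF gf_exp_bounded[OF w] that]) (simp add: exp_add algebra_simps)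
  from avg_equation_complex[OF gf_exp_bounded[OF w] _ this]
  show "FK_defined S t (\<lambda>y. 1 - exp (w * complex_of_real (f y))) x"
    "FK_source_defined S t (\<lambda>s y. complex_of_real (birth S y) * (H_fun S f (t - s) y w)\<^sup>2) x"
    "H_fun S f t x w = FK S t (\<lambda>y. 1 - exp (w * complex_of_real (f y))) x -
      (LBINT s:{0..t}. FK S s (\<lambda>y. complex_of_real (birth S y) * (H_fun S f (t - s) y w)\<^sup>2) x)"
    by (simp_all add: H_fun_eq_avg[of t x])
qed

text \<open>Expectation and exponential series are exchanged, since the partial sums of absolute
  values stay below \<open>exp (a * \<bar>Z\<bar>)\<close>, which is integrable. The coefficient at
  \<open>n = 0\<close> is 0, the moment of order 0 being 1.\<close>

lemma gf_power_series:
  assumes w: "cmod w \<le> a"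
  shows "(\<lambda>n. ((if n = 0 then 1 else 0) - complex_of_real (moment S f n t x) / fact n) * w ^ n) sums H_fun S f t x w"
proof -
  interpret prob_space "tree_law S x" by (rule prob_space_tree_law)
  have tt: "t \<in> {0..t}" using t by simp
  define F where "F = (\<lambda>n v. (if n = 0 then 1 else 0) - (w * complex_of_real v) ^ n / fact n)"
  have F_le: "norm (F n v) \<le> (a * \<bar>v\<bar>) ^ n / fact n" for n v
  proof (cases n)
    case (Suc m)
    have "cmod w * \<bar>v\<bar> \<le> a * \<bar>v\<bar>" using w by (intro mult_right_mono) auto
    then have "(cmod w * \<bar>v\<bar>) ^ n \<le> (a * \<bar>v\<bar>) ^ n" by (intro power_mono) auto
    then show ?thesis using Suc
      by (simp add: F_def norm_divide norm_power norm_mult divide_right_mono del: power_Suc fact_Suc)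
  qed (simp add: F_def)
  have F_sums: "(\<lambda>n. F n v) sums (1 - exp (w * complex_of_real v))" for v
    unfolding F_def
    using sums_diff[OF sums_single[of 0 "\<lambda>_. 1 :: complex"] exp_converges[of "w * complex_of_real v"]]
    by (simp add: scaleR_conv_of_real divide_inverse mult.commute cong: if_cong)
  have exp_sums: "summable (\<lambda>n. (a * \<bar>v\<bar>) ^ n / fact n)" "(\<Sum>n. (a * \<bar>v\<bar>) ^ n / fact n) = exp (a * \<bar>v\<bar>)" for v
  proof -
    have *: "(\<lambda>n. (a * \<bar>v\<bar>) ^ n / fact n) sums exp (a * \<bar>v\<bar>)"
      using exp_converges[of "a * \<bar>v\<bar>"] by (simp add: divide_inverse_commute)
    show "summable (\<lambda>n. (a * \<bar>v\<bar>) ^ n / fact n)" by (rule sums_summable[OF *])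
    show "(\<Sum>n. (a * \<bar>v\<bar>) ^ n / fact n) = exp (a * \<bar>v\<bar>)" by (rule sums_unique[OF *, symmetric])
  qed
  have F_le_exp: "norm (F n v) \<le> 1 * exp (a * \<bar>v\<bar>)" for n v
    using F_le[of n v] power_div_fact_le_exp[of "a * \<bar>v\<bar>" n] a by simp
  have Fm [measurable]: "F n \<in> borel_measurable borel" for n
    unfolding F_def by measurable
  note i = integrable_\<Psi>(1)[OF Fm F_le_exp tt, where y=x]
  have "(\<lambda>n. \<integral>\<tau>. F n (Z_int S t f \<tau>) \<partial>tree_law S x) sums (\<integral>\<tau>. (\<Sum>n. F n (Z_int S t f \<tau>)) \<partial>tree_law S x)"
  proof (rule sums_integral)
    show "integrable (tree_law S x) (\<lambda>\<tau>. F n (Z_int S t f \<tau>))" for n by (rule i)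
    show "AE \<tau> in tree_law S x. summable (\<lambda>n. norm (F n (Z_int S t f \<tau>)))"
      using F_le by (intro AE_I2 summable_comparison_test[OF _ exp_sums(1)]) auto
    show "summable (\<lambda>n. \<integral>\<tau>. norm (F n (Z_int S t f \<tau>)) \<partial>tree_law S x)"
    proof (rule summableI_nonneg_bounded)
      fix n
      have "(\<Sum>k<n. \<integral>\<tau>. norm (F k (Z_int S t f \<tau>)) \<partial>tree_law S x) = (\<integral>\<tau>. (\<Sum>k<n. norm (F k (Z_int S t f \<tau>))) \<partial>tree_law S x)"
        using i by (intro Bochner_Integration.integral_sum[symmetric]) auto
      also have "\<dots> \<le> (\<integral>\<tau>. exp (a * \<bar>Z_int S t f \<tau>\<bar>) \<partial>tree_law S x)"
      proof (rule integral_mono)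
        fix \<tau>
        have "(\<Sum>k<n. norm (F k (Z_int S t f \<tau>))) \<le> (\<Sum>k<n. (a * \<bar>Z_int S t f \<tau>\<bar>) ^ k / fact k)"
          by (intro sum_mono F_le)
        also have "\<dots> \<le> (\<Sum>k. (a * \<bar>Z_int S t f \<tau>\<bar>) ^ k / fact k)"
          using a by (intro sum_le_suminf exp_sums) auto
        finally show "(\<Sum>k<n. norm (F k (Z_int S t f \<tau>))) \<le> exp (a * \<bar>Z_int S t f \<tau>\<bar>)"
          by (simp add: exp_sums(2))
      qed (use i integrable_exp_Z(1)[OF tt] in auto)
      also have "\<dots> \<le> E" by (rule integrable_exp_Z(2)[OF tt])
      finally show "(\<Sum>k<n. \<integral>\<tau>. norm (F k (Z_int S t f \<tau>)) \<partial>tree_law S x) \<le> E" .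
    qed simp
  qed
  also have "(\<integral>\<tau>. (\<Sum>n. F n (Z_int S t f \<tau>)) \<partial>tree_law S x) = H_fun S f t x w"
    by (simp add: H_fun_def sums_unique[OF F_sums, symmetric])
  also have "(\<lambda>n. \<integral>\<tau>. F n (Z_int S t f \<tau>) \<partial>tree_law S x) =
    (\<lambda>n. ((if n = 0 then 1 else 0) - complex_of_real (moment S f n t x) / fact n) * w ^ n)"
  proof
    fix n
    show "(\<integral>\<tau>. F n (Z_int S t f \<tau>) \<partial>tree_law S x) =
      ((if n = 0 then 1 else 0) - complex_of_real (moment S f n t x) / fact n) * w ^ n"
    proof (cases "n = 0")
      case True
      then show ?thesis by (simp add: F_def moment_def)
    next
      case False
      then have "F n (Z_int S t f \<tau>) = (- (w ^ n) / fact n) * complex_of_real (Z_int S t f \<tau> ^ n)" for \<tau>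
        by (simp add: F_def power_mult_distrib)
      then have "(\<integral>\<tau>. F n (Z_int S t f \<tau>) \<partial>tree_law S x) = (- (w ^ n) / fact n) * complex_of_real (moment S f n t x)"
        unfolding moment_def by (simp only: integral_mult_right_zero integral_complex_of_real)
      then show ?thesis using False by simp
    qed
  qed
  finally show ?thesis .
qed

text \<open>The power series converges at the real point \<open>a\<close>, hence may be
  differentiated termwise in the open disc of radius \<open>a\<close>, where it represents
  \<open>H_fun\<close>.\<close>

lemma H_fun_differentiable:
  assumes w: "cmod w < a"
  shows "H_fun S f t x field_differentiable at w"
proof -
  define c where "c = (\<lambda>n. (if n = 0 then 1 else 0) - complex_of_real (moment S f n t x) / fact n)"
  have "summable (\<lambda>n. c n * complex_of_real a ^ n)"
    using sums_summable[OF gf_power_series[of "complex_of_real a"]] a(1) by (simp add: c_def)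
  moreover have "norm w < norm (complex_of_real a)" using w a by simp
  ultimately have "((\<lambda>w. \<Sum>n. c n * w ^ n) has_field_derivative (\<Sum>n. diffs c n * w ^ n)) (at w)"
    by (rule termdiffs_strong)
  then have "(H_fun S f t x has_field_derivative (\<Sum>n. diffs c n * w ^ n)) (at w)"
  proof (rule has_field_derivative_transform_within_open)
    show "open (ball (0::complex) a)" "w \<in> ball 0 a" using w by auto
    fix v :: complex assume "v \<in> ball 0 a"
    then have "cmod v \<le> a" by simp
    from sums_unique[OF gf_power_series[OF this]] show "(\<Sum>n. c n * v ^ n) = H_fun S f t x v"
      by (simp add: c_def)
  qed
  then show ?thesis by (auto simp: field_differentiable_def)
qed

text \<open>One term of the exponential series of \<open>a * \<bar>v\<bar>\<close> is at most its
  sum, whence the constant \<open>fact n / a ^ n\<close>.\<close>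

lemma power_exp_bounded:
  assumes "0 < a"
  shows "exp_bounded a (\<lambda>v::real. v ^ n)"
proof -
  have "norm (v ^ n) \<le> (fact n / a ^ n) * exp (a * \<bar>v\<bar>)" for v :: real
  proof -
    have "(a * \<bar>v\<bar>) ^ n = a ^ n * \<bar>v ^ n\<bar>" by (simp add: power_mult_distrib power_abs)
    then have "a ^ n * \<bar>v ^ n\<bar> / fact n \<le> exp (a * \<bar>v\<bar>)"
      using power_div_fact_le_exp[of "a * \<bar>v\<bar>" n] assms by simp
    then show ?thesis using assms by (simp add: field_simps)
  qed
  then show ?thesis unfolding exp_bounded_def by (intro conjI exI[of _ "fact n / a ^ n"] allI) auto
qed

lemma moment_eq_avg: "moment S f n s y = avg (\<lambda>v. v ^ n) f s y"
  by (simp add: moment_def avg_def)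

lemma avg2_power:
  assumes "0 < a" and s: "s \<in> {0..t}"
  shows "integrable (tree_law S y) (\<lambda>\<tau>. Z_int S s f \<tau> ^ n)"
    "avg2 (\<lambda>v. v ^ n) f s y = (\<Sum>k\<le>n. real (n choose k) * moment S f k s y * moment S f (n - k) s y)"
proof -
  interpret prob_space "tree_law S y" by (rule prob_space_tree_law)
  have i: "integrable (tree_law S y) (\<lambda>\<tau>. Z_int S s f \<tau> ^ n)" for n
  proof -
    obtain C where C: "\<And>v. norm (v ^ n) \<le> C * exp (a * \<bar>v\<bar>)"
      using power_exp_bounded[OF assms(1), of n] unfolding exp_bounded_def by blast
    show ?thesis by (rule integrable_\<Psi>(1)[OF _ C s]) simp
  qed
  then show "integrable (tree_law S y) (\<lambda>\<tau>. Z_int S s f \<tau> ^ n)" .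
  have inner: "(\<integral>\<tau>1. (Z_int S s f \<tau>0 + Z_int S s f \<tau>1) ^ n \<partial>tree_law S y) =
    (\<Sum>k\<le>n. real (n choose k) * Z_int S s f \<tau>0 ^ k * moment S f (n - k) s y)" for \<tau>0
    unfolding binomial_ring moment_def using i
    by (subst Bochner_Integration.integral_sum) auto
  show "avg2 (\<lambda>v. v ^ n) f s y = (\<Sum>k\<le>n. real (n choose k) * moment S f k s y * moment S f (n - k) s y)"
    unfolding avg2_def inner using i
    by (subst Bochner_Integration.integral_sum) (auto simp: moment_def)
qed

lemma moment_0: "moment S f 0 s y = 1"
  by (simp add: moment_def)

text \<open>For the identity, the mean over two copies is exactly twice the mean: the remainder
  vanishes, and so does the source term.\<close>

lemma moment_1_equation:
  assumes a0: "0 < a"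
  shows "FK_defined S t f x" "moment S f 1 t x = FK S t f x"
proof -
  have h: "avg2 (\<lambda>v. v ^ 1) f s y = 2 * avg (\<lambda>v. v ^ 1) f s y + (\<lambda>_ _. 0) s y" if "s \<in> {0..t}" for s y
    using avg2_power(2)[OF a0 that, where y=y and n=1] by (simp add: moment_0) (simp add: moment_def avg_def)
  note e = avg_equation_plus[OF power_exp_bounded[OF a0, of 1] _ h]
  show "FK_defined S t f x"
    using avg_equation(1)[OF power_exp_bounded[OF a0, of 1]] by simp
  have "FK S s (\<lambda>_. 0 :: real) x = 0" for s by (simp add: FK_def)
  then show "moment S f 1 t x = FK S t f x"
    using e(2)[of x] by (simp add: moment_eq_avg)
qed

lemma moment_equation:
  assumes a0: "0 < a" and n: "2 \<le> n"
  defines "h \<equiv> \<lambda>s y. \<Sum>k=1..n-1. real (n choose k) * moment S f (n - k) s y * moment S f k s y"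
  shows "FK_source_defined S t (\<lambda>s y. birth S y * h (t - s) y) x"
    "moment S f n t x = FK S t (\<lambda>y. f y ^ n) x + (LBINT s:{0..t}. FK S s (\<lambda>y. birth S y * h (t - s) y) x)"
proof -
  \<comment> \<open>The binomial terms at \<open>0\<close> and \<open>n\<close> are the two copies
    of \<open>avg\<close> that the equation absorbs; the terms in between form
    \<open>h\<close>.\<close>
  have set: "{..n} = insert 0 (insert n {1..n-1})" using n by auto
  have h: "avg2 (\<lambda>v. v ^ n) f s y = 2 * avg (\<lambda>v. v ^ n) f s y + h s y" if "s \<in> {0..t}" for s y
    unfolding avg2_power(2)[OF a0 that] h_def set using n
    by (subst sum.insert, simp, simp, subst sum.insert)
       (auto simp: moment_0 moment_eq_avg[of n, symmetric] mult_ac intro!: sum.cong)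
  show "FK_source_defined S t (\<lambda>s y. birth S y * h (t - s) y) x"
    by (rule avg_equation_plus(1)[OF power_exp_bounded[OF a0, of n] _ h]) (use n in auto)
  show "moment S f n t x = FK S t (\<lambda>y. f y ^ n) x + (LBINT s:{0..t}. FK S s (\<lambda>y. birth S y * h (t - s) y) x)"
    unfolding moment_eq_avg[of n] by (rule avg_equation_plus(2)[OF power_exp_bounded[OF a0, of n] _ h]) (use n in auto)
qed

end

context branching_tree
begin

text \<open>Moments need some positive exponent, however small. The \<open>+ 1\<close> in the
  denominator covers \<open>M = 0\<close> and makes the required inequality strict.\<close>

lemma exp_moments_small_exponent:
  assumes "f \<in> borel_measurable borel" "\<And>y. \<bar>f y\<bar> \<le> M" "0 \<le> t"
  shows "\<exists>a>0. exp_moments S \<beta> f M a t"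
proof (intro exI conjI)
  have M: "0 \<le> M" using assms(2)[of 0] by simp
  show "0 < exp (- (\<beta> * t)) / (M + 1)" using M by simp
  have "exp (- (\<beta> * t)) / (M + 1) * M < exp (- (\<beta> * t))"
    using M by (simp add: field_simps)
  then show "exp_moments S \<beta> f M (exp (- (\<beta> * t)) / (M + 1)) t"
    using assms M by unfold_locales auto
qed

text \<open>The indicator is bounded, so exponent 0 suffices for its equation; a positive exponent
  serves only to identify the first term with the first moment.\<close>

lemma survival_equation:
  assumes t: "0 \<le> t"
  shows "FK_source_defined S t (\<lambda>s y. birth S y * (survival S (t - s) y)\<^sup>2) x"
    "survival S t x = moment S (\<lambda>_. 1) 1 t x -
      (LBINT s:{0..t}. FK S s (\<lambda>y. birth S y * (survival S (t - s) y)\<^sup>2) x)"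
proof -
  interpret e: exp_moments S \<beta> "\<lambda>_. 1" 1 0 t
    using t by unfold_locales auto
  define \<Psi> :: "real \<Rightarrow> real" where "\<Psi> = (\<lambda>v. if v = 0 then 0 else 1)"
  have N0: "0 \<le> N S s \<tau>" for s \<tau> by (simp add: N_def Z_int_def)
  have \<Psi>: "exp_bounded 0 \<Psi>"
    unfolding exp_bounded_def \<Psi>_def by (auto intro!: exI[of _ 1])
  have surv: "survival S s y = avg \<Psi> (\<lambda>_. 1) s y" for s y
  proof -
    have [measurable]: "N S s \<in> borel_measurable (tree_space S)"
      unfolding N_def by (rule Z_int_measurable[of _ "\<lambda>_. s" _ "\<lambda>\<tau>. \<tau>"]) auto
    have "avg \<Psi> (\<lambda>_. 1) s y = (\<integral>\<tau>. indicator {\<tau> \<in> space (tree_law S y). 0 < N S s \<tau>} \<tau> \<partial>tree_law S y)"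
      unfolding avg_def N_def[symmetric]
      using N0 by (intro Bochner_Integration.integral_cong) (auto simp: \<Psi>_def indicator_def less_le)
    also have "\<dots> = survival S s y" by (simp add: survival_def Int_absorb2)
    finally show ?thesis by simp
  qed
  \<comment> \<open>Population sizes are nonnegative, so the sum of two vanishes only if both
    do.\<close>
  have h: "avg2 \<Psi> (\<lambda>_. 1) s y = 2 * avg \<Psi> (\<lambda>_. 1) s y - (survival S s y)\<^sup>2" if "s \<in> {0..t}" for s y
    unfolding surv
    by (rule e.avg2_multiplicative[OF \<Psi> that]) (use N0 in \<open>auto simp: \<Psi>_def N_def add_nonneg_eq_0_iff\<close>)
  have \<Psi>0: "\<Psi> 0 = 0" by (simp add: \<Psi>_def)
  note eq = e.avg_equation_minus[OF \<Psi> \<Psi>0 h, of x]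
  obtain a' where "0 < a'" "exp_moments S \<beta> (\<lambda>_. 1) 1 a' t"
    using exp_moments_small_exponent[of "\<lambda>_. 1" 1 t] t by auto
  then have "moment S (\<lambda>_. 1) 1 t x = FK S t (\<lambda>_. 1) x"
    by (intro exp_moments.moment_1_equation)
  then show "survival S t x = moment S (\<lambda>_. 1) 1 t x -
      (LBINT s:{0..t}. FK S s (\<lambda>y. birth S y * (survival S (t - s) y)\<^sup>2) x)"
    using eq(2) by (simp add: surv[of t] \<Psi>_def)
  show "FK_source_defined S t (\<lambda>s y. birth S y * (survival S (t - s) y)\<^sup>2) x" by (rule eq(1))
qed

end

section \<open>From the disc to the admissible exponents, and the final assembly\<close>

lemma bcontfun_sup_norm:
  assumes "(f :: real \<Rightarrow> real) \<in> bcontfun"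
  shows "f \<in> borel_measurable borel" "\<bar>f y\<bar> \<le> sup_norm f"
proof -
  show "f \<in> borel_measurable borel"
    using assms by (auto simp: bcontfun_def intro: borel_measurable_continuous_onI)
  have "bounded (range f)" using assms by (simp add: bcontfun_def)
  then have "bdd_above (range (\<lambda>x. norm (f x)))"
    by (auto simp: bounded_iff bdd_above_def)
  then have "norm (f y) \<le> sup_norm f" unfolding sup_norm_def by (rule cSUP_upper2) auto
  then show "\<bar>f y\<bar> \<le> sup_norm f" by simp
qed

text \<open>The radius for the horizon \<open>T\<close> serves every \<open>t \<le> T\<close>, since
  \<open>exp (- (b * t))\<close> decreases in \<open>t\<close>. For \<open>M = 0\<close> the radius
  is infinite and the product is 0.\<close>

lemma mem_discD:
  assumes w: "ereal r < inverse (ereal (M * exp (b * T)))" and M: "0 \<le> M" and r: "0 \<le> r" and b: "0 \<le> b" "t \<le> T"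
  shows "r * M < exp (- (b * t))"
proof (cases "M = 0")
  case False
  then have "0 < M" using M by simp
  then have "r < inverse (M * exp (b * T))" using w by simp
  then have "r * M < exp (- (b * T))" using \<open>0 < M\<close> by (simp add: exp_minus field_simps)
  also have "\<dots> \<le> exp (- (b * t))" using b by (simp add: mult_left_mono)
  finally show ?thesis .
qed simp

theorem proposition4p4:
  fixes S :: "'a branching_model" and bstar :: real
  assumes "markov_process S"
    and "branching_process S"
    and "HV S bstar"
    and "HP S"
  shows
    "(\<forall>f\<in>bcontfun. \<forall>T.
        (\<forall>t\<in>{0..T}. \<forall>x. \<forall>w\<in>disc f bstar T.
           integrable (tree_law S x) (\<lambda>\<tau>. 1 - exp (w * complex_of_real (Z_int S t f \<tau>)))) \<and>
        (\<forall>t\<in>{0..T}. \<forall>x.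
           H_fun S f t x analytic_on disc f bstar T \<and>
           (\<forall>w\<in>disc f bstar T.
              FK_defined S t (\<lambda>y. 1 - exp (w * complex_of_real (f y))) x \<and>
              FK_source_defined S t
                (\<lambda>s y. complex_of_real (birth S y) * (H_fun S f (t - s) y w)\<^sup>2) x \<and>
              H_fun S f t x w =
                FK S t (\<lambda>y. 1 - exp (w * complex_of_real (f y))) x -
                (LBINT s:{0..t}.
                   FK S s (\<lambda>y. complex_of_real (birth S y) * (H_fun S f (t - s) y w)\<^sup>2) x))))
     \<and>
     (\<forall>t\<ge>0. \<forall>x.
        FK_source_defined S t (\<lambda>s y. birth S y * (survival S (t - s) y)\<^sup>2) x \<and>
        survival S t x =
          moment S (\<lambda>_. 1) 1 t x -
          (LBINT s:{0..t}. FK S s (\<lambda>y. birth S y * (survival S (t - s) y)\<^sup>2) x))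
     \<and>
     (\<forall>t\<ge>0. \<forall>x. \<forall>f\<in>bcontfun.
        (\<forall>n\<ge>1. integrable (tree_law S x) (\<lambda>\<tau>. Z_int S t f \<tau> ^ n)) \<and>
        FK_defined S t f x \<and>
        moment S f 1 t x = (\<integral>\<tau>. Z_int S t f \<tau> \<partial>tree_law S x) \<and>
        moment S f 1 t x = FK S t f x \<and>
        (\<forall>n\<ge>2.
           FK_source_defined S t
             (\<lambda>s y. birth S y *
                (\<Sum>k=1..n-1. real (n choose k) * moment S f (n - k) (t - s) y * moment S f k (t - s) y)) x \<and>
           moment S f n t x =
             moment S (\<lambda>y. f y ^ n) 1 t x +
             (LBINT s:{0..t}.
                FK S s
                  (\<lambda>y. birth S y *
                     (\<Sum>k=1..n-1. real (n choose k) * moment S f (n - k) (t - s) y * moment S f k (t - s) y)) x)))"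
proof -
  interpret branching_tree S bstar
    using assms(1-3) by unfold_locales
  have disc: "exp_moments S bstar f (sup_norm f) r t"
    if f: "f \<in> bcontfun" and t: "t \<in> {0..T}" and r: "0 \<le> r" "ereal r < inverse (ereal (sup_norm f * exp (bstar * T)))"
    for f T t r
  proof -
    have "0 \<le> sup_norm f" using bcontfun_sup_norm(2)[OF f, of 0] by simp
    from mem_discD[OF r(2) this r(1) _, of t] show ?thesis
      using bcontfun_sup_norm[OF f] t r \<beta>_pos by unfold_locales auto
  qed
  have analytic: "H_fun S f t x analytic_on disc f bstar T" if f: "f \<in> bcontfun" and t: "t \<in> {0..T}" for f T t x
    unfolding analytic_on_def
  proof
    fix w assume "w \<in> disc f bstar T"
    then have "ereal (cmod w) < inverse (ereal (sup_norm f * exp (bstar * T)))" by (simp add: disc_def)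
    \<comment> \<open>Analyticity concerns a neighbourhood of \<open>w\<close>, so an exponent
      \<open>r\<close> strictly between \<open>cmod w\<close> and the radius is chosen; it works on
      the whole ball of radius \<open>r - cmod w\<close>.\<close>
    then obtain r where r: "ereal (cmod w) < ereal r" "ereal r < inverse (ereal (sup_norm f * exp (bstar * T)))"
      using ereal_dense2 by blast
    then have r0: "0 \<le> r" using norm_ge_zero[of w] by (simp del: norm_ge_zero)
    interpret exp_moments S bstar f "sup_norm f" r t by (rule disc[OF f t r0 r(2)])
    have "H_fun S f t x holomorphic_on ball w (r - cmod w)"
      unfolding holomorphic_on_def
    proof
      fix v assume "v \<in> ball w (r - cmod w)"
      then have "cmod v < r" using norm_triangle_sub[of v w] by (simp add: dist_norm norm_minus_commute)
      then show "H_fun S f t x field_differentiable at v within ball w (r - cmod w)"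
        by (rule field_differentiable_at_within[OF H_fun_differentiable])
    qed
    then show "\<exists>e>0. H_fun S f t x holomorphic_on ball w e"
      using r by (intro exI[of _ "r - cmod w"]) simp
  qed
  have gf: "integrable (tree_law S x) (\<lambda>\<tau>. 1 - exp (w * complex_of_real (Z_int S t f \<tau>)))"
    "FK_defined S t (\<lambda>y. 1 - exp (w * complex_of_real (f y))) x"
    "FK_source_defined S t (\<lambda>s y. complex_of_real (birth S y) * (H_fun S f (t - s) y w)\<^sup>2) x"
    "H_fun S f t x w = FK S t (\<lambda>y. 1 - exp (w * complex_of_real (f y))) x -
      (LBINT s:{0..t}. FK S s (\<lambda>y. complex_of_real (birth S y) * (H_fun S f (t - s) y w)\<^sup>2) x)"
    if f: "f \<in> bcontfun" and t: "t \<in> {0..T}" and w: "w \<in> disc f bstar T" for f T t x w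
  proof -
    \<comment> \<open>For the equation at a single \<open>w\<close> the exponent
      \<open>cmod w\<close> itself is enough, since \<open>gf_equation\<close> allows
      equality.\<close>
    interpret exp_moments S bstar f "sup_norm f" "cmod w" t
      using w by (intro disc[OF f t]) (simp_all add: disc_def)
    show "integrable (tree_law S x) (\<lambda>\<tau>. 1 - exp (w * complex_of_real (Z_int S t f \<tau>)))"
      by (rule gf_integrable) simp
    show "FK_defined S t (\<lambda>y. 1 - exp (w * complex_of_real (f y))) x"
      "FK_source_defined S t (\<lambda>s y. complex_of_real (birth S y) * (H_fun S f (t - s) y w)\<^sup>2) x"
      "H_fun S f t x w = FK S t (\<lambda>y. 1 - exp (w * complex_of_real (f y))) x -
      (LBINT s:{0..t}. FK S s (\<lambda>y. complex_of_real (birth S y) * (H_fun S f (t - s) y w)\<^sup>2) x)"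
      by (rule gf_equation; simp)+
  qed
  have moments: "\<forall>n. integrable (tree_law S x) (\<lambda>\<tau>. Z_int S t f \<tau> ^ n)"
    "FK_defined S t f x" "moment S f 1 t x = FK S t f x"
    "\<forall>n\<ge>2. FK_source_defined S t
             (\<lambda>s y. birth S y *
                (\<Sum>k=1..n-1. real (n choose k) * moment S f (n - k) (t - s) y * moment S f k (t - s) y)) x \<and>
           moment S f n t x =
             moment S (\<lambda>y. f y ^ n) 1 t x +
             (LBINT s:{0..t}.
                FK S s
                  (\<lambda>y. birth S y *
                     (\<Sum>k=1..n-1. real (n choose k) * moment S f (n - k) (t - s) y * moment S f k (t - s) y)) x)"
    if t: "0 \<le> t" and f: "f \<in> bcontfun" for t x f
  proof -
    note fb = bcontfun_sup_norm[OF f]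
    obtain a where a0: "0 < a" and em: "exp_moments S bstar f (sup_norm f) a t"
      using exp_moments_small_exponent[OF fb t] by blast
    interpret exp_moments S bstar f "sup_norm f" a t by (rule em)
    show "\<forall>n. integrable (tree_law S x) (\<lambda>\<tau>. Z_int S t f \<tau> ^ n)"
      using avg2_power(1)[OF a0] t by simp
    show "FK_defined S t f x" "moment S f 1 t x = FK S t f x"
      by (rule moment_1_equation[OF a0])+
    \<comment> \<open>The function \<open>f ^ n\<close> is bounded as well, so the first-moment
      formula, with an exponent of its own, identifies the inhomogeneous term of the moment
      equation.\<close>
    have "moment S (\<lambda>y. f y ^ n) 1 t x = FK S t (\<lambda>y. f y ^ n) x" for n
    proof -
      have "(\<lambda>y. f y ^ n) \<in> borel_measurable borel" using fb(1) by measurable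
      moreover have "\<bar>f y ^ n\<bar> \<le> sup_norm f ^ n" for y
        using fb(2)[of y] by (simp add: power_abs power_mono)
      ultimately obtain a' where "0 < a'" "exp_moments S bstar (\<lambda>y. f y ^ n) (sup_norm f ^ n) a' t"
        using exp_moments_small_exponent[of "\<lambda>y. f y ^ n" "sup_norm f ^ n" t] t by blast
      then show ?thesis by (intro exp_moments.moment_1_equation)
    qed
    then show "\<forall>n\<ge>2. FK_source_defined S t
             (\<lambda>s y. birth S y *
                (\<Sum>k=1..n-1. real (n choose k) * moment S f (n - k) (t - s) y * moment S f k (t - s) y)) x \<and>
           moment S f n t x =
             moment S (\<lambda>y. f y ^ n) 1 t x +
             (LBINT s:{0..t}.
                FK S s
                  (\<lambda>y. birth S y *
                     (\<Sum>k=1..n-1. real (n choose k) * moment S f (n - k) (t - s) y * moment S f k (t - s) y)) x)"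
      using moment_equation[OF a0] by simp
  qed
  have one: "moment S f 1 t x = (\<integral>\<tau>. Z_int S t f \<tau> \<partial>tree_law S x)" for f t x
    by (simp add: moment_def)
  show ?thesis
    apply (intro conjI ballI allI impI)
    subgoal by (rule gf(1))
    subgoal by (rule analytic)
    subgoal by (rule gf(2))
    subgoal by (rule gf(3))
    subgoal by (rule gf(4))
    subgoal by (rule survival_equation(1))
    subgoal by (rule survival_equation(2))
    subgoal using moments(1) by blast
    subgoal by (rule moments(2))
    subgoal by (rule one)
    subgoal by (rule moments(3))
    subgoal by (rule moments(4)[rule_format, THEN conjunct1])
    subgoal by (rule moments(4)[rule_format, THEN conjunct2])
    done
qed

end
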